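(* (Switchback relations.) Let $(W,S)$ be a Coxeter system, let $s\in S$, $J\subset S$ with $s\notin J$ and $Js$ finitary, and let $t\in Js$ (possibly $t=s$). Let $I=Js\setminus\{t\}$ and let $p$ be the $(J,I)$-coset containing $w_{Js}$. (1) If $s=w_{Js}tw_{Js}$, then $[J+s-t]$ is the unique reduced expression of $p$. (2) If $s\ne w_{Js}tw_{Js}$, then $p$ has exactly two reduced expressions. Namely, let $(u_i)_{i\in\mathbb Z}$ be the rotation sequence of $(J,s,t)$, $I_i=Js\setminus\{u_i\}$ and $L_i=Js\setminus\{u_i,u_{i-1}\}$. Let $\delta$ be the largest integer such that $[I_0,L_1,I_1,\dots,L_k,I_k]$ is reduced for all $1\le k\le\delta$. Then $u_\delta=t$, and the two reduced expressions of $p$ are the two sides of $$[J+s-t]\leftrightharpoons[J-u_1+s-u_2+u_1-u_3+u_2-u_4\cdots-u_{\delta-1}+u_{\delta-2}-t+u_{\delta-1}]=[J=I_0,L_1,I_1,L_2,I_2,\dots,L_\delta,I_\delta=I].$$ Moreover, $u_{\delta+1}=w_{Js}sw_{Js}$.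
   Context: Let $(W,S)$ be a Coxeter system with identity $e$ and Bruhat order $\le$. For $I\subset S$ let $W_I$ be the parabolic subgroup generated by $I$; $I$ is finitary if $W_I$ is finite, and then $w_I$ is the longest element of $W_I$. Write $Is=I\sqcup\{s\}$. For finitary $I,J$, a $(J,I)$-coset is a double coset $p\in W_J\backslash W/W_I$ (the pair $(J,I)$ is part of the data); it has a unique Bruhat-maximal element $\overline{p}$ and a unique Bruhat-minimal element $\underline{p}$. Expressions: an expression is a sequence $[I_0,\dots,I_d]$ of finitary subsets, consecutive ones differing by adding or removing exactly one element of $S$. Notation such as $[J+s-t]$ means $[J,\,J\sqcup\{s\},\,(J\sqcup\{s\})\setminus\{t\}]$, and similarly for longer strings. The forward path of $I_\bullet=[I_0,\dots,I_d]$ is the sequence $p_0,\dots,p_d$ where $p_i$ is an $(I_0,I_i)$-coset, $e\in p_0$; if $I_i\subset I_{i+1}$, $p_{i+1}$ is the $(I_0,I_{i+1})$-coset containing $p_i$; if $I_i\supset I_{i+1}$, $p_{i+1}$ is the $(I_0,I_{i+1})$-coset containing $\overline{p_i}$. One says $I_\bullet$ is an expression of $p_d$; $I_\bullet\leftrightharpoons I'_\bullet$ means both express the same double coset. The left redundancy of $p_i$ is $K_i=I_0\cap\underline{p_i}I_i\underline{p_i}^{-1}$. The expression is reduced if for every $i$ with $I_i\subset I_{i+1}$ one has $\underline{p_i}=\underline{p_{i+1}}$ and $K_i=K_{i+1}$. Rotation sequence: given $s\notin J$ with $Js$ finitary and $t\in Js$ with $s\ne w_{Js}tw_{Js}$,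 put $u_0=s$, $u_{-1}=w_{Js}tw_{Js}$, $I_i=Js\setminus\{u_i\}$, and recursively $u_{i+1}=w_{I_i}u_{i-1}w_{I_i}$ for all $i\in\mathbb Z$ (used in both directions); all $u_i$ are elements of $Js$. *)

theory Defs
  imports "HOL-Algebra.Generated_Groups" "HOL-Algebra.Multiplicative_Group"
begin

section \<open>Coxeter systems\<close>

definition word_prod :: "('a, 'b) monoid_scheme \<Rightarrow> 'a list \<Rightarrow> 'a" where
  "word_prod W xs = foldr (\<lambda>x y. x \<otimes>\<^bsub>W\<^esub> y) xs \<one>\<^bsub>W\<^esub>"

text \<open>The congruence on words over \<open>S\<close> generated by the relations \<open>(st)\<^sup>m = 1\<close>, where \<open>m\<close> is the
  order of \<open>st\<close> in \<open>W\<close>.  For \<open>s = t\<close> this is the relation \<open>s s = 1\<close>, so formal inverses are not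
  needed.  The library's \<open>ord\<close> is \<open>0\<close> for elements of infinite order, which gives the empty relator,
  i.e. no relation.\<close>

inductive word_equiv :: "('a, 'b) monoid_scheme \<Rightarrow> 'a set \<Rightarrow> 'a list \<Rightarrow> 'a list \<Rightarrow> bool"
  for W :: "('a, 'b) monoid_scheme" and S :: "'a set" where
  relator: "\<lbrakk>s \<in> S; t \<in> S; set xs \<subseteq> S; set ys \<subseteq> S\<rbrakk> \<Longrightarrow>
     word_equiv W S (xs @ concat (replicate (group.ord W (s \<otimes>\<^bsub>W\<^esub> t)) [s, t]) @ ys) (xs @ ys)"
| refl: "set xs \<subseteq> S \<Longrightarrow> word_equiv W S xs xs"
| sym: "word_equiv W S xs ys \<Longrightarrow> word_equiv W S ys xs"
| trans: "\<lbrakk>word_equiv W S xs ys; word_equiv W S ys zs\<rbrakk> \<Longrightarrow> word_equiv W S xs zs"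

text \<open>\<open>S\<close> generates \<open>W\<close>, consists of elements of order \<open>2\<close>, and the relations
  \<open>(st)\<^bsup>ord(st)\<^esup> = 1\<close> form a presentation of \<open>W\<close>: every word with product \<open>1\<close> reduces to the
  empty word by these relations.  \<open>S\<close> is not assumed to be finite.\<close>

locale coxeter_system = group W for W :: "('a, 'b) monoid_scheme" (structure) +
  fixes S :: "'a set"
  assumes gens_closed: "S \<subseteq> carrier W"
    and gens_generate: "generate W S = carrier W"
    and gens_order_two: "\<And>s. s \<in> S \<Longrightarrow> s \<noteq> \<one> \<and> s \<otimes> s = \<one>"
    and presentation: "\<And>xs. \<lbrakk>set xs \<subseteq> S; word_prod W xs = \<one>\<rbrakk> \<Longrightarrow> word_equiv W S xs []"

definition cox_length :: "('a, 'b) monoid_scheme \<Rightarrow> 'a set \<Rightarrow> 'a \<Rightarrow> nat" where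
  "cox_length W S x = (LEAST n. \<exists>xs. set xs \<subseteq> S \<and> length xs = n \<and> word_prod W xs = x)"

definition reflections :: "('a, 'b) monoid_scheme \<Rightarrow> 'a set \<Rightarrow> 'a set" where
  "reflections W S = {x \<otimes>\<^bsub>W\<^esub> s \<otimes>\<^bsub>W\<^esub> inv\<^bsub>W\<^esub> x | x s. x \<in> carrier W \<and> s \<in> S}"

definition bruhat_step :: "('a, 'b) monoid_scheme \<Rightarrow> 'a set \<Rightarrow> 'a \<Rightarrow> 'a \<Rightarrow> bool" where
  "bruhat_step W S x y \<longleftrightarrow> x \<in> carrier W \<and> cox_length W S x < cox_length W S y
     \<and> (\<exists>r \<in> reflections W S. y = x \<otimes>\<^bsub>W\<^esub> r)"

definition bruhat_le :: "('a, 'b) monoid_scheme \<Rightarrow> 'a set \<Rightarrow> 'a \<Rightarrow> 'a \<Rightarrow> bool" where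
  "bruhat_le W S = (bruhat_step W S)\<^sup>*\<^sup>*"

text \<open>The parabolic subgroup \<open>W\<^sub>I\<close> is \<open>generate W I\<close>.\<close>

definition finitary :: "('a, 'b) monoid_scheme \<Rightarrow> 'a set \<Rightarrow> 'a set \<Rightarrow> bool" where
  "finitary W S I \<longleftrightarrow> I \<subseteq> S \<and> finite (generate W I)"

definition longest :: "('a, 'b) monoid_scheme \<Rightarrow> 'a set \<Rightarrow> 'a set \<Rightarrow> 'a" where
  "longest W S I = (THE w. w \<in> generate W I \<and>
     (\<forall>v \<in> generate W I. cox_length W S v \<le> cox_length W S w))"

section \<open>Double cosets\<close>

text \<open>A \<open>(J, I)\<close>-coset is represented by its underlying set; the pair \<open>(J, I)\<close> is carried
  alongside as explicit arguments.\<close>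

definition double_coset :: "('a, 'b) monoid_scheme \<Rightarrow> 'a set \<Rightarrow> 'a set \<Rightarrow> 'a \<Rightarrow> 'a set" where
  "double_coset W J I x = (generate W J #>\<^bsub>W\<^esub> x) <#>\<^bsub>W\<^esub> generate W I"

definition double_cosets :: "('a, 'b) monoid_scheme \<Rightarrow> 'a set \<Rightarrow> 'a set \<Rightarrow> 'a set set" where
  "double_cosets W J I = double_coset W J I ` carrier W"

definition coset_max :: "('a, 'b) monoid_scheme \<Rightarrow> 'a set \<Rightarrow> 'a set \<Rightarrow> 'a" where
  "coset_max W S p = (THE x. x \<in> p \<and> (\<forall>y \<in> p. bruhat_le W S x y \<longrightarrow> y = x))"

definition coset_min :: "('a, 'b) monoid_scheme \<Rightarrow> 'a set \<Rightarrow> 'a set \<Rightarrow> 'a" where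
  "coset_min W S p = (THE x. x \<in> p \<and> (\<forall>y \<in> p. bruhat_le W S y x \<longrightarrow> y = x))"

section \<open>Expressions\<close>

definition expression :: "('a, 'b) monoid_scheme \<Rightarrow> 'a set \<Rightarrow> 'a set list \<Rightarrow> bool" where
  "expression W S E \<longleftrightarrow> E \<noteq> [] \<and> (\<forall>I \<in> set E. finitary W S I) \<and>
     (\<forall>i. Suc i < length E \<longrightarrow>
        (\<exists>s \<in> S. (s \<notin> E ! i \<and> E ! Suc i = insert s (E ! i)) \<or>
                 (s \<in> E ! i \<and> E ! Suc i = E ! i - {s})))"

text \<open>\<open>forward_path W S E i\<close> is the \<open>i\<close>-th coset of the forward path of \<open>E\<close>; it is meaningful
  for \<open>i < length E\<close>.\<close>

primrec forward_path :: "('a, 'b) monoid_scheme \<Rightarrow> 'a set \<Rightarrow> 'a set list \<Rightarrow> nat \<Rightarrow> 'a set" where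
  "forward_path W S E 0 = (THE q. q \<in> double_cosets W (E ! 0) (E ! 0) \<and> \<one>\<^bsub>W\<^esub> \<in> q)"
| "forward_path W S E (Suc i) =
     (if E ! i \<subseteq> E ! Suc i
      then (THE q. q \<in> double_cosets W (E ! 0) (E ! Suc i) \<and> forward_path W S E i \<subseteq> q)
      else (THE q. q \<in> double_cosets W (E ! 0) (E ! Suc i)
                   \<and> coset_max W S (forward_path W S E i) \<in> q))"

definition left_redundancy ::
    "('a, 'b) monoid_scheme \<Rightarrow> 'a set \<Rightarrow> 'a set list \<Rightarrow> nat \<Rightarrow> 'a set" where
  "left_redundancy W S E i = (let x = coset_min W S (forward_path W S E i) in
     E ! 0 \<inter> (\<lambda>s. x \<otimes>\<^bsub>W\<^esub> s \<otimes>\<^bsub>W\<^esub> inv\<^bsub>W\<^esub> x) ` (E ! i))"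

definition reduced :: "('a, 'b) monoid_scheme \<Rightarrow> 'a set \<Rightarrow> 'a set list \<Rightarrow> bool" where
  "reduced W S E \<longleftrightarrow> expression W S E \<and>
     (\<forall>i. Suc i < length E \<and> E ! i \<subseteq> E ! Suc i \<longrightarrow>
        coset_min W S (forward_path W S E i) = coset_min W S (forward_path W S E (Suc i)) \<and>
        left_redundancy W S E i = left_redundancy W S E (Suc i))"

text \<open>\<open>E\<close> is an expression of the \<open>(J, I)\<close>-coset \<open>p\<close>.\<close>

definition expresses ::
    "('a, 'b) monoid_scheme \<Rightarrow> 'a set \<Rightarrow> 'a set list \<Rightarrow> 'a set \<Rightarrow> 'a set \<Rightarrow> 'a set \<Rightarrow> bool" where
  "expresses W S E J I p \<longleftrightarrow> expression W S E \<and> hd E = J \<and> last E = I \<and>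
     forward_path W S E (length E - 1) = p"

definition reduced_expressions ::
    "('a, 'b) monoid_scheme \<Rightarrow> 'a set \<Rightarrow> 'a set \<Rightarrow> 'a set \<Rightarrow> 'a set \<Rightarrow> 'a set list set" where
  "reduced_expressions W S J I p = {E. reduced W S E \<and> expresses W S E J I p}"

definition same_coset ::
    "('a, 'b) monoid_scheme \<Rightarrow> 'a set \<Rightarrow> 'a set list \<Rightarrow> 'a set list \<Rightarrow> bool" where
  "same_coset W S E E' \<longleftrightarrow> (\<exists>J I p. expresses W S E J I p \<and> expresses W S E' J I p)"

text \<open>The notation \<open>[J + s - t]\<close> is \<open>steps J [Add s, Remove t]\<close>, and similarly for longer strings.
  That the added element is new and the removed one present is enforced by \<open>expression\<close>, not here.\<close>

datatype 'a step = Add 'a | Remove 'a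

fun steps :: "'a set \<Rightarrow> 'a step list \<Rightarrow> 'a set list" where
  "steps J [] = [J]"
| "steps J (Add s # xs) = J # steps (insert s J) xs"
| "steps J (Remove s # xs) = J # steps (J - {s}) xs"

section \<open>Rotation sequences\<close>

text \<open>The recursion \<open>u\<^bsub>i+1\<^esub> = w\<^bsub>I\<^sub>i\<^esub> u\<^bsub>i-1\<^esub> w\<^bsub>I\<^sub>i\<^esub>\<close>, where \<open>I\<^sub>i\<close> is \<open>K\<close> without \<open>u\<^sub>i\<close>, acting on pairs
  \<open>(u\<^bsub>i-1\<^esub>, u\<^sub>i)\<close>, and the same recursion solved for \<open>u\<^bsub>i-1\<^esub>\<close> (\<open>w\<^bsub>I\<^sub>i\<^esub>\<close> is an involution).\<close>

definition rot_next :: "('a, 'b) monoid_scheme \<Rightarrow> 'a set \<Rightarrow> 'a set \<Rightarrow> 'a \<times> 'a \<Rightarrow> 'a \<times> 'a" where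
  "rot_next W S K = (\<lambda>(a, b). let w = longest W S (K - {b}) in (b, w \<otimes>\<^bsub>W\<^esub> a \<otimes>\<^bsub>W\<^esub> w))"

definition rot_prev :: "('a, 'b) monoid_scheme \<Rightarrow> 'a set \<Rightarrow> 'a set \<Rightarrow> 'a \<times> 'a \<Rightarrow> 'a \<times> 'a" where
  "rot_prev W S K = (\<lambda>(a, b). let w = longest W S (K - {a}) in (w \<otimes>\<^bsub>W\<^esub> b \<otimes>\<^bsub>W\<^esub> w, a))"

definition rotation ::
    "('a, 'b) monoid_scheme \<Rightarrow> 'a set \<Rightarrow> 'a set \<Rightarrow> 'a \<Rightarrow> 'a \<Rightarrow> int \<Rightarrow> 'a" where
  "rotation W S J s t i =
     (let K = insert s J; w = longest W S K; start = (w \<otimes>\<^bsub>W\<^esub> t \<otimes>\<^bsub>W\<^esub> w, s)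
      in if 0 \<le> i then snd ((rot_next W S K ^^ nat i) start)
         else snd ((rot_prev W S K ^^ nat (- i)) start))"

text \<open>\<open>rotation_expr K u k\<close> is \<open>[I\<^sub>0, L\<^sub>1, I\<^sub>1, \<dots>, L\<^sub>k, I\<^sub>k]\<close>, where \<open>I\<^sub>i\<close> is \<open>K\<close> without \<open>u\<^sub>i\<close> and
  \<open>L\<^sub>i\<close> is \<open>K\<close> without \<open>u\<^sub>i\<close> and \<open>u\<^bsub>i-1\<^esub>\<close>.\<close>

definition rotation_expr :: "'a set \<Rightarrow> (int \<Rightarrow> 'a) \<Rightarrow> nat \<Rightarrow> 'a set list" where
  "rotation_expr K u k = (K - {u 0}) #
     concat (map (\<lambda>i. [K - {u (int i), u (int i - 1)}, K - {u (int i)}]) [1..<Suc k])"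

end

theory Submission
  imports Defs
begin

text \<open>
  Write \<open>K = insert s J\<close>, \<open>w\<^sub>K\<close> for the longest element of \<open>W\<^sub>K\<close>, \<open>s' = w\<^sub>K s w\<^sub>K\<close>,
  \<open>t' = w\<^sub>K t w\<^sub>K\<close> and \<open>L = K - {s, t'}\<close>.  The picture behind the proof is the Coxeter complex
  of \<open>W\<^sub>K\<close>, a triangulated sphere on which a coset \<open>x W\<^sub>A\<close> is a face of type \<open>K - A\<close>.  The coset
  \<open>W\<^sub>J\<close> is the vertex of type \<open>s\<close> of the fundamental chamber, and \<open>w\<^sub>K W\<^sub>I\<close> is the antipode of its
  vertex of type \<open>t'\<close>.  A reduced expression of \<open>p\<close> is a monotone walk through faces from the first
  vertex to the second.  One such walk goes through the empty face; it is \<open>[J + s - t]\<close>.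
  All other ones must stay inside the set of points fixed by \<open>W\<^sub>L\<close>, the common stabilizer of the
  two end points.  If \<open>s = t'\<close>, this set consists of the two end points only, so there is no
  other walk.  If \<open>s \<noteq> t'\<close>, it is a circle made of edges, and the walk has to follow
  the arc that starts opposite to the fundamental edge of type \<open>{s, t'}\<close>.  The passage to the opposite
  edge in the link of a vertex is the recursion of the rotation sequence, so \<open>u\<^sub>i\<close> is the
  type of the \<open>i\<close>-th vertex on the arc, and the vertex after \<open>w\<^sub>K W\<^sub>I\<close> is the antipode of \<open>W\<^sub>J\<close>, of
  type \<open>s'\<close>.

  In algebraic form, the coset \<open>p\<^sub>i\<close> is recorded by its maximal element \<open>y\<^sub>i\<close>.  A step down
  keeps \<open>y\<^sub>i\<close>.  A step up to \<open>A \<supseteq> I\<^sub>i\<close> is reduced iff \<open>m = y\<^sub>i w\<^bsub>I\<^sub>i\<^esub>\<close>, which is minimal in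
  \<open>m W\<^bsub>I\<^sub>i\<^esub>\<close>, is even minimal in \<open>m W\<^sub>A\<close>, and then \<open>y\<^bsub>i+1\<^esub> = m w\<^sub>A\<close>
  (\<open>reduced_iff\<close>, \<open>path_max_up\<close>).  The stabilizer \<open>W\<^sub>J \<inter> y\<^sub>i W\<^bsub>I\<^sub>i\<^esub> y\<^sub>i\<^sup>-\<^sup>1\<close> shrinks along a
  reduced expression (\<open>stabilizer_decreasing\<close>) and contains \<open>L\<close> at the end, where \<open>y = w\<^sub>K\<close>, so it
  contains \<open>L\<close> throughout.  As \<open>y\<^sub>i\<^sup>-\<^sup>1 L y\<^sub>i\<close> is a known set of simple reflections along the rotation
  (\<open>vert_max_conj\<close>), this decides which reflection each step removes, and reducedness decides which
  one is added (\<open>down_first_forced\<close>).  The rotation stops being reduced exactly when it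
  reaches \<open>w\<^sub>K\<close> (\<open>stop_longest\<close>, \<open>advances_not_longest\<close>), and comparing \<open>y\<^sup>-\<^sup>1 L y\<close> with \<open>w\<^sub>K L w\<^sub>K\<close>
  identifies the last two types as \<open>t\<close> and \<open>s'\<close> (\<open>stop_types\<close>).

  The combinatorics of lengths behind this rests on the exchange condition, which is derived from the
  presentation by counting, modulo \<open>2\<close>, how often a word crosses the wall of a reflection.
\<close>

context coxeter_system
begin

section \<open>Words and the exchange condition\<close>

abbreviation len :: "'a \<Rightarrow> nat" where "len \<equiv> cox_length W S"
abbreviation wprod :: "'a list \<Rightarrow> 'a" where "wprod \<equiv> word_prod W"

lemma S_in_carrier [simp]: "s \<in> S \<Longrightarrow> s \<in> carrier W"
  using gens_closed by blast

lemma S_square [simp]: "s \<in> S \<Longrightarrow> s \<otimes> s = \<one>"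
  using gens_order_two by blast

lemma S_inv [simp]: "s \<in> S \<Longrightarrow> inv s = s"
  by (rule inv_equality) auto

lemma cancel_left [simp]:
  "x \<in> carrier W \<Longrightarrow> y \<in> carrier W \<Longrightarrow> inv x \<otimes> (x \<otimes> y) = y"
  "x \<in> carrier W \<Longrightarrow> y \<in> carrier W \<Longrightarrow> x \<otimes> (inv x \<otimes> y) = y"
  "s \<in> S \<Longrightarrow> y \<in> carrier W \<Longrightarrow> s \<otimes> (s \<otimes> y) = y"
  by (simp_all flip: m_assoc)

lemma wprod_Nil [simp]: "wprod [] = \<one>"
  and wprod_Cons [simp]: "wprod (x # xs) = x \<otimes> wprod xs"
  by (simp_all add: word_prod_def)

lemma wprod_closed [simp]: "set xs \<subseteq> S \<Longrightarrow> wprod xs \<in> carrier W"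
  by (induction xs) auto

lemma wprod_append: "set xs \<subseteq> S \<Longrightarrow> set ys \<subseteq> S \<Longrightarrow> wprod (xs @ ys) = wprod xs \<otimes> wprod ys"
  by (induction xs) (auto simp: m_assoc)

lemma wprod_rev: "set xs \<subseteq> S \<Longrightarrow> wprod (rev xs) = inv (wprod xs)"
  by (induction xs) (auto simp: wprod_append inv_mult_group)

abbreviation par :: "'a set \<Rightarrow> 'a set" where "par I \<equiv> generate W I"

lemma subset_carrier: "I \<subseteq> S \<Longrightarrow> I \<subseteq> carrier W"
  using gens_closed by blast

lemma par_subgroup: "I \<subseteq> S \<Longrightarrow> subgroup (par I) W"
  by (simp add: generate_is_subgroup subset_carrier)

lemma par_closed: "I \<subseteq> S \<Longrightarrow> x \<in> par I \<Longrightarrow> x \<in> carrier W"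
  using par_subgroup subgroup.mem_carrier by metis

lemma par_mult: "I \<subseteq> S \<Longrightarrow> x \<in> par I \<Longrightarrow> y \<in> par I \<Longrightarrow> x \<otimes> y \<in> par I"
  by (simp add: generate.eng)

lemma par_inv: "I \<subseteq> S \<Longrightarrow> x \<in> par I \<Longrightarrow> inv x \<in> par I"
  by (simp add: generate_m_inv_closed subset_carrier)

lemma par_one [simp]: "\<one> \<in> par I"
  by (rule generate.one)

lemma par_gen: "r \<in> I \<Longrightarrow> r \<in> par I"
  by (rule generate.incl)

lemma par_mono: "I \<subseteq> I' \<Longrightarrow> x \<in> par I \<Longrightarrow> x \<in> par I'"
  using mono_generate by blast

lemma wprod_par: "set xs \<subseteq> I \<Longrightarrow> I \<subseteq> S \<Longrightarrow> wprod xs \<in> par I"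
  by (induction xs) (auto intro: par_mult par_gen)

lemma par_word:
  assumes I: "I \<subseteq> S" and "x \<in> par I"
  shows "\<exists>xs. set xs \<subseteq> I \<and> wprod xs = x"
  using assms(2)
proof (induction x rule: generate.induct)
  case one
  show ?case by (intro exI[of _ "[]"]) auto
next
  case (incl r)
  then show ?case using I by (intro exI[of _ "[r]"]) auto
next
  case (inv r)
  then show ?case using I by (intro exI[of _ "[r]"]) auto
next
  case (eng x y)
  then obtain xs ys where "set xs \<subseteq> I" "wprod xs = x" "set ys \<subseteq> I" "wprod ys = y"
    by blast
  then show ?case using I by (intro exI[of _ "xs @ ys"]) (auto simp: wprod_append)
qed

lemma carrier_word: "x \<in> carrier W \<Longrightarrow> \<exists>xs. set xs \<subseteq> S \<and> wprod xs = x"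
  using par_word[of S x] gens_generate by auto

text \<open>The \<open>i\<close>-th letter of a word \<open>s\<^sub>1 \<dots> s\<^sub>n\<close> crosses the wall of the reflection
  \<open>s\<^sub>1 \<dots> s\<^bsub>i-1\<^esub> s\<^sub>i s\<^bsub>i-1\<^esub> \<dots> s\<^sub>1\<close>.  Relators change the number of crossings of a wall by an even
  number, so only the parity depends on the product of the word alone.\<close>

primrec odd_crossing :: "'a list \<Rightarrow> 'a \<Rightarrow> bool" where
  "odd_crossing [] r = False"
| "odd_crossing (s # xs) r = ((r = s) \<noteq> odd_crossing xs (s \<otimes> r \<otimes> s))"

lemma odd_crossing_append:
  assumes "set xs \<subseteq> S" "set ys \<subseteq> S" "r \<in> carrier W"
  shows "odd_crossing (xs @ ys) r
    = (odd_crossing xs r \<noteq> odd_crossing ys (inv (wprod xs) \<otimes> r \<otimes> wprod xs))"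
  using assms by (induction xs arbitrary: r) (auto simp: inv_mult_group m_assoc)

text \<open>With \<open>g = st\<close>, the letters of \<open>(st)\<^sup>n\<close> cross the walls of \<open>g\<^sup>j s\<close> for \<open>j < 2n\<close>, in this
  order: splitting off the first two letters conjugates by \<open>g\<close>, which shifts \<open>j\<close> by two.\<close>

lemma odd_crossing_relator_aux:
  assumes s: "s \<in> S" and t: "t \<in> S" and "r \<in> carrier W"
  shows "odd_crossing (concat (replicate n [s, t])) r
    = odd (\<Sum>j<2 * n. of_bool (r = (s \<otimes> t) [^] j \<otimes> s) :: nat)"
  using assms(3)
proof (induction n arbitrary: r)
  case (Suc n)
  let ?g = "s \<otimes> t"
  let ?X = "concat (replicate n [s, t])"
  have c: "s \<in> carrier W" "t \<in> carrier W" using s t by auto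
  have X: "set ?X \<subseteq> S" using s t by (induction n) auto
  have g1: "(s \<otimes> r \<otimes> s = t) = (r = ?g [^] (1::nat) \<otimes> s)"
    using Suc.prems c s t by (metis S_square m_assoc m_closed nat_pow_eone r_one l_one)
  have g2: "(inv ?g \<otimes> r \<otimes> ?g = ?g [^] j \<otimes> s) = (r = ?g [^] Suc (Suc j) \<otimes> s)" for j :: nat
  proof -
    have gc: "?g \<in> carrier W" "?g [^] j \<in> carrier W" using c by auto
    have ig: "inv ?g = t \<otimes> s" using c s t by (simp add: inv_mult_group)
    have e: "?g \<otimes> (?g [^] j \<otimes> s) \<otimes> inv ?g = ?g [^] Suc (Suc j) \<otimes> s"
    proof -
      have "s \<otimes> inv ?g = ?g \<otimes> s" using ig c by (simp add: m_assoc)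
      then have "?g \<otimes> (?g [^] j \<otimes> s) \<otimes> inv ?g = ?g \<otimes> ?g [^] j \<otimes> ?g \<otimes> s"
        using c gc by (simp add: m_assoc)
      then show ?thesis using gc by (metis nat_pow_Suc nat_pow_Suc2)
    qed
    show ?thesis unfolding e[symmetric] using gc c Suc.prems
      by (smt (verit) inv_solve_left inv_solve_right m_closed inv_closed m_assoc)
  qed
  have "odd_crossing (concat (replicate (Suc n) [s, t])) r
      = (((r = s) \<noteq> (s \<otimes> r \<otimes> s = t)) \<noteq> odd_crossing ?X (inv ?g \<otimes> r \<otimes> ?g))"
    using odd_crossing_append[of "[s, t]" ?X r] s t X Suc.prems by simp
  also have "\<dots> = (((r = s) \<noteq> (r = ?g [^] (1::nat) \<otimes> s))
       \<noteq> odd (\<Sum>j<2 * n. of_bool (r = ?g [^] Suc (Suc j) \<otimes> s) :: nat))"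
    unfolding g1 using Suc.IH[of "inv ?g \<otimes> r \<otimes> ?g"] g2 c Suc.prems by simp
  also have "\<dots> = odd (\<Sum>j<2 * Suc n. of_bool (r = ?g [^] j \<otimes> s) :: nat)"
    using c by (simp add: sum.lessThan_Suc_shift del: sum.lessThan_Suc nat_pow_Suc)
  finally show ?case .
qed simp

text \<open>For \<open>n\<close> the order of \<open>g\<close>, the sequence of the \<open>g\<^sup>j s\<close> with \<open>j < 2n\<close> runs twice through the same
  reflections.\<close>

lemma odd_crossing_relator:
  assumes s: "s \<in> S" and t: "t \<in> S" and "r \<in> carrier W"
  shows "\<not> odd_crossing (concat (replicate (ord (s \<otimes> t)) [s, t])) r"
proof -
  let ?g = "s \<otimes> t" and ?m = "ord (s \<otimes> t)"
  let ?f = "\<lambda>j::nat. of_bool (r = ?g [^] j \<otimes> s) :: nat"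
  have g: "?g \<in> carrier W" using s t by auto
  have "?g [^] (?m + j) = ?g [^] j" for j
    using g by (simp flip: nat_pow_mult)
  then have per: "?f (?m + j) = ?f j" for j by simp
  have "(\<Sum>j<2 * ?m. ?f j) = (\<Sum>j<?m. ?f j) + (\<Sum>j<?m. ?f (?m + j))"
    unfolding mult_2 lessThan_atLeast0 
    using sum.atLeastLessThan_concat[of 0 ?m "?m + ?m" ?f]
      sum.shift_bounds_nat_ivl[of ?f 0 ?m ?m] by (simp add: add.commute)
  then have "even (\<Sum>j<2 * ?m. ?f j)" by (simp add: per)
  then show ?thesis using odd_crossing_relator_aux[OF assms, of ?m] by simp
qed

lemma wprod_relator:
  assumes s: "s \<in> S" and t: "t \<in> S"
  shows "wprod (concat (replicate (ord (s \<otimes> t)) [s, t])) = \<one>"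
proof -
  have "wprod (concat (replicate n [s, t])) = (s \<otimes> t) [^] n" for n :: nat
    using s t
  proof (induction n)
    case (Suc n)
    then show ?case using nat_pow_Suc2[of "s \<otimes> t" n] by (simp add: m_assoc)
  qed simp
  then show ?thesis using s t by (simp add: pow_ord_eq_1)
qed

lemma word_equiv_invariant:
  assumes "word_equiv W S xs ys"
  shows "set xs \<subseteq> S \<and> set ys \<subseteq> S \<and> wprod xs = wprod ys
    \<and> (\<forall>r \<in> carrier W. odd_crossing xs r = odd_crossing ys r)"
  using assms
proof induction
  case (relator s t xs ys)
  let ?R = "concat (replicate (ord (s \<otimes> t)) [s, t])"
  have R: "set ?R \<subseteq> S" using relator by auto
  have "odd_crossing (xs @ ?R @ ys) r = odd_crossing (xs @ ys) r" if "r \<in> carrier W" for r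
  proof -
    let ?r = "inv (wprod xs) \<otimes> r \<otimes> wprod xs"
    have r: "?r \<in> carrier W" using that relator by auto
    have "odd_crossing (?R @ ys) ?r = odd_crossing ys ?r"
      using odd_crossing_append[OF R relator(4) r] odd_crossing_relator[OF relator(1,2) r] r
        wprod_relator[OF relator(1,2)] by auto
    then show ?thesis using that relator R
      by (simp add: odd_crossing_append)
  qed
  then show ?case using relator R
    by (auto simp: wprod_append wprod_relator)
qed auto

text \<open>The presentation enters here: \<open>xs @ rev ys\<close> and \<open>ys @ rev ys\<close> both have product \<open>1\<close>, so
  both cross each wall an even number of times.\<close>

lemma odd_crossing_cong:
  assumes "set xs \<subseteq> S" "set ys \<subseteq> S" "wprod xs = wprod ys" "r \<in> carrier W"
  shows "odd_crossing xs r = odd_crossing ys r"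
proof -
  have "\<not> odd_crossing (zs @ rev ys) r" if "set zs \<subseteq> S" "wprod zs = wprod ys" for zs
  proof -
    have "wprod (zs @ rev ys) = \<one>" using that assms by (simp add: wprod_append wprod_rev)
    then show ?thesis
      using word_equiv_invariant[OF presentation[of "zs @ rev ys"]] that assms by auto
  qed
  from this[of xs] this[of ys] show ?thesis
    using assms by (simp add: odd_crossing_append)
qed

text \<open>If the letter \<open>a\<close> that follows the initial part \<open>as\<close> crosses the wall of \<open>r\<close>, then \<open>r\<close> times the
  product of \<open>as\<close> is the product of \<open>as @ [a]\<close>, so that multiplying by \<open>r\<close> cancels \<open>a\<close>.\<close>

lemma odd_crossing_delete:
  assumes "set xs \<subseteq> S" "r \<in> carrier W" "odd_crossing xs r"
  shows "\<exists>as a bs. xs = as @ a # bs \<and> r \<otimes> wprod xs = wprod (as @ bs)"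
  using assms
proof (induction xs arbitrary: r)
  case (Cons s xs)
  show ?case
  proof (cases "r = s")
    case True
    then show ?thesis using Cons.prems by (intro exI[of _ "[]"]) auto
  next
    case False
    then have "odd_crossing xs (s \<otimes> r \<otimes> s)" using Cons.prems by simp
    then obtain as a bs where *: "xs = as @ a # bs" "s \<otimes> r \<otimes> s \<otimes> wprod xs = wprod (as @ bs)"
      using Cons.IH[of "s \<otimes> r \<otimes> s"] Cons.prems by auto
    then have "wprod ((s # as) @ bs) = s \<otimes> (s \<otimes> r \<otimes> s \<otimes> wprod xs)" by simp
    also have "\<dots> = r \<otimes> wprod (s # xs)" using Cons.prems by (simp add: m_assoc)
    finally show ?thesis using *(1) by (intro exI[of _ "s # as"]) auto
  qed
qed simp

lemma len_le: "set xs \<subseteq> S \<Longrightarrow> len (wprod xs) \<le> length xs"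
  unfolding cox_length_def by (rule Least_le) blast

lemma reduced_word:
  assumes "x \<in> carrier W"
  shows "\<exists>xs. set xs \<subseteq> S \<and> length xs = len x \<and> wprod xs = x"
proof -
  have "\<exists>n xs. set xs \<subseteq> S \<and> length xs = n \<and> wprod xs = x"
    using carrier_word[OF assms] by blast
  then show ?thesis unfolding cox_length_def by (rule LeastI_ex)
qed

lemma len_one [simp]: "len \<one> = 0"
  using len_le[of "[]"] by simp

lemma len_eq_0: "x \<in> carrier W \<Longrightarrow> len x = 0 \<Longrightarrow> x = \<one>"
  using reduced_word[of x] by auto

lemma len_mult: 
  assumes "x \<in> carrier W" "y \<in> carrier W"
  shows "len (x \<otimes> y) \<le> len x + len y"
proof -
  obtain xs where "set xs \<subseteq> S" "length xs = len x" "wprod xs = x"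
    using reduced_word[OF assms(1)] by blast
  moreover obtain ys where "set ys \<subseteq> S" "length ys = len y" "wprod ys = y"
    using reduced_word[OF assms(2)] by blast
  ultimately show ?thesis using len_le[of "xs @ ys"] by (simp add: wprod_append)
qed

lemma len_inv [simp]: 
  assumes "x \<in> carrier W"
  shows "len (inv x) = len x"
proof -
  have "len (inv y) \<le> len y" if y: "y \<in> carrier W" for y
  proof -
    obtain ys where "set ys \<subseteq> S" "length ys = len y" "wprod ys = y"
      using reduced_word[OF y] by blast
    then show ?thesis using len_le[of "rev ys"] by (simp add: wprod_rev)
  qed
  from this[of x] this[of "inv x"] show ?thesis using assms by simp
qed

text \<open>If \<open>xs\<close> crosses the wall of \<open>s\<close> an even number of times, then \<open>s # xs\<close>, and with it any reduced word
  of \<open>s\<close> times the product of \<open>xs\<close>, crosses it an odd number of times.  Deleting a letter there shows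
  that the multiplication by \<open>s\<close> has increased the length.\<close>

lemma exchange:
  assumes s: "s \<in> S" and xs: "set xs \<subseteq> S" and le: "len (s \<otimes> wprod xs) \<le> len (wprod xs)"
  shows "\<exists>as a bs. xs = as @ a # bs \<and> s \<otimes> wprod xs = wprod (as @ bs)"
proof (cases "odd_crossing xs s")
  case True
  then show ?thesis using odd_crossing_delete assms by simp
next
  case False
  let ?y = "s \<otimes> wprod xs"
  have y: "?y \<in> carrier W" using s xs by simp
  obtain zs where zs: "set zs \<subseteq> S" "length zs = len ?y" "wprod zs = ?y"
    using reduced_word[OF y] by blast
  have "odd_crossing (s # xs) s" using False s by simp
  then have "odd_crossing zs s"
    using odd_crossing_cong[of "s # xs" zs s] s xs zs by simp
  then obtain as a bs where *: "zs = as @ a # bs" "s \<otimes> wprod zs = wprod (as @ bs)"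
    using odd_crossing_delete[of zs s] zs s by auto
  then have "wprod xs = wprod (as @ bs)" using zs s xs by simp
  then have "len (wprod xs) < len ?y"
    using len_le[of "as @ bs"] * zs by auto
  then show ?thesis using le by simp
qed

lemma len_gen_left_cases:
  assumes s: "s \<in> S" and x: "x \<in> carrier W"
  shows "len (s \<otimes> x) = Suc (len x) \<or> len x = Suc (len (s \<otimes> x))"
proof -
  obtain xs where xs: "set xs \<subseteq> S" "length xs = len x" "wprod xs = x"
    using reduced_word[OF x] by blast
  have one: "len s \<le> 1" using len_le[of "[s]"] s by simp
  have "len (s \<otimes> x) \<le> Suc (len x)" using len_mult[of s x] s x one by simp
  moreover have "len x \<le> Suc (len (s \<otimes> x))"
    using len_mult[of s "s \<otimes> x"] s x one by simp
  moreover have "len (s \<otimes> x) \<noteq> len x"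
  proof
    assume *: "len (s \<otimes> x) = len x"
    then obtain as a bs where "xs = as @ a # bs" "s \<otimes> x = wprod (as @ bs)"
      using exchange[OF s xs(1)] xs by auto
    then show False using len_le[of "as @ bs"] xs * by auto
  qed
  ultimately show ?thesis by linarith
qed

lemma len_gen_right:
  assumes s: "s \<in> S" and x: "x \<in> carrier W"
  shows "len (x \<otimes> s) = len (s \<otimes> inv x)"
  using len_inv[of "x \<otimes> s"] s x by (simp add: inv_mult_group)

lemma len_gen_right_cases:
  assumes s: "s \<in> S" and x: "x \<in> carrier W"
  shows "len (x \<otimes> s) = Suc (len x) \<or> len x = Suc (len (x \<otimes> s))"
  using len_gen_left_cases[of s "inv x"] assms by (simp add: len_gen_right)

lemma len_gen [simp]: "s \<in> S \<Longrightarrow> len s = 1"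
  using len_gen_left_cases[of s \<one>] by simp

section \<open>Parabolic subgroups\<close>

lemma par_reduced_word:
  assumes I: "I \<subseteq> S" and "x \<in> par I"
  shows "\<exists>xs. set xs \<subseteq> I \<and> length xs = len x \<and> wprod xs = x"
proof -
  have "\<exists>ys. set ys \<subseteq> I \<and> length ys = len (wprod xs) \<and> wprod ys = wprod xs"
    if "set xs \<subseteq> I" for xs
    using that
  proof (induction xs)
    case (Cons r xs)
    then obtain ys where ys: "set ys \<subseteq> I" "length ys = len (wprod xs)" "wprod ys = wprod xs"
      by auto
    have r: "r \<in> S" and xsS: "set xs \<subseteq> S" and ysS: "set ys \<subseteq> S" using Cons.prems I ys by auto
    from len_gen_left_cases[OF r, of "wprod xs"] xsS
    consider "len (r \<otimes> wprod xs) = Suc (len (wprod xs))"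
      | "len (wprod xs) = Suc (len (r \<otimes> wprod xs))" by auto
    then show ?case
    proof cases
      case 1
      then show ?thesis using ys Cons.prems by (intro exI[of _ "r # ys"]) auto
    next
      case 2
      then obtain as a bs where "ys = as @ a # bs" "r \<otimes> wprod ys = wprod (as @ bs)"
        using exchange[OF r ysS] ys by auto
      then show ?thesis using ys 2 by (intro exI[of _ "as @ bs"]) auto
    qed
  qed (intro exI[of _ "[]"], simp)
  then show ?thesis using par_word[OF assms] by blast
qed

text \<open>Each step prepends a letter to a reduced word, so that the length goes up by one.\<close>

lemma par_induct [consumes 2, case_names one step]:
  assumes I: "I \<subseteq> S" and x: "x \<in> par I"
    and "P \<one>"
    and step: "\<And>r y. \<lbrakk>r \<in> I; y \<in> par I; len (r \<otimes> y) = Suc (len y); P y\<rbrakk> \<Longrightarrow> P (r \<otimes> y)"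
  shows "P x"
proof -
  have "P (wprod xs)" if "set xs \<subseteq> I" "length xs = len (wprod xs)" for xs
    using that
  proof (induction xs)
    case (Cons r xs)
    have xs: "set xs \<subseteq> I" "set xs \<subseteq> S" and r: "r \<in> I" "r \<in> S" using Cons.prems I by auto
    have "len (wprod xs) = length xs" "len (r \<otimes> wprod xs) = Suc (len (wprod xs))"
      using len_gen_left_cases[OF r(2), of "wprod xs"] xs len_le[of xs] Cons.prems by auto
    then show ?case using step[of r "wprod xs"] Cons.IH r xs wprod_par[OF xs(1) I] by simp
  qed (simp add: assms)
  then show ?thesis using par_reduced_word[OF I x] by metis
qed

lemma par_gen_mem:
  assumes "I \<subseteq> S" "r \<in> S" "r \<in> par I"
  shows "r \<in> I"
proof -
  obtain xs where "set xs \<subseteq> I" "length xs = len r" "wprod xs = r"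
    using par_reduced_word[OF assms(1,3)] by blast
  then show ?thesis using assms by (cases xs) auto
qed

lemma par_len_one:
  assumes "I \<subseteq> S" "x \<in> par I" "len x = 1"
  shows "x \<in> I"
proof -
  obtain xs where "set xs \<subseteq> I" "length xs = len x" "wprod xs = x"
    using par_reduced_word[OF assms(1,2)] by blast
  then show ?thesis using assms by (cases xs) auto
qed

text \<open>The exchange condition deletes a letter from a word over \<open>I\<close>, so both \<open>x\<close> and \<open>rx\<close> lie
  in \<open>W\<^sub>I\<close>.\<close>

lemma par_left_descent:
  assumes I: "I \<subseteq> S" and x: "x \<in> par I" and r: "r \<in> S" and d: "len (r \<otimes> x) < len x"
  shows "r \<in> I"
proof -
  obtain xs where xs: "set xs \<subseteq> I" "length xs = len x" "wprod xs = x"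
    using par_reduced_word[OF I x] by blast
  have xsS: "set xs \<subseteq> S" using xs I by auto
  obtain as a bs where ab: "xs = as @ a # bs" "r \<otimes> x = wprod (as @ bs)"
    using exchange[OF r xsS, unfolded xs(3)] d by auto
  have "r \<otimes> x \<in> par I" unfolding ab(2) using ab(1) xs I by (intro wprod_par) auto
  then have "r \<otimes> x \<otimes> inv x \<in> par I" using par_mult par_inv I x by blast
  then have "r \<in> par I" using r par_closed[OF I x] by (simp add: m_assoc)
  then show ?thesis using par_gen_mem I r by blast
qed

lemma par_right_descent:
  assumes I: "I \<subseteq> S" and x: "x \<in> par I" and r: "r \<in> S" and d: "len (x \<otimes> r) < len x"
  shows "r \<in> I"
  using par_left_descent[of I "inv x" r] par_inv[OF I x] par_closed[OF I x] assms
  by (simp add: len_gen_right)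

text \<open>In a length-additive product, the first letter of \<open>x\<close> is a left descent of the product and
  hence belongs to \<open>I\<close>.\<close>

lemma par_prefix:
  assumes I: "I \<subseteq> S" and xy: "x \<in> carrier W" "y \<in> carrier W" "x \<otimes> y \<in> par I"
    and add: "len (x \<otimes> y) = len x + len y"
  shows "x \<in> par I"
proof -
  have "x \<in> par S" using xy gens_generate by simp
  have "x \<otimes> y \<in> par I \<longrightarrow> len (x \<otimes> y) = len x + len y \<longrightarrow> x \<in> par I"
    using subset_refl[of S] \<open>x \<in> par S\<close>
  proof (induction x rule: par_induct)
    case (step r x)
    have c: "r \<in> carrier W" "x \<in> carrier W" using step gens_generate by auto
    show ?case
    proof (intro impI)
      assume *: "r \<otimes> x \<otimes> y \<in> par I" "len (r \<otimes> x \<otimes> y) = len (r \<otimes> x) + len y"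
      have e: "r \<otimes> (r \<otimes> x \<otimes> y) = x \<otimes> y" using c step xy by (simp add: m_assoc)
      have l: "len (x \<otimes> y) \<le> len x + len y" using len_mult c xy by blast
      then have "r \<in> I"
        using par_left_descent[OF I *(1) step(1)] e * step by simp
      moreover from this have "x \<otimes> y \<in> par I" using e *(1) par_mult[OF I par_gen] by metis
      moreover have "len (x \<otimes> y) = len x + len y"
        using l *(2) step len_mult[of r "x \<otimes> y"] c xy by (simp add: m_assoc)
      ultimately show "r \<otimes> x \<in> par I" using step par_mult par_gen I by blast
    qed
  qed auto
  then show ?thesis using xy add by blast
qed

section \<open>Length in double cosets\<close>

abbreviation dcoset :: "'a set \<Rightarrow> 'a set \<Rightarrow> 'a \<Rightarrow> 'a set" where "dcoset \<equiv> double_coset W"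

lemma mem_dcoset: "z \<in> dcoset J I x \<longleftrightarrow> (\<exists>a \<in> par J. \<exists>b \<in> par I. z = a \<otimes> x \<otimes> b)"
  by (auto simp: double_coset_def r_coset_def set_mult_def)

lemma dcoset_self: "x \<in> carrier W \<Longrightarrow> x \<in> dcoset J I x"
  unfolding mem_dcoset by (intro bexI[of _ \<one>]) auto

lemma dcoset_closed:
  assumes "J \<subseteq> S" "I \<subseteq> S" "x \<in> carrier W" "z \<in> dcoset J I x"
  shows "z \<in> carrier W"
  using assms by (auto simp: mem_dcoset par_closed)

lemma dcoset_eq:
  assumes J: "J \<subseteq> S" and I: "I \<subseteq> S" and x: "x \<in> carrier W" and z: "z \<in> dcoset J I x"
  shows "dcoset J I z = dcoset J I x"
proof -
  have sub: "dcoset J I y \<subseteq> dcoset J I y'" if "y \<in> dcoset J I y'" "y' \<in> carrier W" for y y'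
  proof
    fix v assume "v \<in> dcoset J I y"
    with that obtain a b c d where *: "a \<in> par J" "b \<in> par I" "v = a \<otimes> y \<otimes> b"
       "c \<in> par J" "d \<in> par I" "y = c \<otimes> y' \<otimes> d" unfolding mem_dcoset by blast
    have "v = (a \<otimes> c) \<otimes> y' \<otimes> (d \<otimes> b)" using * that par_closed J I by (simp add: m_assoc)
    then show "v \<in> dcoset J I y'" using * par_mult J I unfolding mem_dcoset by blast
  qed
  obtain a b where *: "a \<in> par J" "b \<in> par I" "z = a \<otimes> x \<otimes> b" using z unfolding mem_dcoset by blast
  have "x = inv a \<otimes> z \<otimes> inv b" using * x par_closed J I by (simp add: m_assoc)
  then have "x \<in> dcoset J I z" using * par_inv J I unfolding mem_dcoset by blast
  then show ?thesis using sub z x dcoset_closed[OF J I x z] by blast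
qed

lemma dcoset_inv:
  assumes J: "J \<subseteq> S" and I: "I \<subseteq> S" and x: "x \<in> carrier W" and z: "z \<in> dcoset J I x"
  shows "inv z \<in> dcoset I J (inv x)"
proof -
  obtain a b where *: "a \<in> par J" "b \<in> par I" "z = a \<otimes> x \<otimes> b" using z unfolding mem_dcoset by blast
  have "inv z = inv b \<otimes> inv x \<otimes> inv a" using * x par_closed J I by (simp add: m_assoc inv_mult_group)
  then show ?thesis using * par_inv J I unfolding mem_dcoset by blast
qed

text \<open>The two predicates ask for descents only.  This suffices to characterise the Bruhat-minimal and the
  Bruhat-maximal element of \<open>W\<^sub>J x W\<^sub>I\<close> (\<open>coset_min_eq\<close>, \<open>coset_max_eq\<close>), and it makes
  one-sided cosets the special cases \<open>J = {}\<close> and \<open>I = {}\<close>.\<close>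

definition coset_minimal :: "'a set \<Rightarrow> 'a set \<Rightarrow> 'a \<Rightarrow> bool" where
  "coset_minimal J I x \<longleftrightarrow> x \<in> carrier W \<and>
     (\<forall>r\<in>J. len x < len (r \<otimes> x)) \<and> (\<forall>r\<in>I. len x < len (x \<otimes> r))"

definition coset_maximal :: "'a set \<Rightarrow> 'a set \<Rightarrow> 'a \<Rightarrow> bool" where
  "coset_maximal J I x \<longleftrightarrow> x \<in> carrier W \<and>
     (\<forall>r\<in>J. len (r \<otimes> x) < len x) \<and> (\<forall>r\<in>I. len (x \<otimes> r) < len x)"

lemma coset_minimal_inv:
  assumes "J \<subseteq> S" "I \<subseteq> S" "coset_minimal J I x"
  shows "coset_minimal I J (inv x)"
proof -
  have x: "x \<in> carrier W" using assms(3) coset_minimal_def by blast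
  have "len (inv x) < len (r \<otimes> inv x)" if r: "r \<in> I" for r
  proof -
    have "len x < len (x \<otimes> r)" using assms(3) r unfolding coset_minimal_def by blast
    then show ?thesis using len_gen_right[of r x] x subsetD[OF assms(2) r] by simp
  qed
  moreover have "len (inv x) < len (inv x \<otimes> r)" if r: "r \<in> J" for r
  proof -
    have "len x < len (r \<otimes> x)" using assms(3) r unfolding coset_minimal_def by blast
    then show ?thesis using len_gen_right[of r "inv x"] x subsetD[OF assms(1) r] by simp
  qed
  ultimately show ?thesis using x by (simp add: coset_minimal_def)
qed

lemma coset_maximal_inv:
  assumes "J \<subseteq> S" "I \<subseteq> S" "coset_maximal J I x"
  shows "coset_maximal I J (inv x)"
proof -
  have x: "x \<in> carrier W" using assms(3) coset_maximal_def by blast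
  have "len (r \<otimes> inv x) < len (inv x)" if r: "r \<in> I" for r
  proof -
    have "len (x \<otimes> r) < len x" using assms(3) r unfolding coset_maximal_def by blast
    then show ?thesis using len_gen_right[of r x] x subsetD[OF assms(2) r] by simp
  qed
  moreover have "len (inv x \<otimes> r) < len (inv x)" if r: "r \<in> J" for r
  proof -
    have "len (r \<otimes> x) < len x" using assms(3) r unfolding coset_maximal_def by blast
    then show ?thesis using len_gen_right[of r "inv x"] x subsetD[OF assms(1) r] by simp
  qed
  ultimately show ?thesis using x by (simp add: coset_maximal_def)
qed

definition additive :: "'a set \<Rightarrow> 'a set \<Rightarrow> 'a \<Rightarrow> 'a \<Rightarrow> bool" where
  "additive J I x z \<longleftrightarrow>
     (\<exists>a\<in>par J. \<exists>b\<in>par I. z = a \<otimes> x \<otimes> b \<and> len z = len a + len x + len b)"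

lemma additive_inv:
  assumes J: "J \<subseteq> S" and I: "I \<subseteq> S" and x: "x \<in> carrier W" and z: "additive J I x z"
  shows "additive I J (inv x) (inv z)"
proof -
  obtain a b where *: "a \<in> par J" "b \<in> par I" "z = a \<otimes> x \<otimes> b" "len z = len a + len x + len b"
    using z unfolding additive_def by blast
  have c: "a \<in> carrier W" "b \<in> carrier W" using * par_closed J I by auto
  then have "inv z = inv b \<otimes> inv x \<otimes> inv a" using * x by (simp add: m_assoc inv_mult_group)
  moreover have "len (inv z) = len (inv b) + len (inv x) + len (inv a)" using c * x by simp
  ultimately show ?thesis using * par_inv J I unfolding additive_def by blast
qed

text \<open>If \<open>rz\<close> is shorter than \<open>z\<close>, apply the exchange condition to a word of \<open>z\<close> composed of reduced words of
  \<open>a\<close>, \<open>x\<close> and \<open>b\<close>.  The deleted letter belongs to \<open>a\<close> or \<open>b\<close>, as otherwise the double coset would have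
  an element shorter than \<open>x\<close>.\<close>

lemma additive_step:
  assumes J: "J \<subseteq> S" and I: "I \<subseteq> S" and x: "x \<in> carrier W"
    and min: "\<And>y. y \<in> dcoset J I x \<Longrightarrow> len x \<le> len y"
    and z: "additive J I x z" and r: "r \<in> J"
  shows "additive J I x (r \<otimes> z)"
proof -
  obtain a b where *: "a \<in> par J" "b \<in> par I" "z = a \<otimes> x \<otimes> b" "len z = len a + len x + len b"
    using z unfolding additive_def by blast
  have c: "a \<in> carrier W" "b \<in> carrier W" "r \<in> S" "r \<in> carrier W" "z \<in> carrier W"
    using * par_closed J I r x by auto
  have rz: "r \<otimes> z = (r \<otimes> a) \<otimes> x \<otimes> b" using c x * by (simp add: m_assoc)
  consider "len (r \<otimes> z) = Suc (len z)" | "len z = Suc (len (r \<otimes> z))"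
    using len_gen_left_cases c by blast
  then show ?thesis
  proof cases
    case 1
    have "len (r \<otimes> z) \<le> len (r \<otimes> a) + len x + len b"
      unfolding rz using len_mult[of "r \<otimes> a \<otimes> x" b] len_mult[of "r \<otimes> a" x] c x by simp
    then have "len (r \<otimes> z) = len (r \<otimes> a) + len x + len b"
      using 1 * len_mult[of r a] c by auto
    then show ?thesis using rz * r J par_mult par_gen unfolding additive_def by blast
  next
    case 2
    obtain as where as: "set as \<subseteq> J" "length as = len a" "wprod as = a"
      using par_reduced_word[OF J *(1)] by blast
    obtain bs where bs: "set bs \<subseteq> I" "length bs = len b" "wprod bs = b"
      using par_reduced_word[OF I *(2)] by blast
    obtain xs where xs: "set xs \<subseteq> S" "length xs = len x" "wprod xs = x"
      using reduced_word[OF x] by blast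
    have S: "set as \<subseteq> S" "set bs \<subseteq> S" using as bs J I by auto
    have zw: "wprod (as @ xs @ bs) = z" using as bs xs S * c x by (simp add: wprod_append m_assoc)
    obtain ls l rs where del: "as @ xs @ bs = ls @ l # rs" "r \<otimes> z = wprod (ls @ rs)"
      using exchange[OF c(3), of "as @ xs @ bs"] zw 2 S xs by auto
    have lz: "len (r \<otimes> z) + 1 = length as + length xs + length bs" using 2 * as xs bs by simp
    consider cs where "as = ls @ l # cs" "rs = cs @ xs @ bs"
      | ds cs where "ls = as @ ds" "xs = ds @ l # cs" "rs = cs @ bs"
      | cs where "ls = as @ xs @ cs" "bs = cs @ l # rs"
      using del(1) by (auto simp: append_eq_append_conv2 append_eq_Cons_conv Cons_eq_append_conv)
    then show ?thesis
    proof cases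
      case 1
      let ?a = "wprod (ls @ cs)"
      have s: "set (ls @ cs) \<subseteq> J" "set ls \<subseteq> S" "set cs \<subseteq> S" using as 1 J by auto
      then have "?a \<in> par J" using wprod_par J by blast
      moreover have e: "r \<otimes> z = ?a \<otimes> x \<otimes> b"
        using del 1 s S xs bs c x by (simp add: wprod_append m_assoc)
      moreover have "len (r \<otimes> z) = len ?a + len x + len b"
      proof -
        have "len ?a + 1 \<le> length as" using len_le[of "ls @ cs"] s 1 by simp
        moreover have "len (r \<otimes> z) \<le> len ?a + len x + len b"
          unfolding e using len_mult[of "?a \<otimes> x" b] len_mult[of ?a x] s c x by simp
        ultimately show ?thesis using lz xs bs by linarith
      qed
      ultimately show ?thesis using * unfolding additive_def by blast
    next
      case 2
      let ?x = "wprod (ds @ cs)"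
      have s: "set ds \<subseteq> S" "set cs \<subseteq> S" using xs 2 by auto
      have e: "r \<otimes> z = a \<otimes> ?x \<otimes> b"
        using del 2 s S as bs c by (simp add: wprod_append m_assoc)
      then have "?x = (inv a \<otimes> r \<otimes> a) \<otimes> x \<otimes> (b \<otimes> inv b)"
      proof -
        have "inv a \<otimes> (r \<otimes> z) \<otimes> inv b = ?x" unfolding e using c s by (simp add: m_assoc)
        then show ?thesis using * c x s by (simp add: m_assoc)
      qed
      then have "?x \<in> dcoset J I x"
        unfolding mem_dcoset using * r par_mult par_inv par_gen J I by metis
      then have "len x \<le> len ?x" by (rule min)
      moreover have "len ?x < len x" using len_le[of "ds @ cs"] s 2 xs by auto
      ultimately show ?thesis by simp
    next
      case 3
      let ?b = "wprod (cs @ rs)"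
      have s: "set (cs @ rs) \<subseteq> I" "set rs \<subseteq> S" "set cs \<subseteq> S" using bs 3 I by auto
      then have "?b \<in> par I" using wprod_par I by blast
      moreover have e: "r \<otimes> z = a \<otimes> x \<otimes> ?b"
        using del 3 s S xs as c x by (simp add: wprod_append m_assoc)
      moreover have "len (r \<otimes> z) = len a + len x + len ?b"
      proof -
        have "len ?b + 1 \<le> length bs" using len_le[of "cs @ rs"] s 3 by simp
        moreover have "len (r \<otimes> z) \<le> len a + len x + len ?b"
          unfolding e using len_mult[of "a \<otimes> x" ?b] len_mult[of a x] s c x by simp
        ultimately show ?thesis using lz xs as by linarith
      qed
      ultimately show ?thesis using * unfolding additive_def by blast
    qed
  qed
qed

text \<open>The element \<open>z = axb\<close> is reached from \<open>x\<close> by multiplying with the letters of \<open>b\<close> on the right,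
  which the passage to inverses turns into steps on the left, and then with the letters of \<open>a\<close> on the
  left.\<close>

lemma additive_of_shortest:
  assumes J: "J \<subseteq> S" and I: "I \<subseteq> S" and x: "x \<in> carrier W"
    and min: "\<And>y. y \<in> dcoset J I x \<Longrightarrow> len x \<le> len y"
    and z: "z \<in> dcoset J I x"
  shows "additive J I x z"
proof -
  obtain a b where *: "a \<in> par J" "b \<in> par I" "z = a \<otimes> x \<otimes> b" using z unfolding mem_dcoset by blast
  have xx: "additive I J (inv x) (inv x)"
    unfolding additive_def using x by (intro bexI[of _ \<one>]) auto
  have min': "len (inv x) \<le> len y" if "y \<in> dcoset I J (inv x)" for y
  proof -
    have "inv y \<in> dcoset J I x" using dcoset_inv[OF I J _ that] x by simp
    then show ?thesis using min[of "inv y"] dcoset_closed[OF I J _ that] x by simp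
  qed
  have ib: "inv b \<in> par I" using par_inv I * by simp
  have "additive I J (inv x) (c \<otimes> inv x)" if c: "c \<in> par I" for c
    using I c
  proof (induction c rule: par_induct)
    case one
    then show ?case using xx x by simp
  next
    case (step r y)
    then show ?case using additive_step[OF I J _ min' step(4), of r] x par_closed[OF I] I
      by (simp add: m_assoc subset_iff)
  qed
  from this[OF ib] have xb: "additive J I x (x \<otimes> b)"
    using additive_inv[OF I J, of "inv x" "inv b \<otimes> inv x"] x * par_closed[OF I]
    by (simp add: inv_mult_group)
  have "additive J I x (a \<otimes> (x \<otimes> b))"
    using J *(1)
  proof (induction a rule: par_induct)
    case one
    then show ?case using xb x * par_closed[OF I] by simp
  next
    case (step r y)
    then show ?case
      using additive_step[OF J I x min step(4), of r] x * par_closed[OF I] par_closed[OF J] J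
      by (simp add: m_assoc subset_iff)
  qed
  then show ?thesis using * x par_closed I J by (simp add: m_assoc)
qed

lemma par_nontrivial_descent:
  assumes I: "I \<subseteq> S" and a: "a \<in> par I" "a \<noteq> \<one>"
  shows "\<exists>r\<in>I. len (r \<otimes> a) < len a"
proof -
  obtain as where as: "set as \<subseteq> I" "length as = len a" "wprod as = a"
    using par_reduced_word[OF I a(1)] by blast
  with a obtain r bs where rb: "as = r # bs" by (cases as) auto
  have s: "r \<in> S" "set bs \<subseteq> S" "r \<in> I" using as I rb by auto
  have "r \<otimes> a = wprod bs" using as(3) rb s by auto
  then have "len (r \<otimes> a) < len a" using len_le[OF s(2)] as(2) rb by simp
  then show ?thesis using s by blast
qed

lemma coset_minimal_trivial:
  assumes J: "J \<subseteq> S" and I: "I \<subseteq> S" and x: "coset_minimal J I x"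
    and c: "a \<in> par J" "y \<in> carrier W" "x = a \<otimes> y" "len x = len a + len y"
  shows "a = \<one>"
proof (rule ccontr)
  assume "a \<noteq> \<one>"
  then obtain r where r: "r \<in> J" "len (r \<otimes> a) < len a" using par_nontrivial_descent J c by blast
  have "len (r \<otimes> x) \<le> len (r \<otimes> a) + len y"
    using len_mult[of "r \<otimes> a" y] c r J par_closed[OF J c(1)] by (simp add: m_assoc subset_iff)
  then show False using x r c unfolding coset_minimal_def by force
qed

lemma ex_shortest:
  assumes J: "J \<subseteq> S" and I: "I \<subseteq> S" and x: "x \<in> carrier W"
  shows "\<exists>x0 \<in> dcoset J I x. coset_minimal J I x0 \<and> (\<forall>z\<in>dcoset J I x. len x0 \<le> len z)"
proof -
  obtain x0 where x0: "x0 \<in> dcoset J I x" "\<forall>z. z \<in> dcoset J I x \<longrightarrow> len x0 \<le> len z"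
    using ex_has_least_nat[of "\<lambda>z. z \<in> dcoset J I x" x len] dcoset_self[OF x] by blast
  have c: "x0 \<in> carrier W" using dcoset_closed[OF J I x x0(1)] .
  have "len x0 < len (r \<otimes> x0)" if "r \<in> J" for r
  proof -
    have "r \<otimes> x0 \<in> dcoset J I x0" unfolding mem_dcoset
      using that J c par_gen[OF that] by (intro bexI[of _ r] bexI[of _ \<one>]) auto
    then show ?thesis using x0 dcoset_eq[OF J I x x0(1)] len_gen_left_cases[of r x0] that J c
      by fastforce
  qed
  moreover have "len x0 < len (x0 \<otimes> r)" if "r \<in> I" for r
  proof -
    have "x0 \<otimes> r \<in> dcoset J I x0" unfolding mem_dcoset
      using that I c par_gen[OF that] by (intro bexI[of _ \<one>] bexI[of _ r]) auto
    then show ?thesis using x0 dcoset_eq[OF J I x x0(1)] len_gen_right_cases[of r x0] that I c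
      by fastforce
  qed
  ultimately show ?thesis using x0 c unfolding coset_minimal_def by blast
qed

text \<open>In an additive decomposition \<open>x = a x\<^sub>0 b\<close> over a shortest element \<open>x\<^sub>0\<close>, a nontrivial factor \<open>a\<close> or
  \<open>b\<close> would give a descent of \<open>x\<close>.\<close>

lemma coset_minimal_shortest:
  assumes J: "J \<subseteq> S" and I: "I \<subseteq> S" and x: "coset_minimal J I x"
    and z: "z \<in> dcoset J I x"
  shows "len x \<le> len z"
proof -
  have xc: "x \<in> carrier W" using x coset_minimal_def by blast
  obtain x0 where x0: "x0 \<in> dcoset J I x" "\<forall>z \<in> dcoset J I x. len x0 \<le> len z"
    using ex_shortest[OF J I xc] by blast
  have c: "x0 \<in> carrier W" using dcoset_closed[OF J I xc x0(1)] .
  have eq: "dcoset J I x0 = dcoset J I x" using dcoset_eq[OF J I xc x0(1)] .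
  have "additive J I x0 x"
    using additive_of_shortest[OF J I c] x0 eq dcoset_self[OF xc] by metis
  then obtain a b where *: "a \<in> par J" "b \<in> par I" "x = a \<otimes> x0 \<otimes> b" "len x = len a + len x0 + len b"
    unfolding additive_def by blast
  have ac: "a \<in> carrier W" "b \<in> carrier W" using * par_closed J I by auto
  have "a = \<one>"
  proof (rule coset_minimal_trivial[OF J I x *(1)])
    show "x = a \<otimes> (x0 \<otimes> b)" using * ac c by (simp add: m_assoc)
    show "len x = len a + len (x0 \<otimes> b)"
      using * ac c len_mult[of a "x0 \<otimes> b"] len_mult[of x0 b] by (simp add: m_assoc)
  qed (use ac c in simp)
  moreover have "inv b = \<one>"
  proof (rule coset_minimal_trivial[OF I J coset_minimal_inv[OF J I x]])
    show "inv b \<in> par I" using par_inv I * by blast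
    show "inv x = inv b \<otimes> inv (a \<otimes> x0)" using * ac c by (simp add: inv_mult_group)
    show "len (inv x) = len (inv b) + len (inv (a \<otimes> x0))"
      using * ac c xc len_mult[of "a \<otimes> x0" b] len_mult[of a x0] by simp
  qed (use ac c in simp)
  ultimately have "x = x0" using * c ac by (metis inv_inv inv_one l_one r_one)
  then show ?thesis using x0 z by blast
qed

lemma coset_minimal_dec:
  assumes J: "J \<subseteq> S" and I: "I \<subseteq> S" and x: "coset_minimal J I x"
    and z: "z \<in> dcoset J I x"
  obtains a b where "a \<in> par J" "b \<in> par I" "z = a \<otimes> x \<otimes> b" "len z = len a + len x + len b"
  using additive_of_shortest[OF J I _ coset_minimal_shortest[OF J I x] z] x
  unfolding additive_def coset_minimal_def by blast

lemma right_minimal_len: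
  assumes I: "I \<subseteq> S" and x: "coset_minimal {} I x" and b: "b \<in> par I"
  shows "len (x \<otimes> b) = len x + len b"
proof -
  have c: "x \<in> carrier W" "b \<in> carrier W" using x coset_minimal_def b par_closed I by auto
  have "x \<otimes> b \<in> dcoset {} I x" unfolding mem_dcoset
    using b c by (intro bexI[of _ \<one>] bexI[of _ b]) auto
  from coset_minimal_dec[OF empty_subsetI I x this]
  obtain a b' where *: "a \<in> par {}" "b' \<in> par I" "x \<otimes> b = a \<otimes> x \<otimes> b'" "len (x \<otimes> b) = len a + len x + len b'"
    by blast
  have "a = \<one>" using *(1) by (simp add: generate_empty)
  moreover from this have "b' = b" using * c par_closed[OF I *(2)] by simp
  ultimately show ?thesis using * by simp
qed

lemma left_minimal_len:
  assumes J: "J \<subseteq> S" and x: "coset_minimal J {} x" and a: "a \<in> par J"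
  shows "len (a \<otimes> x) = len a + len x"
proof -
  have c: "x \<in> carrier W" "a \<in> carrier W" using x coset_minimal_def a par_closed J by auto
  have "len (inv x \<otimes> inv a) = len (inv x) + len (inv a)"
    using right_minimal_len[OF J coset_minimal_inv[OF J _ x] par_inv[OF J a]] by simp
  then show ?thesis using c len_inv[of "a \<otimes> x"] by (simp add: inv_mult_group)
qed

text \<open>An element \<open>v\<close> of \<open>W\<^sub>J\<close> is split off from \<open>y\<close> letter by letter: if \<open>y = v \<cdot> y'\<close> is additive and
  \<open>rv\<close> is longer than \<open>v\<close>, the letter that the exchange condition deletes to form \<open>ry\<close>
  belongs to \<open>y'\<close>, so \<open>rv\<close> can be split off additively as well.\<close>

lemma left_maximal_len:
  assumes J: "J \<subseteq> S" and y: "coset_maximal J I y" and a: "a \<in> par J"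
  shows "len (a \<otimes> y) + len a = len y"
proof -
  have yc: "y \<in> carrier W" using y coset_maximal_def by blast
  have "len (inv v \<otimes> y) + len v = len y" if "v \<in> par J" for v
    using J that
  proof (induction v rule: par_induct)
    case (step r v)
    have c: "r \<in> S" "v \<in> carrier W" using step J par_closed by auto
    obtain vs where vs: "set vs \<subseteq> J" "length vs = len v" "wprod vs = v"
      using par_reduced_word[OF J step(2)] by blast
    obtain ys where ys: "set ys \<subseteq> S" "length ys = len (inv v \<otimes> y)" "wprod ys = inv v \<otimes> y"
      using reduced_word[of "inv v \<otimes> y"] c yc by auto
    have vS: "set vs \<subseteq> S" using vs J by auto
    have w: "wprod (vs @ ys) = y" using vs ys vS c yc by (simp add: wprod_append)
    have "len (r \<otimes> y) < len y" using y step unfolding coset_maximal_def by blast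
    then obtain ls l rs where del: "vs @ ys = ls @ l # rs" "r \<otimes> y = wprod (ls @ rs)"
      using exchange[OF c(1), of "vs @ ys"] w vS ys by auto
    consider cs where "vs = ls @ l # cs" "rs = cs @ ys"
      | cs where "ls = vs @ cs" "ys = cs @ l # rs"
      using del(1) by (auto simp: append_eq_append_conv2 append_eq_Cons_conv Cons_eq_append_conv)
    then show ?case
    proof cases
      case 1
      have s: "set ls \<subseteq> S" "set cs \<subseteq> S" using vS 1 by auto
      have "r \<otimes> y = wprod (ls @ cs) \<otimes> (inv v \<otimes> y)"
        using del 1 s ys c yc by (simp add: wprod_append m_assoc)
      then have "r \<otimes> y = (wprod (ls @ cs) \<otimes> inv v) \<otimes> y" using s c yc by (simp add: m_assoc)
      moreover have "wprod (ls @ cs) \<in> carrier W" using s by simp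
      ultimately have "r = wprod (ls @ cs) \<otimes> inv v" using c yc by simp
      then have "r \<otimes> v = wprod (ls @ cs)" using s c by (simp add: m_assoc)
      then have "len (r \<otimes> v) \<le> len v" using len_le[of "ls @ cs"] s vs 1 by simp
      then show ?thesis using step by simp
    next
      case 2
      have s: "set cs \<subseteq> S" "set rs \<subseteq> S" using ys 2 by auto
      have "r \<otimes> y = v \<otimes> wprod (cs @ rs)"
        using del 2 s vs vS c by (simp add: wprod_append m_assoc)
      then have "inv (r \<otimes> v) \<otimes> y = wprod (cs @ rs)"
        using c yc s by (simp add: inv_mult_group m_assoc)
      then have "len (inv (r \<otimes> v) \<otimes> y) + 1 \<le> len (inv v \<otimes> y)"
        using len_le[of "cs @ rs"] s ys 2 by simp
      moreover have "len y \<le> len (r \<otimes> v) + len (inv (r \<otimes> v) \<otimes> y)"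
        using len_mult[of "r \<otimes> v" "inv (r \<otimes> v) \<otimes> y"] c yc by simp
      ultimately show ?thesis using step by simp
    qed
  qed (use yc in simp)
  from this[of "inv a"] show ?thesis using par_inv[OF J a] par_closed[OF J a] by simp
qed

lemma right_maximal_len:
  assumes J: "J \<subseteq> S" and I: "I \<subseteq> S" and y: "coset_maximal J I y" and b: "b \<in> par I"
  shows "len (y \<otimes> b) + len b = len y"
proof -
  have c: "y \<in> carrier W" "b \<in> carrier W" using y coset_maximal_def b par_closed I by auto
  show ?thesis
    using left_maximal_len[OF I coset_maximal_inv[OF J I y] par_inv[OF I b]] c
      len_inv[of "y \<otimes> b"] by (simp add: inv_mult_group)
qed

section \<open>Longest elements\<close>

abbreviation wl :: "'a set \<Rightarrow> 'a" where "wl \<equiv> longest W S"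
abbreviation fin :: "'a set \<Rightarrow> bool" where "fin \<equiv> finitary W S"

lemma fin_subset: "fin I \<Longrightarrow> I \<subseteq> S"
  by (simp add: finitary_def)

lemma fin_mono: "fin I \<Longrightarrow> I' \<subseteq> I \<Longrightarrow> fin I'"
  unfolding finitary_def using par_mono finite_subset subsetI by (metis subset_trans)

lemma dcoset_finite:
  assumes "fin J" "fin I"
  shows "finite (dcoset J I x)"
proof -
  have "dcoset J I x = (\<lambda>(a, b). a \<otimes> x \<otimes> b) ` (par J \<times> par I)"
    unfolding set_eq_iff mem_dcoset by auto
  then show ?thesis using assms by (simp add: finitary_def)
qed

lemma dcoset_gen:
  assumes "J \<subseteq> S" "I \<subseteq> S" "x \<in> carrier W"
  shows "r \<in> J \<Longrightarrow> r \<otimes> x \<in> dcoset J I x" "r \<in> I \<Longrightarrow> x \<otimes> r \<in> dcoset J I x"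
proof -
  show "r \<otimes> x \<in> dcoset J I x" if "r \<in> J" unfolding mem_dcoset
    using that assms par_gen[OF that] by (intro bexI[of _ r] bexI[of _ \<one>]) auto
  show "x \<otimes> r \<in> dcoset J I x" if "r \<in> I" unfolding mem_dcoset
    using that assms par_gen[OF that] by (intro bexI[of _ \<one>] bexI[of _ r]) auto
qed

lemma coset_maximal_of_longest:
  assumes J: "J \<subseteq> S" and I: "I \<subseteq> S" and y: "y \<in> carrier W"
    and max: "\<And>z. z \<in> dcoset J I y \<Longrightarrow> len z \<le> len y"
  shows "coset_maximal J I y"
proof -
  have "len (r \<otimes> y) < len y" if "r \<in> J" for r
    using max[OF dcoset_gen(1)[OF J I y that]] len_gen_left_cases[of r y] that J y by fastforce
  moreover have "len (y \<otimes> r) < len y" if "r \<in> I" for r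
    using max[OF dcoset_gen(2)[OF J I y that]] len_gen_right_cases[of r y] that I y by fastforce
  ultimately show ?thesis using y by (simp add: coset_maximal_def)
qed

lemma ex_longest:
  assumes J: "fin J" and I: "fin I" and x: "x \<in> carrier W"
  shows "\<exists>y \<in> dcoset J I x. coset_maximal J I y \<and> (\<forall>z\<in>dcoset J I x. len z \<le> len y)"
proof -
  note JS = fin_subset[OF J] and IS = fin_subset[OF I]
  let ?p = "dcoset J I x"
  have "Max (len ` ?p) \<in> len ` ?p"
    using dcoset_finite[OF J I] dcoset_self[OF x] by (intro Max_in) auto
  then obtain y where y: "y \<in> ?p" "len y = Max (len ` ?p)" by auto
  then have m: "\<forall>z\<in>?p. len z \<le> len y" using dcoset_finite[OF J I] by simp
  moreover have "coset_maximal J I y"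
    using coset_maximal_of_longest[OF JS IS] dcoset_eq[OF JS IS x y(1)]
      dcoset_closed[OF JS IS x y(1)] m by auto
  ultimately show ?thesis using y by blast
qed

lemma par_maximal_unique:
  assumes I: "I \<subseteq> S" and w: "w \<in> par I" "coset_maximal {} I w" and v: "v \<in> par I" "coset_maximal {} I v"
  shows "w = v"
proof -
  have c: "w \<in> carrier W" "v \<in> carrier W" using w v par_closed I by auto
  have "len v + len (inv w \<otimes> v) = len w"
    using right_maximal_len[OF empty_subsetI I w(2), of "inv w \<otimes> v"] w v I c by (simp add: par_mult par_inv)
  moreover have "len w + len (inv v \<otimes> w) = len v"
    using right_maximal_len[OF empty_subsetI I v(2), of "inv v \<otimes> w"] w v I c by (simp add: par_mult par_inv)
  ultimately have "inv w \<otimes> v = \<one>" using len_eq_0[of "inv w \<otimes> v"] c by simp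
  then show ?thesis using c by (metis inv_closed inv_equality inv_inv)
qed

lemma dcoset_par:
  assumes I: "I \<subseteq> S" and x: "x \<in> par I"
  shows "dcoset {} I x = par I"
proof (rule Set.set_eqI)
  fix z
  have xc: "x \<in> carrier W" using par_closed[OF I x] .
  show "z \<in> dcoset {} I x \<longleftrightarrow> z \<in> par I"
  proof
    assume "z \<in> dcoset {} I x"
    then show "z \<in> par I" using I x xc par_mult par_closed by (auto simp: mem_dcoset generate_empty)
  next
    assume z: "z \<in> par I"
    then have "z = \<one> \<otimes> x \<otimes> (inv x \<otimes> z)" using xc par_closed[OF I] by simp
    then show "z \<in> dcoset {} I x" using par_mult par_inv par_one I x z unfolding mem_dcoset by blast
  qed
qed

lemma longest_eqI:
  assumes I: "fin I" and w: "w \<in> par I" "\<forall>r\<in>I. len (w \<otimes> r) < len w"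
  shows "wl I = w"
proof -
  note IS = fin_subset[OF I]
  have c: "w \<in> carrier W" using par_closed[OF IS w(1)] .
  then have m: "coset_maximal {} I w" using w by (simp add: coset_maximal_def)
  have fe: "fin {}" using fin_mono[OF I] by simp
  obtain y where "y \<in> par I" "coset_maximal {} I y" "\<forall>z\<in>par I. len z \<le> len y"
    using ex_longest[OF fe I c] dcoset_par[OF IS w(1)] by auto
  then have w2: "\<forall>z\<in>par I. len z \<le> len w" using par_maximal_unique[OF IS w(1) m] by blast
  show ?thesis unfolding longest_def
  proof (rule the_equality)
    fix v assume v: "v \<in> par I \<and> (\<forall>z\<in>par I. len z \<le> len v)"
    then have "coset_maximal {} I v"
      using coset_maximal_of_longest[OF empty_subsetI IS, of v] par_closed[OF IS, of v]
        dcoset_par[OF IS, of v] by blast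
    then show "v = w" using par_maximal_unique[OF IS w(1) m] v by blast
  qed (use w w2 in blast)
qed

lemma longest_par_maximal:
  assumes I: "fin I"
  shows "wl I \<in> par I \<and> coset_maximal {} I (wl I)"
proof -
  have "fin {}" using fin_mono[OF I] by simp
  from ex_longest[OF this I one_closed]
  obtain y where "y \<in> par I" "coset_maximal {} I y"
    using dcoset_par[OF fin_subset[OF I] par_one] by auto
  then show ?thesis using longest_eqI[OF I] by (simp add: coset_maximal_def)
qed

lemma longest_par: "fin I \<Longrightarrow> wl I \<in> par I"
  using longest_par_maximal by blast

lemma longest_closed [simp]: "fin I \<Longrightarrow> wl I \<in> carrier W"
  using longest_par fin_subset par_closed by blast

lemma longest_len:
  assumes "fin I" "b \<in> par I"
  shows "len (wl I \<otimes> b) + len b = len (wl I)"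
  using right_maximal_len[of "{}" I "wl I" b] longest_par_maximal[OF assms(1)] fin_subset[OF assms(1)] assms by blast

lemma longest_inv [simp]:
  assumes I: "fin I"
  shows "inv (wl I) = wl I"
proof -
  note IS = fin_subset[OF I]
  have "len (inv (wl I) \<otimes> r) < len (inv (wl I))" if r: "r \<in> I" for r
  proof -
    have p: "inv (wl I) \<otimes> r \<in> par I"
      using par_mult par_inv par_gen longest_par[OF I] IS r by blast
    then have "len (inv (wl I) \<otimes> r) \<le> len (wl I)"
      using longest_len[OF I, of "inv (wl I) \<otimes> (inv (wl I) \<otimes> r)"] longest_len[OF I p]
        longest_len[OF I par_mult[OF IS par_inv[OF IS longest_par[OF I]] p]] longest_closed[OF I]
        r IS by (simp add: subset_iff)
    then show ?thesis using len_gen_right_cases[of r "inv (wl I)"] longest_closed[OF I] r IS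
      by (simp add: subset_iff)
  qed
  then show ?thesis using longest_eqI[OF I par_inv[OF IS longest_par[OF I]]] by simp
qed

lemma longest_square [simp]:
  assumes "fin I"
  shows "wl I \<otimes> wl I = \<one>"
  using l_inv[OF longest_closed[OF assms]] longest_inv[OF assms] by simp

lemma longest_cancel [simp]:
  assumes "fin I" "x \<in> carrier W"
  shows "wl I \<otimes> (wl I \<otimes> x) = x"
  using assms by (simp flip: m_assoc)

lemma longest_maximal: "fin I \<Longrightarrow> coset_maximal I I (wl I)"
  using longest_par_maximal[of I] coset_maximal_inv[of "{}" I "wl I"] fin_subset[of I]
  by (auto simp: coset_maximal_def)

lemma longest_len_left:
  assumes "fin I" "b \<in> par I"
  shows "len (b \<otimes> wl I) + len b = len (wl I)"
  using left_maximal_len[OF fin_subset[OF assms(1)] longest_maximal assms(2)] assms by blast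

text \<open>Multiplication by the longest element turns the length \<open>l\<close> into its complement, so doing it on both
  sides preserves length one.\<close>

lemma longest_conj:
  assumes I: "fin I" and r: "r \<in> I"
  shows "wl I \<otimes> r \<otimes> wl I \<in> I"
proof -
  note IS = fin_subset[OF I] and wc = longest_closed[OF I]
  have rc: "r \<in> S" "r \<in> carrier W" using r IS by auto
  have p: "r \<otimes> wl I \<in> par I" using par_mult[OF IS par_gen longest_par[OF I]] r by blast
  have "len (r \<otimes> wl I) + 1 = len (wl I)"
    using longest_len_left[OF I par_gen[OF r]] rc by simp
  then have "len (wl I \<otimes> (r \<otimes> wl I)) = 1" using longest_len[OF I p] by simp
  moreover have "wl I \<otimes> (r \<otimes> wl I) \<in> par I" using par_mult[OF IS longest_par[OF I] p] .
  ultimately show ?thesis using par_len_one[OF IS] rc wc by (simp add: m_assoc)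
qed

lemma maximal_times_longest:
  assumes J: "J \<subseteq> S" and I: "fin I" and y: "coset_maximal J I y"
  shows "coset_minimal {} I (y \<otimes> wl I)"
proof -
  note IS = fin_subset[OF I]
  have yc: "y \<in> carrier W" using y coset_maximal_def by blast
  have "len (y \<otimes> wl I) < len (y \<otimes> wl I \<otimes> r)" if r: "r \<in> I" for r
  proof -
    have rc: "r \<in> S" using r IS by auto
    have "wl I \<otimes> r \<in> par I" using par_mult[OF IS longest_par[OF I] par_gen] r by blast
    then have "len (y \<otimes> (wl I \<otimes> r)) + len (wl I \<otimes> r) = len y"
      using right_maximal_len[OF J IS y] by blast
    moreover have "len (y \<otimes> wl I) + len (wl I) = len y"
      using right_maximal_len[OF J IS y longest_par[OF I]] .
    moreover have "len (wl I \<otimes> r) + len r = len (wl I)" using longest_len[OF I par_gen[OF r]] .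
    ultimately show ?thesis using rc yc I by (simp add: m_assoc)
  qed
  then show ?thesis using yc I by (simp add: coset_minimal_def)
qed

lemma longest_subset:
  assumes I: "fin I" and I': "fin I'" and eq: "wl I = wl I'"
  shows "I' \<subseteq> I"
proof
  fix r assume r: "r \<in> I'"
  then have "len (wl I \<otimes> r) < len (wl I)"
    using longest_maximal[OF I'] eq unfolding coset_maximal_def by simp
  then show "r \<in> I"
    using par_right_descent[OF fin_subset[OF I] longest_par[OF I]] r fin_subset[OF I'] by blast
qed

lemma longest_conj_conj:
  assumes I: "fin I" and g: "g \<in> carrier W"
  shows "wl I \<otimes> (wl I \<otimes> g \<otimes> wl I) \<otimes> wl I = g"
  using assms by (simp add: m_assoc)

text \<open>Conjugation by \<open>w\<^sub>I\<close> is an involution of \<open>I\<close>, so it commutes with complements in \<open>I\<close>.\<close>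

lemma longest_conj_image_Diff:
  assumes I: "fin I" and X: "X \<subseteq> I"
  shows "(\<lambda>g. wl I \<otimes> g \<otimes> wl I) ` (I - X) = I - (\<lambda>g. wl I \<otimes> g \<otimes> wl I) ` X"
proof -
  let ?f = "\<lambda>g. wl I \<otimes> g \<otimes> wl I"
  have "I \<subseteq> carrier W" using fin_subset[OF I] by auto
  then have ff: "?f (?f g) = g" if "g \<in> I" for g using longest_conj_conj[OF I] that by blast
  then have inj: "inj_on ?f I" by (metis (no_types, lifting) inj_onI)
  have "?f g \<in> I" if "g \<in> I" for g using longest_conj[OF I that] .
  then have "?f ` I = I" using ff by (metis (no_types, lifting) image_eqI image_subsetI subsetI subset_antisym)
  then show ?thesis using inj_on_image_set_diff[OF inj Diff_subset X] by simp
qed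

lemma conj_len_le:
  assumes A: "A \<subseteq> S" and g: "g \<in> carrier W" and AS: "\<And>r. r \<in> A \<Longrightarrow> g \<otimes> r \<otimes> inv g \<in> S"
    and x: "x \<in> par A"
  shows "len (g \<otimes> x \<otimes> inv g) \<le> len x"
  using A x
proof (induction x rule: par_induct)
  case one
  then show ?case using g by simp
next
  case (step r x)
  have c: "r \<in> carrier W" "x \<in> carrier W" using step A par_closed by auto
  have "g \<otimes> (r \<otimes> x) \<otimes> inv g = (g \<otimes> r \<otimes> inv g) \<otimes> (g \<otimes> x \<otimes> inv g)"
    using g c by (simp add: m_assoc)
  then have "len (g \<otimes> (r \<otimes> x) \<otimes> inv g) \<le> len (g \<otimes> r \<otimes> inv g) + len (g \<otimes> x \<otimes> inv g)"
    using len_mult[of "g \<otimes> r \<otimes> inv g" "g \<otimes> x \<otimes> inv g"] g c by simp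
  then show ?case using len_gen[OF AS[OF step(1)]] step by simp
qed

lemma ascent_outside:
  assumes A: "fin A" and r: "r \<in> S" "r \<notin> A"
  shows "len (wl A) < len (wl A \<otimes> r)"
  using par_right_descent[OF fin_subset[OF A] longest_par[OF A] r(1)] r(2)
    len_gen_right_cases[OF r(1) longest_closed[OF A]] by linarith

text \<open>On \<open>W\<^sub>X\<close>, left multiplication by \<open>y\<close> reverses the order of lengths, and \<open>r\<close> makes \<open>w\<^sub>A\<close> longer.\<close>

lemma maximal_longest_no_ascent:
  assumes J: "J \<subseteq> S" and X: "X \<subseteq> S" and y: "coset_maximal J X y"
    and A: "fin A" "A \<subseteq> X" and r: "r \<in> X" "r \<notin> A"
  shows "\<not> len (y \<otimes> wl A) < len (y \<otimes> wl A \<otimes> r)"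
proof -
  have rc: "r \<in> S" "r \<in> carrier W" "y \<in> carrier W" using r X y by (auto simp: coset_maximal_def)
  have wA: "wl A \<in> par X" using par_mono[OF A(2) longest_par[OF A(1)]] .
  have "len (wl A) < len (wl A \<otimes> r)" using ascent_outside[OF A(1) rc(1) r(2)] .
  moreover have "len (y \<otimes> (wl A \<otimes> r)) + len (wl A \<otimes> r) = len y"
    using right_maximal_len[OF J X y par_mult[OF X wA par_gen[OF r(1)]]] .
  moreover have "len (y \<otimes> wl A) + len (wl A) = len y"
    using right_maximal_len[OF J X y wA] .
  ultimately show ?thesis using rc A by (simp add: m_assoc)
qed

lemma right_minimal_in_par_trivial:
  assumes I: "I \<subseteq> S" and m: "coset_minimal {} I m" "m \<in> par I"
  shows "m = \<one>"
proof -
  have "m \<in> carrier W" using m coset_minimal_def by blast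
  then show ?thesis using right_minimal_len[OF I m(1) par_inv[OF I m(2)]] len_eq_0 by simp
qed

lemma longest_bound: "fin I \<Longrightarrow> b \<in> par I \<Longrightarrow> len b \<le> len (wl I)"
  using longest_len[of I b] by simp

section \<open>Bruhat-extremal elements of double cosets\<close>

lemma coset_minimal_unique:
  assumes J: "J \<subseteq> S" and I: "I \<subseteq> S" and x: "coset_minimal J I x"
    and z: "z \<in> dcoset J I x" and le: "len z \<le> len x"
  shows "z = x"
proof -
  obtain a b where *: "a \<in> par J" "b \<in> par I" "z = a \<otimes> x \<otimes> b" "len z = len a + len x + len b"
    using coset_minimal_dec[OF J I x z] .
  then have "a = \<one>" "b = \<one>" using le len_eq_0 par_closed[OF J] par_closed[OF I] by auto
  then show ?thesis using * x by (simp add: coset_minimal_def)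
qed

lemma left_minimal_dec:
  assumes J: "J \<subseteq> S" and I: "I \<subseteq> S" and x: "coset_minimal J I x"
    and z: "z \<in> dcoset J I x" "coset_minimal J {} z"
  obtains b where "b \<in> par I" "z = x \<otimes> b" "len z = len x + len b"
proof -
  obtain a b where *: "a \<in> par J" "b \<in> par I" "z = a \<otimes> x \<otimes> b" "len z = len a + len x + len b"
    using coset_minimal_dec[OF J I x z(1)] .
  have c: "a \<in> carrier W" "b \<in> carrier W" "x \<in> carrier W"
    using * par_closed J I x coset_minimal_def by auto
  have "a = \<one>"
  proof (rule coset_minimal_trivial[OF J empty_subsetI z(2) *(1)])
    show "z = a \<otimes> (x \<otimes> b)" using * c by (simp add: m_assoc)
    then show "len z = len a + len (x \<otimes> b)"
      using * c len_mult[of a "x \<otimes> b"] len_mult[of x b] by simp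
  qed (use c in simp)
  then show ?thesis using that[of b] * c by simp
qed

lemma right_minimal_dec:
  assumes J: "J \<subseteq> S" and I: "I \<subseteq> S" and x: "coset_minimal J I x"
    and z: "z \<in> dcoset J I x" "coset_minimal {} I z"
  obtains a where "a \<in> par J" "z = a \<otimes> x" "len z = len a + len x"
proof -
  have c: "x \<in> carrier W" "z \<in> carrier W" using x z(2) coset_minimal_def by auto
  obtain b where *: "b \<in> par J" "inv z = inv x \<otimes> b" "len (inv z) = len (inv x) + len b"
    using left_minimal_dec[OF I J coset_minimal_inv[OF J I x] dcoset_inv[OF J I c(1) z(1)]
        coset_minimal_inv[OF empty_subsetI I z(2)]] .
  have b: "b \<in> carrier W" using par_closed[OF J *(1)] .
  have "z = inv (inv z)" using c by simp
  also have "\<dots> = inv (inv x \<otimes> b)" unfolding *(2) ..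
  also have "\<dots> = inv b \<otimes> x" using c b by (simp add: inv_mult_group)
  finally have z': "z = inv b \<otimes> x" .
  have "len z = len (inv b) + len x" using *(3) b c by simp
  then show ?thesis using that[of "inv b"] z' par_inv[OF J *(1)] by blast
qed

text \<open>With \<open>m\<close> the shortest element of \<open>W\<^sub>J y\<close>, maximality gives \<open>y = w\<^sub>J m\<close>, and minimality of \<open>m\<close> on the left
  gives \<open>m = xb\<close>.\<close>

lemma coset_maximal_form:
  assumes J: "fin J" and I: "I \<subseteq> S" and x: "coset_minimal J I x"
    and y: "y \<in> dcoset J I x" "coset_maximal J I y"
  obtains b where "b \<in> par I" "y = wl J \<otimes> x \<otimes> b"
proof -
  note JS = fin_subset[OF J]
  have c: "x \<in> carrier W" "y \<in> carrier W" using x y(2) coset_minimal_def coset_maximal_def by auto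
  obtain m where m: "m \<in> dcoset J {} y" "coset_minimal J {} m"
    using ex_shortest[OF JS empty_subsetI c(2)] by blast
  have mc: "m \<in> carrier W" using m(2) coset_minimal_def by blast
  obtain v where v: "v \<in> par J" "m = v \<otimes> y"
    using m(1) c par_closed[OF JS] unfolding mem_dcoset by (auto simp: generate_empty)
  have vc: "v \<in> carrier W" using par_closed[OF JS v(1)] .
  have yv: "y = inv v \<otimes> m" using v c vc by simp
  have "len (v \<otimes> r) < len v" if r: "r \<in> J" for r
  proof -
    have rc: "r \<in> S" "r \<in> carrier W" using r JS by auto
    have "len (r \<otimes> y) < len y" using y(2) r unfolding coset_maximal_def by blast
    moreover have "len y = len (inv v) + len m"
      unfolding yv using left_minimal_len[OF JS m(2)] v par_inv[OF JS] by blast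
    moreover have "len (r \<otimes> y) = len (r \<otimes> inv v) + len m"
      using left_minimal_len[OF JS m(2), of "r \<otimes> inv v"] v(1) par_inv[OF JS] par_mult[OF JS] par_gen[OF r]
        yv mc vc rc by (simp add: m_assoc)
    ultimately show ?thesis using len_gen_right[OF rc(1) vc] vc by simp
  qed
  then have wv: "wl J = v" using longest_eqI[OF J v(1)] by blast
  have "m = v \<otimes> y \<otimes> \<one>" using v vc c by simp
  then have "m \<in> dcoset J I y" using v(1) par_one unfolding mem_dcoset by blast
  then have "m \<in> dcoset J I x" using dcoset_eq[OF JS I c(1) y(1)] by simp
  then obtain b where b: "b \<in> par I" "m = x \<otimes> b"
    using left_minimal_dec[OF JS I x _ m(2)] by blast
  have "y = wl J \<otimes> m" using yv wv J longest_inv[OF J] by simp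
  then show ?thesis using that[OF b(1)] b J c par_closed[OF I] by (simp add: m_assoc)
qed

text \<open>By \<open>coset_maximal_form\<close>, \<open>y\<close> and \<open>z\<close> differ by a right factor \<open>c\<close> from \<open>W\<^sub>I\<close>.  Both are maximal on the right, so
  multiplying by \<open>c\<close>, or by its inverse, can only decrease the length by that of \<open>c\<close>.\<close>

lemma coset_maximal_unique:
  assumes J: "fin J" and I: "I \<subseteq> S" and y: "coset_maximal J I y" and z: "coset_maximal J I z"
    and zy: "z \<in> dcoset J I y"
  shows "z = y"
proof -
  note JS = fin_subset[OF J]
  have c: "z \<in> carrier W" "y \<in> carrier W" using y z coset_maximal_def by auto
  obtain x where x: "x \<in> dcoset J I y" "coset_minimal J I x"
    using ex_shortest[OF JS I c(2)] by blast
  have xc: "x \<in> carrier W" using x(2) coset_minimal_def by blast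
  have e: "dcoset J I x = dcoset J I y" using dcoset_eq[OF JS I c(2) x(1)] .
  obtain b where b: "b \<in> par I" "y = wl J \<otimes> x \<otimes> b"
    using coset_maximal_form[OF J I x(2) _ y] dcoset_self[OF c(2)] e by blast
  obtain d where d: "d \<in> par I" "z = wl J \<otimes> x \<otimes> d"
    using coset_maximal_form[OF J I x(2) _ z] zy e by blast
  have bd: "b \<in> carrier W" "d \<in> carrier W" using b d par_closed I by auto
  have zb: "z = y \<otimes> (inv b \<otimes> d)" "y = z \<otimes> (inv d \<otimes> b)"
    using b d bd xc J by (simp_all add: m_assoc)
  have "len z + len (inv b \<otimes> d) = len y"
    using right_maximal_len[OF JS I y, of "inv b \<otimes> d"] zb(1) b d I par_mult par_inv by simp
  moreover have "len y + len (inv d \<otimes> b) = len z"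
    using right_maximal_len[OF JS I z, of "inv d \<otimes> b"] zb(2) b d I par_mult par_inv by simp
  ultimately have "inv b \<otimes> d = \<one>" using len_eq_0[of "inv b \<otimes> d"] bd by simp
  then show ?thesis using zb c by simp
qed

lemma bruhat_le_len:
  assumes "bruhat_le W S x y"
  shows "x = y \<or> len x < len y"
  using assms unfolding bruhat_le_def
  by (induction rule: rtranclp_induct) (auto simp: bruhat_step_def)

lemma bruhat_step_gen:
  assumes s: "s \<in> S" and x: "x \<in> carrier W"
  shows "len x < len (s \<otimes> x) \<Longrightarrow> bruhat_step W S x (s \<otimes> x)"
    and "len x < len (x \<otimes> s) \<Longrightarrow> bruhat_step W S x (x \<otimes> s)"
    and "len (s \<otimes> x) < len x \<Longrightarrow> bruhat_step W S (s \<otimes> x) x"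
    and "len (x \<otimes> s) < len x \<Longrightarrow> bruhat_step W S (x \<otimes> s) x"
proof -
  have l: "bruhat_step W S y (s \<otimes> y)" if y: "y \<in> carrier W" and "len y < len (s \<otimes> y)" for y
  proof -
    have "inv y \<otimes> s \<otimes> inv (inv y) \<in> reflections W S"
      unfolding reflections_def using s y by blast
    moreover have "s \<otimes> y = y \<otimes> (inv y \<otimes> s \<otimes> inv (inv y))" using s y by (simp add: m_assoc)
    ultimately show ?thesis unfolding bruhat_step_def using that by blast
  qed
  have r: "bruhat_step W S y (y \<otimes> s)" if y: "y \<in> carrier W" and "len y < len (y \<otimes> s)" for y
  proof -
    have "\<one> \<otimes> s \<otimes> inv \<one> \<in> reflections W S"
      unfolding reflections_def using s by blast
    then have "s \<in> reflections W S" using s by simp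
    then show ?thesis unfolding bruhat_step_def using that by blast
  qed
  show "len x < len (s \<otimes> x) \<Longrightarrow> bruhat_step W S x (s \<otimes> x)"
    and "len x < len (x \<otimes> s) \<Longrightarrow> bruhat_step W S x (x \<otimes> s)" using l r x by auto
  show "len (s \<otimes> x) < len x \<Longrightarrow> bruhat_step W S (s \<otimes> x) x"
    using l[of "s \<otimes> x"] s x by simp
  show "len (x \<otimes> s) < len x \<Longrightarrow> bruhat_step W S (x \<otimes> s) x"
    using r[of "x \<otimes> s"] s x by (simp add: m_assoc)
qed

lemma coset_max_eq:
  assumes J: "fin J" and I: "fin I" and y: "coset_maximal J I y"
  shows "coset_max W S (dcoset J I y) = y"
  unfolding coset_max_def
proof (rule the_equality)
  note JS = fin_subset[OF J] and IS = fin_subset[OF I]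
  have yc: "y \<in> carrier W" using y coset_maximal_def by blast
  obtain y0 where y0: "y0 \<in> dcoset J I y" "coset_maximal J I y0" "\<forall>z\<in>dcoset J I y. len z \<le> len y0"
    using ex_longest[OF J I yc] by blast
  then have "y0 = y" using coset_maximal_unique[OF J IS y] by blast
  then show "y \<in> dcoset J I y \<and> (\<forall>z\<in>dcoset J I y. bruhat_le W S y z \<longrightarrow> z = y)"
    using y0 dcoset_self[OF yc] bruhat_le_len by (metis leD)
  fix x assume x: "x \<in> dcoset J I y \<and> (\<forall>z\<in>dcoset J I y. bruhat_le W S x z \<longrightarrow> z = x)"
  have xc: "x \<in> carrier W" using dcoset_closed[OF JS IS yc] x by blast
  have e: "dcoset J I x = dcoset J I y" using dcoset_eq[OF JS IS yc] x by blast
  have no: "\<not> bruhat_step W S x z" if "z \<in> dcoset J I x" for z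
  proof
    assume b: "bruhat_step W S x z"
    then have "bruhat_le W S x z" unfolding bruhat_le_def by blast
    then have "z = x" using x that e by blast
    then show False using b unfolding bruhat_step_def by simp
  qed
  have "len (r \<otimes> x) < len x" if "r \<in> J" for r
    using no[OF dcoset_gen(1)[OF JS IS xc that]] bruhat_step_gen(1)[of r x] that JS xc
      len_gen_left_cases[of r x] by fastforce
  moreover have "len (x \<otimes> r) < len x" if "r \<in> I" for r
    using no[OF dcoset_gen(2)[OF JS IS xc that]] bruhat_step_gen(2)[of r x] that IS xc
      len_gen_right_cases[of r x] by fastforce
  ultimately have "coset_maximal J I x" using xc by (simp add: coset_maximal_def)
  then show "x = y" using coset_maximal_unique[OF J IS y] x by blast
qed

lemma coset_min_eq:
  assumes JS: "J \<subseteq> S" and IS: "I \<subseteq> S" and y: "coset_minimal J I y"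
  shows "coset_min W S (dcoset J I y) = y"
  unfolding coset_min_def
proof (rule the_equality)
  have yc: "y \<in> carrier W" using y coset_minimal_def by blast
  show "y \<in> dcoset J I y \<and> (\<forall>z\<in>dcoset J I y. bruhat_le W S z y \<longrightarrow> z = y)"
    using coset_minimal_shortest[OF JS IS y] dcoset_self[OF yc] bruhat_le_len by (metis leD)
  fix x assume x: "x \<in> dcoset J I y \<and> (\<forall>z\<in>dcoset J I y. bruhat_le W S z x \<longrightarrow> z = x)"
  have xc: "x \<in> carrier W" using dcoset_closed[OF JS IS yc] x by blast
  have e: "dcoset J I x = dcoset J I y" using dcoset_eq[OF JS IS yc] x by blast
  have no: "\<not> bruhat_step W S z x" if "z \<in> dcoset J I x" for z
  proof
    assume b: "bruhat_step W S z x"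
    then have "bruhat_le W S z x" unfolding bruhat_le_def by blast
    then have "z = x" using x that e by blast
    then show False using b unfolding bruhat_step_def by simp
  qed
  have "len x < len (r \<otimes> x)" if "r \<in> J" for r
    using no[OF dcoset_gen(1)[OF JS IS xc that]] bruhat_step_gen(3)[of r x] that JS xc
      len_gen_left_cases[of r x] by fastforce
  moreover have "len x < len (x \<otimes> r)" if "r \<in> I" for r
    using no[OF dcoset_gen(2)[OF JS IS xc that]] bruhat_step_gen(4)[of r x] that IS xc
      len_gen_right_cases[of r x] by fastforce
  ultimately have "coset_minimal J I x" using xc by (simp add: coset_minimal_def)
  then show "x = y"
    using coset_minimal_unique[OF JS IS y] coset_minimal_shortest[OF JS IS, of x y] x e dcoset_self[OF yc]
    by blast
qed

section \<open>Forward paths\<close>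

text \<open>The key fact on steps up.  Let \<open>v = m b m\<^sup>-\<^sup>1\<close>.  Maximality of \<open>y\<close> on the left makes \<open>vy\<close> shorter than \<open>y\<close>
  by the length of \<open>v\<close>, while minimality of \<open>m\<close> on the right makes lengths additive in
  \<open>vy = m \<cdot> b w\<^sub>I\<close> and in \<open>vm = m \<cdot> b\<close>.  Together they show that \<open>b w\<^sub>I\<close> is shorter than \<open>w\<^sub>I\<close> by the
  length of \<open>b\<close>.  So \<open>b\<^sup>-\<^sup>1\<close> is an initial factor of \<open>w\<^sub>I\<close>.\<close>

lemma up_step_stabilizer:
  assumes J: "J \<subseteq> S" and I: "fin I" and I': "I' \<subseteq> S" "I \<subseteq> I'"
    and y: "coset_maximal J I y" and m: "m = y \<otimes> wl I" "coset_minimal {} I' m"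
    and b: "b \<in> par I'" "m \<otimes> b \<otimes> inv m \<in> par J"
  shows "b \<in> par I"
proof -
  note IS = fin_subset[OF I]
  have c: "y \<in> carrier W" "m \<in> carrier W" "b \<in> carrier W" "wl I \<in> carrier W"
    using y m b I par_closed[OF I'(1)] by (auto simp: coset_maximal_def)
  let ?v = "m \<otimes> b \<otimes> inv m"
  have w': "wl I \<in> par I'" using par_mono[OF I'(2) longest_par[OF I]] .
  have ym: "y = m \<otimes> wl I" using m c I by (simp add: m_assoc)
  have "len (?v \<otimes> y) + len ?v = len y" using left_maximal_len[OF J y b(2)] .
  moreover have "?v \<otimes> y = m \<otimes> (b \<otimes> wl I)" unfolding ym using c by (simp add: m_assoc)
  moreover have "len (m \<otimes> (b \<otimes> wl I)) = len m + len (b \<otimes> wl I)"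
    using right_minimal_len[OF I'(1) m(2)] par_mult[OF I'(1) b(1) w'] by blast
  moreover have "len y = len m + len (wl I)"
    unfolding ym using right_minimal_len[OF I'(1) m(2) w'] .
  moreover have "len b \<le> len ?v"
  proof -
    have "m \<otimes> b = ?v \<otimes> m" using c by (simp add: m_assoc)
    then have "len m + len b \<le> len ?v + len m"
      using right_minimal_len[OF I'(1) m(2) b(1)] len_mult[of ?v m] c by simp
    then show ?thesis by simp
  qed
  moreover have "len (wl I) \<le> len (inv b) + len (b \<otimes> wl I)"
    using len_mult[of "inv b" "b \<otimes> wl I"] c by simp
  ultimately have "len (inv b \<otimes> (b \<otimes> wl I)) = len (inv b) + len (b \<otimes> wl I)" using c by simp
  then have "inv b \<in> par I"
    using par_prefix[OF IS, of "inv b" "b \<otimes> wl I"] c longest_par[OF I] by simp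
  then show ?thesis using par_inv[OF IS] c by fastforce
qed

text \<open>The left redundancy of a coset in terms of its minimal element \<open>x\<close>, without reference to an
  expression.\<close>

definition redundancy :: "'a set \<Rightarrow> 'a set \<Rightarrow> 'a \<Rightarrow> 'a set" where
  "redundancy J I x = J \<inter> (\<lambda>s. x \<otimes> s \<otimes> inv x) ` I"

text \<open>Write \<open>m = y w\<^sub>I\<close> as an additive product \<open>ax\<close> with \<open>a\<close> in \<open>W\<^sub>J\<close>, and suppose that \<open>mr\<close> is shorter than \<open>m\<close> for
  some \<open>r\<close> in \<open>I'\<close>.  Then \<open>xr\<close> has a left descent \<open>d\<close> in \<open>J\<close>, and minimality of \<open>x\<close> forces \<open>dxr = x\<close>.
  So \<open>d = x r x\<^sup>-\<^sup>1\<close> is in the redundancy for \<open>I'\<close>, and the inclusion of redundancies puts \<open>r\<close> into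
  \<open>I\<close>, where \<open>m\<close> has no descents.\<close>

lemma up_step_necessary:
  assumes J: "fin J" and I: "fin I" and I': "I' \<subseteq> S" "I \<subseteq> I'"
    and y: "coset_maximal J I y"
    and x: "x \<in> dcoset J I y" "coset_minimal J I' x"
    and red: "redundancy J I' x \<subseteq> redundancy J I x"
  shows "coset_minimal {} I' (y \<otimes> wl I)"
proof -
  note IS = fin_subset[OF I] and JS = fin_subset[OF J]
  let ?m = "y \<otimes> wl I"
  have c: "y \<in> carrier W" "x \<in> carrier W" "?m \<in> carrier W"
    using y x I by (auto simp: coset_maximal_def coset_minimal_def)
  have xI: "coset_minimal J I x" using x(2) I'(2) unfolding coset_minimal_def by blast
  have m: "coset_minimal {} I ?m" using maximal_times_longest[OF JS I y] .
  have "?m = \<one> \<otimes> y \<otimes> wl I" using c by simp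
  then have "?m \<in> dcoset J I y" using par_one longest_par[OF I] unfolding mem_dcoset by blast
  then have "?m \<in> dcoset J I x" using dcoset_eq[OF JS IS c(1) x(1)] by simp
  then obtain a where a: "a \<in> par J" "?m = a \<otimes> x" "len ?m = len a + len x"
    using right_minimal_dec[OF JS IS xI _ m] by blast
  have ac: "a \<in> carrier W" using par_closed[OF JS a(1)] .
  have "len ?m < len (?m \<otimes> r)" if r: "r \<in> I'" for r
  proof (rule ccontr)
    assume "\<not> len ?m < len (?m \<otimes> r)"
    then have lt: "len (?m \<otimes> r) < len ?m" using len_gen_right_cases[of r ?m] r I'(1) c by fastforce
    have rc: "r \<in> S" "r \<in> carrier W" using r I' by auto
    have xr: "len (x \<otimes> r) = Suc (len x)"
      using x(2) r len_gen_right_cases[OF rc(1) c(2)] unfolding coset_minimal_def by fastforce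
    \<comment> \<open>otherwise \<open>a \<otimes> (x \<otimes> r)\<close> would be additive and longer than \<open>a \<otimes> x\<close>\<close>
    have "\<exists>d\<in>J. len (d \<otimes> (x \<otimes> r)) < len (x \<otimes> r)"
    proof (rule ccontr)
      assume "\<not> ?thesis"
      then have "len (x \<otimes> r) < len (d \<otimes> (x \<otimes> r))" if "d \<in> J" for d
        using len_gen_left_cases[of d "x \<otimes> r"] that JS c rc by fastforce
      then have "coset_minimal J {} (x \<otimes> r)" using c rc by (simp add: coset_minimal_def)
      from left_minimal_len[OF JS this a(1)] have "len (?m \<otimes> r) = len a + len (x \<otimes> r)"
        using a ac c rc by (simp add: m_assoc)
      then show False using lt xr a by simp
    qed
    then obtain d where d: "d \<in> J" "len (d \<otimes> (x \<otimes> r)) < len (x \<otimes> r)" by blast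
    have dc: "d \<in> S" "d \<in> carrier W" using d JS by auto
    have "d \<otimes> (x \<otimes> r) = d \<otimes> x \<otimes> r" using dc c rc by (simp add: m_assoc)
    then have "d \<otimes> (x \<otimes> r) \<in> dcoset J I' x"
      using par_gen[OF d(1)] par_gen[OF r] unfolding mem_dcoset by blast
    then have "d \<otimes> (x \<otimes> r) = x" using coset_minimal_unique[OF JS I'(1) x(2)] d xr by simp
    then have e: "d \<otimes> x \<otimes> r = x" using c dc rc by (simp add: m_assoc)
    have "x \<otimes> r \<otimes> inv x = d"
    proof -
      have "x \<otimes> r = d \<otimes> (d \<otimes> (x \<otimes> r))" using dc c rc by simp
      also have "\<dots> = d \<otimes> x" using \<open>d \<otimes> (x \<otimes> r) = x\<close> by simp
      finally show ?thesis using c dc by (simp add: m_assoc)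
    qed
    then have "d \<in> redundancy J I' x" using d r unfolding redundancy_def by blast
    then have "d \<in> redundancy J I x" using red by blast
    then obtain r' where r': "r' \<in> I" "d = x \<otimes> r' \<otimes> inv x" unfolding redundancy_def by blast
    have r'c: "r' \<in> carrier W" using r' IS by auto
    have "r' = inv x \<otimes> d \<otimes> x" unfolding r'(2) using r'c c by (simp add: m_assoc)
    also have "\<dots> = r" unfolding \<open>x \<otimes> r \<otimes> inv x = d\<close>[symmetric] using rc c by (simp add: m_assoc)
    finally have "r \<in> I" using r' by simp
    then show False using m lt unfolding coset_minimal_def by force
  qed
  then show ?thesis using c by (simp add: coset_minimal_def)
qed

text \<open>As a right factor of \<open>m\<close>, the element \<open>x\<close> inherits minimality with respect to \<open>I'\<close>.  The
  redundancies agree by \<open>up_step_stabilizer\<close>.\<close>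

lemma up_step_sufficient:
  assumes J: "fin J" and I: "fin I" and I': "I' \<subseteq> S" "I \<subseteq> I'"
    and y: "coset_maximal J I y"
    and x: "x \<in> dcoset J I y" "coset_minimal J I x"
    and m: "coset_minimal {} I' (y \<otimes> wl I)"
  shows "coset_minimal J I' x \<and> redundancy J I' x = redundancy J I x"
proof -
  note IS = fin_subset[OF I] and JS = fin_subset[OF J]
  let ?m = "y \<otimes> wl I"
  have c: "y \<in> carrier W" "x \<in> carrier W" "?m \<in> carrier W"
    using y x I by (auto simp: coset_maximal_def coset_minimal_def)
  have mI: "coset_minimal {} I ?m" using maximal_times_longest[OF JS I y] .
  have "?m = \<one> \<otimes> y \<otimes> wl I" using c by simp
  then have "?m \<in> dcoset J I y" using par_one longest_par[OF I] unfolding mem_dcoset by blast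
  then have "?m \<in> dcoset J I x" using dcoset_eq[OF JS IS c(1) x(1)] by simp
  then obtain a where a: "a \<in> par J" "?m = a \<otimes> x" "len ?m = len a + len x"
    using right_minimal_dec[OF JS IS x(2) _ mI] by blast
  have ac: "a \<in> carrier W" using par_closed[OF JS a(1)] .
  have "len x < len (x \<otimes> r)" if r: "r \<in> I'" for r
  proof -
    have rc: "r \<in> carrier W" using r I' by auto
    have "len ?m < len (?m \<otimes> r)" using m r unfolding coset_minimal_def by blast
    also have "\<dots> = len (a \<otimes> (x \<otimes> r))" unfolding a(2) using ac c rc by (simp add: m_assoc)
    also have "\<dots> \<le> len a + len (x \<otimes> r)" using len_mult[of a "x \<otimes> r"] ac c rc by simp
    finally show ?thesis using a(3) by simp
  qed
  then have "coset_minimal J I' x" using x(2) unfolding coset_minimal_def by blast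
  moreover have "redundancy J I' x \<subseteq> redundancy J I x"
  proof
    fix d assume "d \<in> redundancy J I' x"
    then obtain b where b: "d \<in> J" "b \<in> I'" "d = x \<otimes> b \<otimes> inv x" unfolding redundancy_def by blast
    have bc: "b \<in> S" "b \<in> carrier W" using b I' by auto
    have "?m \<otimes> b \<otimes> inv ?m = a \<otimes> d \<otimes> inv a"
      unfolding a(2) b(3) using ac c bc by (simp add: m_assoc inv_mult_group)
    also have "\<dots> \<in> par J" using a(1) par_gen[OF b(1)] par_mult[OF JS] par_inv[OF JS] by blast
    finally have "b \<in> par I"
      using up_step_stabilizer[OF JS I I' y HOL.refl m par_gen[OF b(2)]] by blast
    then have "b \<in> I" using par_gen_mem[OF IS bc(1)] by blast
    then show "d \<in> redundancy J I x" using b unfolding redundancy_def by blast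
  qed
  ultimately show ?thesis using I'(2) unfolding redundancy_def by blast
qed

lemma dcoset_the:
  assumes "J \<subseteq> S" "I \<subseteq> S" "z \<in> carrier W"
  shows "(THE q. q \<in> double_cosets W J I \<and> z \<in> q) = dcoset J I z"
proof (rule the_equality)
  show "dcoset J I z \<in> double_cosets W J I \<and> z \<in> dcoset J I z"
    using assms dcoset_self unfolding double_cosets_def by blast
  fix q assume "q \<in> double_cosets W J I \<and> z \<in> q"
  then obtain x where "x \<in> carrier W" "q = dcoset J I x" "z \<in> q"
    unfolding double_cosets_def by blast
  then show "q = dcoset J I z" using dcoset_eq[OF assms(1,2)] by simp
qed

lemma dcoset_the_subset:
  assumes J: "J \<subseteq> S" and I: "I' \<subseteq> S" "I \<subseteq> I'" and y: "y \<in> carrier W"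
  shows "(THE q. q \<in> double_cosets W J I' \<and> dcoset J I y \<subseteq> q) = dcoset J I' y"
proof (rule the_equality)
  have "dcoset J I y \<subseteq> dcoset J I' y"
    using par_mono[OF I(2)] unfolding mem_dcoset subset_iff by blast
  then show "dcoset J I' y \<in> double_cosets W J I' \<and> dcoset J I y \<subseteq> dcoset J I' y"
    using y unfolding double_cosets_def by blast
  fix q assume "q \<in> double_cosets W J I' \<and> dcoset J I y \<subseteq> q"
  then obtain x where "x \<in> carrier W" "q = dcoset J I' x" "y \<in> q"
    using dcoset_self[OF y] unfolding double_cosets_def by blast
  then show "q = dcoset J I' y" using dcoset_eq[OF J I(1)] by simp
qed

definition path_max :: "'a set list \<Rightarrow> nat \<Rightarrow> 'a" where
  "path_max E i = coset_max W S (forward_path W S E i)"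

lemma expression_fin: "expression W S E \<Longrightarrow> i < length E \<Longrightarrow> fin (E ! i)"
  by (simp add: expression_def)

lemma expression_fin_hd: "expression W S E \<Longrightarrow> fin (E ! 0)"
  by (simp add: expression_def)

lemma expression_down:
  "expression W S E \<Longrightarrow> Suc i < length E \<Longrightarrow> \<not> E ! i \<subseteq> E ! Suc i \<Longrightarrow> E ! Suc i \<subseteq> E ! i"
  unfolding expression_def by blast

lemma expression_step:
  assumes "expression W S E" "Suc i < length E"
  obtains (up) r where "r \<in> S" "r \<notin> E ! i" "E ! Suc i = insert r (E ! i)" "E ! i \<subseteq> E ! Suc i"
  | (down) r where "r \<in> S" "r \<in> E ! i" "E ! Suc i = E ! i - {r}" "\<not> E ! i \<subseteq> E ! Suc i"
proof -
  obtain r where r: "r \<in> S" "r \<notin> E ! i \<and> E ! Suc i = insert r (E ! i) \<or>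
      r \<in> E ! i \<and> E ! Suc i = E ! i - {r}"
    using assms unfolding expression_def by meson
  from r(2) show ?thesis
  proof
    assume "r \<notin> E ! i \<and> E ! Suc i = insert r (E ! i)"
    then show ?thesis using up[OF r(1)] by auto
  next
    assume "r \<in> E ! i \<and> E ! Suc i = E ! i - {r}"
    then show ?thesis using down[OF r(1)] by auto
  qed
qed

lemma path_max_props:
  assumes E: "expression W S E" and i: "i < length E"
  shows "forward_path W S E i = dcoset (E ! 0) (E ! i) (path_max E i)
    \<and> coset_maximal (E ! 0) (E ! i) (path_max E i)"
proof -
  have J: "fin (E ! 0)" using expression_fin_hd[OF E] .
  note JS = fin_subset[OF J]
  have "\<exists>y. coset_maximal (E ! 0) (E ! i) y \<and> forward_path W S E i = dcoset (E ! 0) (E ! i) y"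
    using i
  proof (induction i)
    case 0
    obtain y where y: "y \<in> dcoset (E ! 0) (E ! 0) \<one>" "coset_maximal (E ! 0) (E ! 0) y"
      using ex_longest[OF J J one_closed] by blast
    then show ?case
      using dcoset_the[OF JS JS one_closed] dcoset_eq[OF JS JS one_closed y(1)] by auto
  next
    case (Suc i)
    then obtain y where y: "coset_maximal (E ! 0) (E ! i) y"
        "forward_path W S E i = dcoset (E ! 0) (E ! i) y" by auto
    have yc: "y \<in> carrier W" using y(1) coset_maximal_def by blast
    have I: "fin (E ! i)" "fin (E ! Suc i)" using expression_fin[OF E] Suc.prems by auto
    note IS = fin_subset[OF I(1)] fin_subset[OF I(2)]
    show ?case
    proof (cases "E ! i \<subseteq> E ! Suc i")
      case True
      then have "forward_path W S E (Suc i) = dcoset (E ! 0) (E ! Suc i) y"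
        using dcoset_the_subset[OF JS IS(2) True yc] y by simp
      then show ?thesis using ex_longest[OF J I(2) yc] dcoset_eq[OF JS IS(2) yc] by metis
    next
      case False
      then have "forward_path W S E (Suc i) = dcoset (E ! 0) (E ! Suc i) y"
        using dcoset_the[OF JS IS(2) yc] y coset_max_eq[OF J I(1) y(1)] by simp
      moreover have "coset_maximal (E ! 0) (E ! Suc i) y"
        using y(1) expression_down[OF E Suc.prems False] unfolding coset_maximal_def by blast
      ultimately show ?thesis by blast
    qed
  qed
  then show ?thesis
    unfolding path_max_def using coset_max_eq[OF J expression_fin[OF E i]] by metis
qed

lemma path_max_maximal:
  "expression W S E \<Longrightarrow> i < length E \<Longrightarrow> coset_maximal (E ! 0) (E ! i) (path_max E i)"
  using path_max_props by blast

lemma path_max_closed: "expression W S E \<Longrightarrow> i < length E \<Longrightarrow> path_max E i \<in> carrier W"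
  using path_max_maximal coset_maximal_def by blast

lemma path_coset:
  "expression W S E \<Longrightarrow> i < length E \<Longrightarrow> forward_path W S E i = dcoset (E ! 0) (E ! i) (path_max E i)"
  using path_max_props by blast

lemma path_max_0:
  assumes E: "expression W S E"
  shows "path_max E 0 = wl (E ! 0)"
proof -
  have J: "fin (E ! 0)" using expression_fin_hd[OF E] .
  note JS = fin_subset[OF J]
  have "wl (E ! 0) = wl (E ! 0) \<otimes> \<one> \<otimes> \<one>" using J by simp
  then have "wl (E ! 0) \<in> dcoset (E ! 0) (E ! 0) \<one>"
    using longest_par[OF J] par_one unfolding mem_dcoset by blast
  then show ?thesis unfolding path_max_def
    using dcoset_the[OF JS JS one_closed] dcoset_eq[OF JS JS one_closed]
      coset_max_eq[OF J J longest_maximal[OF J]] by simp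
qed

lemma path_max_down:
  assumes E: "expression W S E" and i: "Suc i < length E" and d: "\<not> E ! i \<subseteq> E ! Suc i"
  shows "path_max E (Suc i) = path_max E i"
proof -
  have J: "fin (E ! 0)" and I: "fin (E ! Suc i)" using expression_fin[OF E] expression_fin_hd[OF E] i by auto
  have "coset_maximal (E ! 0) (E ! Suc i) (path_max E i)"
    using path_max_maximal[OF E, of i] i expression_down[OF E i d] unfolding coset_maximal_def by auto
  moreover have "forward_path W S E (Suc i) = dcoset (E ! 0) (E ! Suc i) (path_max E i)"
    using d dcoset_the[OF fin_subset[OF J] fin_subset[OF I]] path_max_closed[OF E, of i] i
    by (simp flip: path_max_def)
  ultimately show ?thesis using coset_max_eq[OF J I] unfolding path_max_def by simp
qed

lemma path_coset_up:
  assumes E: "expression W S E" and i: "Suc i < length E" and u: "E ! i \<subseteq> E ! Suc i"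
  shows "forward_path W S E (Suc i) = dcoset (E ! 0) (E ! Suc i) (path_max E i)"
proof -
  have J: "fin (E ! 0)" and I: "fin (E ! Suc i)" using expression_fin[OF E] expression_fin_hd[OF E] i by auto
  have i': "i < length E" using i by simp
  show ?thesis
    using u path_coset[OF E i'] dcoset_the_subset[OF fin_subset[OF J] fin_subset[OF I] u path_max_closed[OF E i']]
    by simp
qed

text \<open>Reducedness of a step up, in a form that no longer mentions minimal elements of
  double cosets or redundancies (see \<open>reduced_up_iff\<close>).\<close>

definition reduced_up :: "'a set list \<Rightarrow> nat \<Rightarrow> bool" where
  "reduced_up E i \<longleftrightarrow> coset_minimal {} (E ! Suc i) (path_max E i \<otimes> wl (E ! i))"

text \<open>Write \<open>m w'\<close> for the right-hand side, where \<open>m\<close> is minimal on the right.  It has the right descents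
  of the longest element \<open>w'\<close>, and it inherits the left descents of its additive left factor
  \<open>path_max E i\<close>.\<close>

lemma path_max_up:
  assumes E: "expression W S E" and i: "Suc i < length E" and u: "E ! i \<subseteq> E ! Suc i"
    and r: "reduced_up E i"
  shows "path_max E (Suc i) = path_max E i \<otimes> wl (E ! i) \<otimes> wl (E ! Suc i)"
proof -
  have i': "i < length E" and J: "fin (E ! 0)" and I: "fin (E ! i)" and I': "fin (E ! Suc i)"
    using expression_fin[OF E] expression_fin_hd[OF E] i by auto
  note JS = fin_subset[OF J] and IS = fin_subset[OF I] and IS' = fin_subset[OF I']
  let ?y = "path_max E i" and ?m = "path_max E i \<otimes> wl (E ! i)"
  let ?z = "?m \<otimes> wl (E ! Suc i)"
  have y: "coset_maximal (E ! 0) (E ! i) ?y" using path_max_maximal[OF E i'] .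
  have yc: "?y \<in> carrier W" and mc: "?m \<in> carrier W" and zc: "?z \<in> carrier W"
    using path_max_closed[OF E i'] I I' by auto
  have m: "coset_minimal {} (E ! Suc i) ?m" using r unfolding reduced_up_def .
  have lz: "len ?z = len ?m + len (wl (E ! Suc i))"
    using right_minimal_len[OF IS' m longest_par[OF I']] .
  have wI: "wl (E ! i) \<in> par (E ! Suc i)" using par_mono[OF u longest_par[OF I]] .
  have w: "wl (E ! i) \<otimes> wl (E ! Suc i) \<in> par (E ! Suc i)"
    using par_mult[OF IS' wI longest_par[OF I']] .
  have "len (?z \<otimes> r) < len ?z" if r: "r \<in> E ! Suc i" for r
  proof -
    have rc: "r \<in> carrier W" using r IS' by auto
    have "wl (E ! Suc i) \<otimes> r \<in> par (E ! Suc i)"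
      using par_mult[OF IS' longest_par[OF I'] par_gen[OF r]] .
    then have "len (?m \<otimes> (wl (E ! Suc i) \<otimes> r)) = len ?m + len (wl (E ! Suc i) \<otimes> r)"
      using right_minimal_len[OF IS' m] by blast
    moreover have "len (wl (E ! Suc i) \<otimes> r) < len (wl (E ! Suc i))"
      using longest_maximal[OF I'] r unfolding coset_maximal_def by blast
    ultimately show ?thesis using lz mc rc I' by (simp add: m_assoc)
  qed
  moreover have "len (r \<otimes> ?z) < len ?z" if r: "r \<in> E ! 0" for r
  proof -
    have rc: "r \<in> carrier W" using r JS by auto
    let ?c = "wl (E ! i) \<otimes> wl (E ! Suc i)"
    have "len (r \<otimes> ?z) \<le> len (r \<otimes> ?y) + len ?c"
      using len_mult[of "r \<otimes> ?y" ?c] rc yc I I' by (simp add: m_assoc)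
    moreover have "len (r \<otimes> ?y) < len ?y" using y r unfolding coset_maximal_def by blast
    moreover have "len ?y + len (wl (E ! i) \<otimes> wl (E ! Suc i)) = len ?z"
    proof -
      have "len ?m + len (wl (E ! i)) = len ?y"
        using right_maximal_len[OF JS IS y longest_par[OF I]] .
      moreover have "len (wl (E ! i) \<otimes> wl (E ! Suc i)) + len (wl (E ! i)) = len (wl (E ! Suc i))"
        using longest_len_left[OF I' wI] .
      ultimately show ?thesis using lz by simp
    qed
    ultimately show ?thesis by simp
  qed
  ultimately have zm: "coset_maximal (E ! 0) (E ! Suc i) ?z" using zc by (simp add: coset_maximal_def)
  have "?z = \<one> \<otimes> ?y \<otimes> (wl (E ! i) \<otimes> wl (E ! Suc i))" using yc I I' by (simp add: m_assoc)
  then have "?z \<in> dcoset (E ! 0) (E ! Suc i) ?y" using w par_one unfolding mem_dcoset by blast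
  then have "forward_path W S E (Suc i) = dcoset (E ! 0) (E ! Suc i) ?z"
    using path_coset_up[OF E i u] dcoset_eq[OF JS IS' yc] by simp
  then show ?thesis using coset_max_eq[OF J I' zm] unfolding path_max_def by simp
qed

lemma path_max_up_len:
  assumes E: "expression W S E" and i: "Suc i < length E" and u: "E ! i \<subseteq> E ! Suc i"
    and r: "reduced_up E i"
  shows "len (path_max E (Suc i)) = len (path_max E i) + len (wl (E ! i) \<otimes> wl (E ! Suc i))"
proof -
  have i': "i < length E" and J: "fin (E ! 0)" and I: "fin (E ! i)" and I': "fin (E ! Suc i)"
    using expression_fin[OF E] expression_fin_hd[OF E] i by auto
  have m: "coset_minimal {} (E ! Suc i) (path_max E i \<otimes> wl (E ! i))"
    using r unfolding reduced_up_def .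
  have "len (path_max E i \<otimes> wl (E ! i)) + len (wl (E ! i)) = len (path_max E i)"
    using right_maximal_len[OF fin_subset[OF J] fin_subset[OF I] path_max_maximal[OF E i'] longest_par[OF I]] .
  moreover have "len (wl (E ! i) \<otimes> wl (E ! Suc i)) + len (wl (E ! i)) = len (wl (E ! Suc i))"
    using longest_len_left[OF I' par_mono[OF u longest_par[OF I]]] .
  ultimately show ?thesis
    using path_max_up[OF assms] right_minimal_len[OF fin_subset[OF I'] m longest_par[OF I']] by simp
qed

lemma reduced_up_iff:
  assumes E: "expression W S E" and i: "Suc i < length E" and u: "E ! i \<subseteq> E ! Suc i"
  shows "coset_min W S (forward_path W S E i) = coset_min W S (forward_path W S E (Suc i)) \<and>
        left_redundancy W S E i = left_redundancy W S E (Suc i) \<longleftrightarrow> reduced_up E i"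
proof -
  have i': "i < length E" and J: "fin (E ! 0)" and I: "fin (E ! i)" and I': "fin (E ! Suc i)"
    using expression_fin[OF E] expression_fin_hd[OF E] i by auto
  note JS = fin_subset[OF J] and IS = fin_subset[OF I] and IS' = fin_subset[OF I']
  let ?y = "path_max E i"
  have y: "coset_maximal (E ! 0) (E ! i) ?y" using path_max_maximal[OF E i'] .
  have yc: "?y \<in> carrier W" using path_max_closed[OF E i'] .
  note c = path_coset[OF E i'] path_coset_up[OF E i u]
  obtain x where x: "x \<in> dcoset (E ! 0) (E ! i) ?y" "coset_minimal (E ! 0) (E ! i) x"
    using ex_shortest[OF JS IS yc] by blast
  obtain x' where x': "x' \<in> dcoset (E ! 0) (E ! Suc i) ?y" "coset_minimal (E ! 0) (E ! Suc i) x'"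
    using ex_shortest[OF JS IS' yc] by blast
  have mx: "coset_min W S (forward_path W S E i) = x"
    unfolding c using coset_min_eq[OF JS IS x(2)] dcoset_eq[OF JS IS yc x(1)] by simp
  have mx': "coset_min W S (forward_path W S E (Suc i)) = x'"
    unfolding c using coset_min_eq[OF JS IS' x'(2)] dcoset_eq[OF JS IS' yc x'(1)] by simp
  have lr: "left_redundancy W S E i = redundancy (E ! 0) (E ! i) x"
    "left_redundancy W S E (Suc i) = redundancy (E ! 0) (E ! Suc i) x'"
    unfolding left_redundancy_def mx mx' redundancy_def by simp_all
  have sub: "x \<in> dcoset (E ! 0) (E ! Suc i) ?y"
    using x(1) par_mono[OF u] unfolding mem_dcoset by blast
  show ?thesis unfolding mx mx' lr
  proof
    assume a: "x = x' \<and> redundancy (E ! 0) (E ! i) x = redundancy (E ! 0) (E ! Suc i) x'"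
    then have "coset_minimal (E ! 0) (E ! Suc i) x"
      "redundancy (E ! 0) (E ! Suc i) x \<subseteq> redundancy (E ! 0) (E ! i) x"
      using x'(2) by auto
    then show "reduced_up E i" unfolding reduced_up_def
      using up_step_necessary[OF J I IS' u y x(1)] by blast
  next
    assume "reduced_up E i"
    then have *: "coset_minimal (E ! 0) (E ! Suc i) x \<and>
        redundancy (E ! 0) (E ! Suc i) x = redundancy (E ! 0) (E ! i) x"
      using up_step_sufficient[OF J I IS' u y x] unfolding reduced_up_def by blast
    have "coset_min W S (dcoset (E ! 0) (E ! Suc i) x) = x" using coset_min_eq[OF JS IS'] * by blast
    then have "x = x'" using mx' c(2) dcoset_eq[OF JS IS' yc sub] by simp
    then show "x = x' \<and> redundancy (E ! 0) (E ! i) x = redundancy (E ! 0) (E ! Suc i) x'"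
      using * by simp
  qed
qed

lemma reduced_iff:
  "reduced W S E \<longleftrightarrow> expression W S E \<and>
     (\<forall>i. Suc i < length E \<and> E ! i \<subseteq> E ! Suc i \<longrightarrow> reduced_up E i)"
  unfolding reduced_def using reduced_up_iff by blast

text \<open>The groups \<open>W\<^sub>J \<inter> y\<^sub>i W\<^bsub>I\<^sub>i\<^esub> y\<^sub>i\<^sup>-\<^sup>1\<close> shrink along a reduced expression: a step down keeps \<open>y\<^sub>i\<close> and
  shrinks \<open>I\<^sub>i\<close>, and a step up does not change the group by \<open>up_step_stabilizer\<close>.\<close>

lemma stabilizer_decreasing:
  assumes E: "reduced W S E" and n: "n < length E" and jn: "j \<le> n" and g: "g \<in> par (E ! 0)"
    and st: "inv (path_max E n) \<otimes> g \<otimes> path_max E n \<in> par (E ! n)"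
  shows "inv (path_max E j) \<otimes> g \<otimes> path_max E j \<in> par (E ! j)"
  using jn st n
proof (induction rule: inc_induct)
  case base
  then show ?case by blast
next
  case (step i)
  have ex: "expression W S E" using E reduced_iff by blast
  have i: "Suc i < length E" using step n by simp
  then have i': "i < length E" and J: "fin (E ! 0)" and I: "fin (E ! i)" and I': "fin (E ! Suc i)"
    using expression_fin[OF ex] expression_fin_hd[OF ex] by auto
  note JS = fin_subset[OF J] and IS = fin_subset[OF I] and IS' = fin_subset[OF I']
  have gc: "g \<in> carrier W" using par_closed[OF JS g] .
  let ?y = "path_max E i" and ?w = "wl (E ! i)" and ?w' = "wl (E ! Suc i)"
  have yc: "?y \<in> carrier W" using path_max_closed[OF ex i'] .
  have IH: "inv (path_max E (Suc i)) \<otimes> g \<otimes> path_max E (Suc i) \<in> par (E ! Suc i)"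
    using step by blast
  show ?case
  proof (cases "E ! i \<subseteq> E ! Suc i")
    case False
    then show ?thesis
      using IH path_max_down[OF ex i False] par_mono[OF expression_down[OF ex i False]] by simp
  next
    case True
    then have r: "reduced_up E i" using E i unfolding reduced_iff by blast
    let ?m = "?y \<otimes> ?w"
    define b where "b = inv ?m \<otimes> g \<otimes> ?m"
    have bc: "b \<in> carrier W" unfolding b_def using yc gc I by simp
    have Y: "path_max E (Suc i) = ?m \<otimes> ?w'" using path_max_up[OF ex i True r] .
    have "b = ?w' \<otimes> (inv (?m \<otimes> ?w') \<otimes> g \<otimes> (?m \<otimes> ?w')) \<otimes> ?w'"
      unfolding b_def using yc gc I I' by (simp add: inv_mult_group m_assoc)
    then have "b \<in> par (E ! Suc i)"
      using IH[unfolded Y] par_mult[OF IS'] longest_par[OF I'] by metis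
    moreover have "?m \<otimes> b \<otimes> inv ?m \<in> par (E ! 0)"
      unfolding b_def using yc gc I g by (simp add: m_assoc)
    ultimately have "b \<in> par (E ! i)"
      using up_step_stabilizer[OF JS I IS' True path_max_maximal[OF ex i'] HOL.refl] r
      unfolding reduced_up_def by blast
    moreover have "inv ?y \<otimes> g \<otimes> ?y = ?w \<otimes> b \<otimes> ?w"
      unfolding b_def using yc gc I by (simp add: inv_mult_group m_assoc)
    ultimately show ?thesis using par_mult[OF IS] longest_par[OF I] by metis
  qed
qed

end

lemma steps_append: "steps A (xs @ ys) = steps A xs @ tl (steps (last (steps A xs)) ys)"
proof -
  have ne: "steps A zs \<noteq> []" for A :: "'c set" and zs by (cases "(A, zs)" rule: steps.cases) auto
  have hd: "steps A zs = A # tl (steps A zs)" for A :: "'c set" and zs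
    by (cases "(A, zs)" rule: steps.cases) auto
  show ?thesis
    by (induction A xs rule: steps.induct) (use ne hd in auto)
qed

section \<open>The rotation sequence\<close>

locale switchback = coxeter_system W S for W :: "('a, 'b) monoid_scheme" (structure) and S +
  fixes s :: 'a and J :: "'a set" and t :: 'a
  assumes s_in_S: "s \<in> S" and J_subset: "J \<subseteq> S" and s_notin: "s \<notin> J"
    and fin_sJ: "finitary W S (insert s J)" and t_mem: "t \<in> insert s J"
begin

text \<open>\<open>topp\<close> and \<open>sopp\<close> are the types of the vertices opposite to vertices of types \<open>t\<close> and \<open>s\<close> in the
  Coxeter complex of \<open>W\<^sub>K\<close>.\<close>

abbreviation K :: "'a set" where "K \<equiv> insert s J"
abbreviation wK :: 'a where "wK \<equiv> longest W S K"
abbreviation topp :: 'a where "topp \<equiv> wK \<otimes> t \<otimes> wK"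
abbreviation sopp :: 'a where "sopp \<equiv> wK \<otimes> s \<otimes> wK"
abbreviation L :: "'a set" where "L \<equiv> K - {s, topp}"

lemma K_subset: "K \<subseteq> S" using fin_subset[OF fin_sJ] .
lemma K_carrier: "g \<in> K \<Longrightarrow> g \<in> carrier W" using K_subset by auto
lemma fin_sub: "A \<subseteq> K \<Longrightarrow> fin A" using fin_mono[OF fin_sJ] .
lemma fin_J: "fin J" by (rule fin_sub) auto
lemma topp_mem: "topp \<in> K" using longest_conj[OF fin_sJ t_mem] .
lemma sopp_mem: "sopp \<in> K" using longest_conj[OF fin_sJ, of s] by simp
lemma topp_opp: "wK \<otimes> topp \<otimes> wK = t"
  using longest_conj_conj[OF fin_sJ] t_mem K_carrier by blast

text \<open>The pair \<open>(u\<^bsub>n-1\<^esub>, u\<^sub>n)\<close> of the rotation sequence, starting with \<open>u\<^bsub>-1\<^esub> = topp\<close> and \<open>u\<^sub>0 = s\<close>.\<close>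

definition rpair :: "nat \<Rightarrow> 'a \<times> 'a" where
  "rpair n = (rot_next W S K ^^ n) (topp, s)"
definition rprev :: "nat \<Rightarrow> 'a" where "rprev n = fst (rpair n)"
definition rcur :: "nat \<Rightarrow> 'a" where "rcur n = snd (rpair n)"

text \<open>The sets \<open>I\<^sub>n\<close> and \<open>L\<^sub>n\<close> of the rotation sequence, named after the faces of the Coxeter complex
  that they belong to.\<close>

definition vert :: "nat \<Rightarrow> 'a set" where "vert n = K - {rcur n}"
definition edge :: "nat \<Rightarrow> 'a set" where "edge n = K - {rprev n, rcur n}"

lemma rot_0: "rprev 0 = topp" "rcur 0 = s"
  by (simp_all add: rprev_def rcur_def rpair_def)

lemma rot_Suc: "rprev (Suc n) = rcur n" "rcur (Suc n) = wl (vert n) \<otimes> rprev n \<otimes> wl (vert n)"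
  by (simp_all add: rprev_def rcur_def rpair_def rot_next_def vert_def case_prod_beta Let_def)

lemma rotation_nat: "rotation W S J s t (int n) = rcur n"
  by (simp add: rotation_def rcur_def rpair_def Let_def)

lemma vert_sub: "vert n \<subseteq> K" and edge_sub: "edge n \<subseteq> K"
  by (auto simp: vert_def edge_def)

lemma fin_vert: "fin (vert n)" and fin_edge: "fin (edge n)"
  using fin_sub vert_sub edge_sub by auto

lemma vert_0: "vert 0 = J"
  using s_notin by (auto simp: vert_def rot_0)

text \<open>The maximal elements of the cosets along the rotation.  Those for \<open>edge (Suc n)\<close> and for
  \<open>vert n\<close> coincide, because the step between them is a step down.\<close>

primrec vert_max :: "nat \<Rightarrow> 'a" where
  "vert_max 0 = wl J"
| "vert_max (Suc n) = vert_max n \<otimes> wl (edge (Suc n)) \<otimes> wl (vert (Suc n))"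

lemma vert_max_par: "vert_max n \<in> par K"
proof (induction n)
  case 0
  show ?case using par_mono[OF _ longest_par[OF fin_J], of K] by auto
next
  case (Suc n)
  then show ?case
    using par_mult[OF K_subset] par_mono[OF edge_sub longest_par[OF fin_edge]]
      par_mono[OF vert_sub longest_par[OF fin_vert]] by simp
qed

lemma vert_max_closed: "vert_max n \<in> carrier W"
  using vert_max_par par_closed[OF K_subset] by blast

definition path_set :: "nat \<Rightarrow> 'a set" where
  "path_set i = (if even i then vert (i div 2) else edge (Suc (i div 2)))"

definition rexp :: "nat \<Rightarrow> 'a set list" where
  "rexp k = map path_set [0..<Suc (2 * k)]"

text \<open>The step up from \<open>edge (Suc n)\<close> to \<open>vert (Suc n)\<close> is reduced.\<close>

definition advances :: "nat \<Rightarrow> bool" where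
  "advances n \<longleftrightarrow> coset_minimal {} (vert (Suc n)) (vert_max n \<otimes> wl (edge (Suc n)))"

lemma path_set_simps [simp]:
  "path_set (2 * n) = vert n" "path_set (Suc (2 * n)) = edge (Suc n)"
  by (simp_all add: path_set_def)

lemma path_set_sub: "path_set i \<subseteq> K"
  using vert_sub edge_sub by (simp add: path_set_def)

lemma rexp_length [simp]: "length (rexp k) = Suc (2 * k)"
  by (simp add: rexp_def)

lemma rexp_nth [simp]: "i < Suc (2 * k) \<Longrightarrow> rexp k ! i = path_set i"
  by (simp add: rexp_def del: upt_Suc)

lemma rotation_expr_rexp: "rotation_expr K (rotation W S J s t) k = rexp k"
proof (induction k)
  case 0
  show ?case by (simp add: rotation_expr_def rexp_def path_set_def vert_def flip: rotation_nat)
next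
  case (Suc k)
  let ?u = "rotation W S J s t"
  have "rotation_expr K ?u (Suc k) = rotation_expr K ?u k
      @ [K - {?u (int (Suc k)), ?u (int (Suc k) - 1)}, K - {?u (int (Suc k))}]"
    by (simp add: rotation_expr_def)
  also have "?u (int (Suc k)) = rcur (Suc k)" by (rule rotation_nat)
  also have "?u (int (Suc k) - 1) = rprev (Suc k)"
    using rotation_nat[of k] by (simp add: rot_Suc)
  also have "rotation_expr K ?u k @ [K - {rcur (Suc k), rprev (Suc k)}, K - {rcur (Suc k)}]
      = rexp k @ [path_set (Suc (2 * k)), path_set (2 * Suc k)]"
    using Suc.IH by (simp only: path_set_simps) (simp add: edge_def vert_def insert_commute)
  also have "\<dots> = rexp (Suc k)" by (simp add: rexp_def)
  finally show ?case .
qed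

end

text \<open>The case in which the end points of the walk are not antipodal.\<close>

locale proper_switchback = switchback +
  assumes s_neq: "s \<noteq> topp"
begin

lemma rot_mem: "rprev n \<in> K \<and> rcur n \<in> K \<and> rprev n \<noteq> rcur n"
proof (induction n)
  case 0
  show ?case using topp_mem s_neq by (simp add: rot_0)
next
  case (Suc n)
  then have "rprev n \<in> vert n" by (simp add: vert_def)
  then have "rcur (Suc n) \<in> vert n" using longest_conj[OF fin_vert] by (simp add: rot_Suc)
  then have "rcur (Suc n) \<in> K \<and> rcur n \<noteq> rcur (Suc n)" by (auto simp: vert_def)
  then show ?case unfolding rot_Suc(1) using Suc by simp
qed

lemma edge_of_vert: "edge (Suc n) = vert n - {rcur (Suc n)}" "rcur (Suc n) \<in> vert n"
  "rcur (Suc n) \<notin> edge (Suc n)"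
  using rot_mem[of "Suc n"] by (auto simp: edge_def vert_def rot_Suc(1))

lemma vert_of_edge: "vert (Suc n) = insert (rcur n) (edge (Suc n))" "rcur n \<notin> edge (Suc n)"
  using rot_mem[of "Suc n"] by (auto simp: edge_def vert_def rot_Suc(1))

lemma insert_vert: "insert (rcur n) (vert n) = K"
  using rot_mem[of n] by (auto simp: vert_def)

text \<open>In geometric terms, the edge \<open>n + 1\<close> of the walk has stabilizer \<open>W\<^sub>L\<close>.  Passing from \<open>n\<close> to \<open>n + 1\<close> conjugates by
  two more longest elements.  The one of \<open>edge (Suc n)\<close> permutes that set, and the one of \<open>vert (Suc n)\<close>
  maps the omitted element \<open>rcur n\<close> to \<open>rcur (Suc (Suc n))\<close>, by the recursion of the rotation
  sequence.\<close>

lemma vert_max_conj: "(\<lambda>g. inv (vert_max n) \<otimes> g \<otimes> vert_max n) ` L = edge (Suc n)"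
proof (induction n)
  case 0
  have "L = J - {topp}" using s_notin by auto
  moreover have "topp \<in> J" using topp_mem s_neq by auto
  ultimately have "(\<lambda>g. wl J \<otimes> g \<otimes> wl J) ` L = J - {wl J \<otimes> topp \<otimes> wl J}"
    using longest_conj_image_Diff[OF fin_J, of "{topp}"] by simp
  also have "\<dots> = edge (Suc 0)"
    using edge_of_vert(1)[of 0] by (simp add: vert_0 rot_Suc(2) rot_0)
  finally show ?case using fin_J by simp
next
  case (Suc n)
  let ?A = "edge (Suc n)" and ?V = "vert (Suc n)"
  have Lc: "g \<in> carrier W" if "g \<in> L" for g using that K_carrier by blast
  have "(\<lambda>g. inv (vert_max (Suc n)) \<otimes> g \<otimes> vert_max (Suc n)) ` L
      = (\<lambda>g. wl ?V \<otimes> g \<otimes> wl ?V) ` (\<lambda>g. wl ?A \<otimes> g \<otimes> wl ?A) ` (\<lambda>g. inv (vert_max n) \<otimes> g \<otimes> vert_max n) ` L"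
    unfolding image_image
  proof (rule image_cong[OF HOL.refl])
    fix g assume "g \<in> L"
    then have "g \<in> carrier W" by (rule Lc)
    moreover note vert_max_closed[of n] longest_closed[OF fin_edge[of "Suc n"]]
      longest_closed[OF fin_vert[of "Suc n"]]
      longest_inv[OF fin_edge[of "Suc n"]] longest_inv[OF fin_vert[of "Suc n"]]
    ultimately show "inv (vert_max (Suc n)) \<otimes> g \<otimes> vert_max (Suc n)
        = wl ?V \<otimes> (wl ?A \<otimes> (inv (vert_max n) \<otimes> g \<otimes> vert_max n) \<otimes> wl ?A) \<otimes> wl ?V"
      by (simp add: inv_mult_group m_assoc)
  qed
  also have "\<dots> = (\<lambda>g. wl ?V \<otimes> g \<otimes> wl ?V) ` ?A"
    unfolding Suc.IH using longest_conj_image_Diff[OF fin_edge, of "{}" "Suc n"] by simp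
  also have "\<dots> = (\<lambda>g. wl ?V \<otimes> g \<otimes> wl ?V) ` (?V - {rcur n})"
    using vert_of_edge[of n] by simp
  also have "\<dots> = ?V - {wl ?V \<otimes> rcur n \<otimes> wl ?V}"
    using longest_conj_image_Diff[OF fin_vert, of "{rcur n}" "Suc n"] vert_of_edge[of n] by simp
  also have "\<dots> = edge (Suc (Suc n))"
    using edge_of_vert(1)[of "Suc n"] by (simp add: rot_Suc)
  finally show ?case .
qed

lemma vert_max_conj_back:
  assumes "q \<in> edge (Suc n)"
  shows "vert_max n \<otimes> q \<otimes> inv (vert_max n) \<in> L"
proof -
  obtain g where g: "g \<in> L" "q = inv (vert_max n) \<otimes> g \<otimes> vert_max n" using assms vert_max_conj[of n] by blast
  then have "vert_max n \<otimes> q \<otimes> inv (vert_max n) = g" using vert_max_closed[of n] K_carrier by (simp add: m_assoc)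
  then show ?thesis using g by simp
qed

lemma path_set_step:
  "even i \<Longrightarrow> \<not> path_set i \<subseteq> path_set (Suc i)" 
  "odd i \<Longrightarrow> path_set i \<subseteq> path_set (Suc i)"
proof -
  show "\<not> path_set i \<subseteq> path_set (Suc i)" if ev: "even i"
  proof -
    obtain n where "i = 2 * n" using ev by (rule evenE)
    then show ?thesis using edge_of_vert[of n] by auto
  qed
  show "path_set i \<subseteq> path_set (Suc i)" if od: "odd i"
  proof -
    obtain n where "i = 2 * n + 1" using od by (rule oddE)
    then have n: "i = Suc (2 * n)" by simp
    have "path_set (Suc i) = vert (Suc n)" using path_set_simps(1)[of "Suc n"] n by simp
    then show ?thesis using vert_of_edge[of n] n by auto
  qed
qed

lemma rexp_expression: "expression W S (rexp k)"
  unfolding expression_def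
proof (intro conjI allI impI)
  show "rexp k \<noteq> []" by (simp add: rexp_def)
  show "\<forall>I\<in>set (rexp k). fin I" using fin_sub[OF path_set_sub]
    by (auto simp: rexp_def simp del: upt_Suc)
  fix i assume "Suc i < length (rexp k)"
  then have nth: "rexp k ! i = path_set i" "rexp k ! Suc i = path_set (Suc i)" by simp_all
  show "\<exists>r\<in>S. r \<notin> rexp k ! i \<and> rexp k ! Suc i = insert r (rexp k ! i) \<or>
      r \<in> rexp k ! i \<and> rexp k ! Suc i = rexp k ! i - {r}"
  proof (cases "even i")
    case True
    then obtain n where n: "i = 2 * n" by blast
    have "rcur (Suc n) \<in> S" using rot_mem[of "Suc n"] K_subset by blast
    with n show ?thesis unfolding nth using edge_of_vert[of n]
      by (intro bexI[of _ "rcur (Suc n)"]) auto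
  next
    case False
    then obtain n where n: "i = Suc (2 * n)" using oddE by fastforce
    have "path_set (Suc i) = vert (Suc n)" using path_set_simps(1)[of "Suc n"] n by simp
    then show ?thesis unfolding nth using vert_of_edge[of n] rot_mem[of n] K_subset n
      by (intro bexI[of _ "rcur n"]) auto
  qed
qed

text \<open>An expression that follows the rotation up to position \<open>n\<close> by reduced steps has the
  maximal elements \<open>vert_max\<close>.  It is stated for initial segments, to serve both for \<open>rexp k\<close> and for an
  arbitrary reduced expression that is being compared with the rotation.\<close>

lemma path_max_rotation:
  assumes E: "expression W S E" and n: "n < length E"
    and up: "\<And>i. i < n \<Longrightarrow> E ! i \<subseteq> E ! Suc i \<Longrightarrow> reduced_up E i"
    and eq: "\<And>i. i \<le> n \<Longrightarrow> E ! i = path_set i"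
  shows "path_max E n = vert_max (n div 2) \<and> (\<forall>j. Suc (2 * j) < n \<longrightarrow> advances j)"
  using n up eq
proof (induction n)
  case 0
  have "path_set 0 = J" using path_set_simps(1)[of 0] vert_0 by simp
  then show ?case using path_max_0[OF E] 0 by simp
next
  case (Suc n)
  have IH: "path_max E n = vert_max (n div 2)" "\<forall>j. Suc (2 * j) < n \<longrightarrow> advances j"
    using Suc by auto
  have e: "E ! n = path_set n" "E ! Suc n = path_set (Suc n)" using Suc.prems by auto
  show ?case
  proof (cases "even n")
    case True
    then have "path_max E (Suc n) = path_max E n"
      using path_max_down[OF E Suc.prems(1)] path_set_step(1)[of n] e by simp
    moreover have "Suc (2 * j) < Suc n \<longrightarrow> Suc (2 * j) < n" for j using True by presburger
    ultimately show ?thesis using IH True by simp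
  next
    case False
    then obtain m where m: "n = Suc (2 * m)" using oddE by fastforce
    have u: "E ! n \<subseteq> E ! Suc n" using path_set_step(2)[OF False] e by simp
    then have r: "reduced_up E n" using Suc.prems by simp
    have ps: "path_set n = edge (Suc m)" "path_set (Suc n) = vert (Suc m)"
      using path_set_simps(1)[of "Suc m"] m by simp_all
    have "path_max E (Suc n) = vert_max (Suc m)"
      using path_max_up[OF E Suc.prems(1) u r] IH e ps m by simp
    moreover have "advances m" using r IH m unfolding reduced_up_def advances_def e ps by simp
    moreover have "Suc (2 * j) < Suc n \<longrightarrow> Suc (2 * j) < n \<or> j = m" for j using m by presburger
    ultimately show ?thesis using IH m by auto
  qed
qed

lemma reduced_rexp_iff: "reduced W S (rexp k) \<longleftrightarrow> (\<forall>j<k. advances j)"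
proof
  assume r: "reduced W S (rexp k)"
  then have "\<forall>j. Suc (2 * j) < 2 * k \<longrightarrow> advances j"
    using path_max_rotation[OF rexp_expression, of "2 * k" k] unfolding reduced_iff by simp
  then show "\<forall>j<k. advances j" by simp
next
  assume adv: "\<forall>j<k. advances j"
  have up: "rexp k ! i \<subseteq> rexp k ! Suc i \<longrightarrow> reduced_up (rexp k) i" if "i < 2 * k" for i
    using that
  proof (induction i rule: less_induct)
    case (less i)
    show ?case
    proof
      assume u: "rexp k ! i \<subseteq> rexp k ! Suc i"
      then have "odd i" using path_set_step(1)[of i] less.prems by auto
      then obtain m where m: "i = Suc (2 * m)" using oddE by fastforce
      have y: "path_max (rexp k) i = vert_max m"
        using path_max_rotation[OF rexp_expression, of i k] less m by simp
      have ps: "path_set i = edge (Suc m)" "path_set (Suc i) = vert (Suc m)"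
        using path_set_simps(1)[of "Suc m"] m by simp_all
      have "advances m" using adv less.prems m by simp
      then show "reduced_up (rexp k) i"
        unfolding reduced_up_def y advances_def using ps less.prems by simp
    qed
  qed
  show "reduced W S (rexp k)" unfolding reduced_iff
  proof (intro conjI allI impI rexp_expression)
    fix i assume "Suc i < length (rexp k) \<and> rexp k ! i \<subseteq> rexp k ! Suc i"
    then have i: "Suc i < length (rexp k)" "rexp k ! i \<subseteq> rexp k ! Suc i" by blast+
    from i(1) have "i < 2 * k" by simp
    then show "reduced_up (rexp k) i" using up i(2) by blast
  qed
qed

lemma vert_max_maximal:
  assumes "\<forall>j<n. advances j"
  shows "coset_maximal J (vert n) (vert_max n)"
proof -
  have r: "reduced W S (rexp n)" using assms reduced_rexp_iff by blast
  then have "path_max (rexp n) (2 * n) = vert_max n"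
    using path_max_rotation[OF rexp_expression, of "2 * n" n] unfolding reduced_iff by simp
  then show ?thesis
    using path_max_maximal[OF rexp_expression, of "2 * n" n] path_set_simps(1)[of 0] vert_0 by simp
qed

text \<open>Up to the common factor that is minimal on the right, this compares the longest elements
  of an edge and of the adjacent vertex.\<close>

lemma vert_max_len_less:
  assumes adv: "\<forall>j\<le>n. advances j"
  shows "len (vert_max n) < len (vert_max (Suc n))"
proof -
  let ?A = "edge (Suc n)" and ?V = "vert (Suc n)"
  note AV = fin_edge[of "Suc n"] fin_vert[of "Suc n"]
  note VS = fin_subset[OF AV(2)]
  have yc: "vert_max n \<in> carrier W" by (rule vert_max_closed)
  have m: "coset_minimal {} ?V (vert_max n \<otimes> wl ?A)" using adv unfolding advances_def by blast
  have y: "coset_maximal J (vert n) (vert_max n)" using vert_max_maximal adv by simp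
  have "wl ?A \<in> par (vert n)"
    using par_mono[OF _ longest_par[OF AV(1)]] edge_of_vert[of n] by blast
  then have "len (vert_max n \<otimes> wl ?A) + len (wl ?A) = len (vert_max n)"
    using right_maximal_len[OF J_subset fin_subset[OF fin_vert] y] by blast
  moreover have "len (vert_max (Suc n)) = len (vert_max n \<otimes> wl ?A) + len (wl ?V)"
    using right_minimal_len[OF VS m longest_par[OF AV(2)]] by simp
  moreover have "len (wl ?A) < len (wl ?V)"
  proof -
    have r: "rcur n \<in> S" "rcur n \<in> ?V" using rot_mem[of n] K_subset vert_of_edge[of n] by auto
    have "wl ?A \<in> par ?V" using par_mono[OF _ longest_par[OF AV(1)]] vert_of_edge[of n] by blast
    then have "wl ?A \<otimes> rcur n \<in> par ?V" using par_mult[OF VS] par_gen[OF r(2)] by blast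
    then show ?thesis
      using ascent_outside[OF AV(1) r(1) vert_of_edge(2)] longest_bound[OF AV(2)] by fastforce
  qed
  ultimately show ?thesis by simp
qed

lemma ex_stop: "\<exists>n. \<not> advances n"
proof (rule ccontr)
  assume "\<not> ?thesis"
  then have adv: "advances n" for n by blast
  have "n \<le> len (vert_max n)" for n
  proof (induction n)
    case (Suc n)
    then show ?case using vert_max_len_less[of n] adv by simp
  qed simp
  then have "Suc (len wK) \<le> len (vert_max (Suc (len wK)))" .
  then show False using longest_bound[OF fin_sJ vert_max_par, of "Suc (len wK)"] by simp
qed

text \<open>Let \<open>m = y w\<^sub>A\<close> with \<open>y = vert_max n\<close> and \<open>A = edge (Suc n)\<close>.  If the next step up is not reduced,
  then \<open>rcur n\<close>, the one element that this step adds, is a right descent of \<open>m\<close>.  By \<open>vert_max_conj\<close>,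
  conjugation by \<open>m\<close> maps \<open>A\<close> into \<open>L\<close>, so \<open>y = v m\<close> with \<open>v = m w\<^sub>A m\<^sup>-\<^sup>1\<close> is additive, and the descent
  passes from \<open>m\<close> to \<open>y\<close>.  The other elements of \<open>K\<close> are right descents of \<open>y\<close> anyway.\<close>

lemma stop_longest:
  assumes adv: "\<forall>j<n. advances j" and stop: "\<not> advances n"
  shows "vert_max n = wK"
proof -
  let ?A = "edge (Suc n)"
  note A = fin_edge[of "Suc n"]
  note AS = fin_subset[OF A]
  let ?m = "vert_max n \<otimes> wl ?A"
  have yc: "vert_max n \<in> carrier W" by (rule vert_max_closed)
  then have mc: "?m \<in> carrier W" using A by simp
  have y: "coset_maximal J (vert n) (vert_max n)" using vert_max_maximal adv by blast
  then have yA: "coset_maximal J ?A (vert_max n)"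
    using edge_of_vert[of n] unfolding coset_maximal_def by blast
  have mA: "coset_minimal {} ?A ?m" using maximal_times_longest[OF J_subset A yA] .
  let ?r = "rcur n"
  have r: "?r \<in> S" "?r \<in> carrier W" using rot_mem[of n] K_subset by auto
  have "\<not> len ?m < len (?m \<otimes> ?r)"
    using stop mA vert_of_edge[of n] unfolding advances_def coset_minimal_def by auto
  then have mr: "len (?m \<otimes> ?r) < len ?m" using len_gen_right_cases[OF r(1) mc] by linarith
  \<comment> \<open>the longest element of \<open>A\<close>, moved to the left of \<open>m\<close>\<close>
  define v where "v = ?m \<otimes> wl ?A \<otimes> inv ?m"
  have vc: "v \<in> carrier W" unfolding v_def using mc A by simp
  have yv: "vert_max n = v \<otimes> ?m" unfolding v_def using yc A by (simp add: m_assoc inv_mult_group)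
  have vl: "len v \<le> len (wl ?A)" unfolding v_def
  proof (rule conj_len_le[OF AS mc _ longest_par[OF A]])
    fix q assume q: "q \<in> ?A"
    have "vert_max n \<otimes> (wl ?A \<otimes> q \<otimes> wl ?A) \<otimes> inv (vert_max n) \<in> L"
      using vert_max_conj_back longest_conj[OF A q] by blast
    moreover have "q \<in> carrier W" using q AS by auto
    ultimately show "?m \<otimes> q \<otimes> inv ?m \<in> S"
      using yc A K_subset by (auto simp: inv_mult_group m_assoc)
  qed
  have "len (vert_max n \<otimes> ?r) < len (vert_max n)"
  proof -
    have "v \<otimes> (?m \<otimes> ?r) = v \<otimes> ?m \<otimes> ?r" using m_assoc[OF vc mc r(2)] by simp
    also have "\<dots> = vert_max n \<otimes> ?r" by (simp only: yv[symmetric])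
    finally have "len (vert_max n \<otimes> ?r) \<le> len v + len (?m \<otimes> ?r)"
      using len_mult[of v "?m \<otimes> ?r"] vc m_closed[OF mc r(2)] by simp
    also have "\<dots> < len (wl ?A) + len ?m" using vl mr by simp
    also have "\<dots> = len (vert_max n)"
      using right_maximal_len[OF J_subset AS yA longest_par[OF A]] by simp
    finally show ?thesis .
  qed
  then have "\<forall>q\<in>insert ?r (vert n). len (vert_max n \<otimes> q) < len (vert_max n)"
    using y unfolding coset_maximal_def by blast
  then have "\<forall>q\<in>K. len (vert_max n \<otimes> q) < len (vert_max n)" unfolding insert_vert .
  then show ?thesis using longest_eqI[OF fin_sJ vert_max_par] by simp
qed

lemma advances_not_longest:
  assumes "vert_max n = wK"
  shows "\<not> advances n"
proof -
  have "rcur n \<in> K" "edge (Suc n) \<subseteq> K" using rot_mem[of n] edge_sub by auto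
  then have "\<not> len (vert_max n \<otimes> wl (edge (Suc n))) < len (vert_max n \<otimes> wl (edge (Suc n)) \<otimes> rcur n)"
    using maximal_longest_no_ascent[OF K_subset K_subset longest_maximal[OF fin_sJ] fin_edge]
      vert_of_edge[of n] unfolding assms by blast
  then show ?thesis using vert_of_edge[of n] unfolding advances_def coset_minimal_def by auto
qed

text \<open>Conjugating \<open>L\<close> by \<open>vert_max n = w\<^sub>K\<close> in two ways shows that the last two types are \<open>t\<close> and \<open>sopp\<close> in
  some order.  If \<open>sopp\<close> came first, the walk would have reached the antipode of its starting
  vertex.  All of \<open>W\<^sub>J\<close> fixes that antipode, so by \<open>stabilizer_decreasing\<close> it would fix the
  first edge of the walk as well, which is false.\<close>

lemma stop_types:
  assumes adv: "\<forall>j<n. advances j" and stop: "\<not> advances n"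
  shows "1 \<le> n \<and> rcur n = t \<and> rcur (Suc n) = sopp"
proof -
  have y: "vert_max n = wK" using stop_longest[OF assms] .
  have n: "n \<noteq> 0"
  proof
    assume "n = 0"
    then have "K \<subseteq> J" using y longest_subset[OF fin_J fin_sJ] by simp
    then show False using s_notin by blast
  qed
  have "edge (Suc n) = (\<lambda>g. wK \<otimes> g \<otimes> wK) ` (K - {s, topp})"
    using vert_max_conj[of n] y fin_sJ by simp
  also have "\<dots> = K - {sopp, t}"
    using longest_conj_image_Diff[OF fin_sJ, of "{s, topp}"] topp_mem topp_opp by simp
  finally have "K - {rcur n, rcur (Suc n)} = K - {sopp, t}" unfolding edge_def rot_Suc(1) .
  moreover have "rcur n \<in> K" "rcur (Suc n) \<in> K" using rot_mem by auto
  ultimately have set: "{rcur n, rcur (Suc n)} = {sopp, t}"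
    using sopp_mem t_mem by blast
  have "rcur n \<noteq> sopp"
  proof
    assume eq: "rcur n = sopp"
    let ?E = "rexp n"
    have red: "reduced W S ?E" using adv reduced_rexp_iff by blast
    then have up: "\<And>i. i < 2 * n \<Longrightarrow> ?E ! i \<subseteq> ?E ! Suc i \<Longrightarrow> reduced_up ?E i"
      unfolding reduced_iff by simp
    have E0: "?E ! 0 = J" using path_set_simps(1)[of 0] vert_0 by simp
    have y2: "path_max ?E (2 * n) = wK"
      using path_max_rotation[OF rexp_expression, of "2 * n" n] up y by simp
    have y1: "path_max ?E 1 = wl J"
      using path_max_rotation[OF rexp_expression, of 1 n] up n by simp
    have E1: "?E ! 1 = edge 1" using n path_set_simps(2)[of 0] by simp
    \<comment> \<open>a reflection in \<open>J\<close> that does not fix the first edge, since \<open>wl J\<close> conjugates it to \<open>rcur 1\<close>\<close>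
    let ?g = "wl J \<otimes> rcur 1 \<otimes> wl J"
    have r1: "rcur 1 \<in> J" using edge_of_vert(2)[of 0] vert_0 by simp
    then have r1c: "rcur 1 \<in> S" "rcur 1 \<in> carrier W" using J_subset by auto
    have g: "?g \<in> J" using longest_conj[OF fin_J r1] .
    then have gK: "?g \<in> K - {s}" using s_notin by auto
    have "(\<lambda>g. wK \<otimes> g \<otimes> wK) ` (K - {s}) = K - {sopp}"
      using longest_conj_image_Diff[OF fin_sJ, of "{s}"] by simp
    then have "wK \<otimes> ?g \<otimes> wK \<in> vert n" using gK unfolding vert_def eq by blast
    then have "inv (path_max ?E (2 * n)) \<otimes> ?g \<otimes> path_max ?E (2 * n) \<in> par (?E ! (2 * n))"
      unfolding y2 using par_gen fin_sJ by simp
    then have "inv (path_max ?E 1) \<otimes> ?g \<otimes> path_max ?E 1 \<in> par (?E ! 1)"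
      using stabilizer_decreasing[OF red, of "2 * n" 1 ?g] par_gen[OF g] n E0 by simp
    moreover have "inv (wl J) \<otimes> ?g \<otimes> wl J = rcur 1"
      using longest_conj_conj[OF fin_J r1c(2)] fin_J by simp
    ultimately have "rcur 1 \<in> par (edge 1)" unfolding y1 E1 by simp
    then have "rcur 1 \<in> edge 1" using par_gen_mem[OF fin_subset[OF fin_edge] r1c(1)] by blast
    then show False using edge_of_vert(3)[of 0] by simp
  qed
  then show ?thesis using set n by (auto simp: doubleton_eq_iff)
qed

end

context switchback
begin

section \<open>Classification of the reduced expressions\<close>

abbreviation target :: "'a set" where "target \<equiv> dcoset J (K - {t}) wK"

text \<open>All elements of \<open>K\<close> are descents of \<open>w\<^sub>K\<close> on both sides, so \<open>w\<^sub>K\<close> is the maximal element of the target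
  coset.\<close>

lemma target_facts:
  assumes "E \<in> reduced_expressions W S J (K - {t}) target"
  shows "reduced W S E" "expression W S E" "E \<noteq> []" "E ! 0 = J" "E ! (length E - 1) = K - {t}"
    "path_max E (length E - 1) = wK"
proof -
  show r: "reduced W S E" using assms by (simp add: reduced_expressions_def)
  show e: "expression W S E" using r reduced_iff by blast
  show ne: "E \<noteq> []" using e by (simp add: expression_def)
  have *: "hd E = J" "last E = K - {t}" "forward_path W S E (length E - 1) = target"
    using assms by (auto simp: reduced_expressions_def expresses_def)
  show "E ! 0 = J" using * ne by (simp add: hd_conv_nth)
  show "E ! (length E - 1) = K - {t}" using * ne by (simp add: last_conv_nth)
  have "coset_maximal J (K - {t}) wK"
    using longest_maximal[OF fin_sJ] unfolding coset_maximal_def by blast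
  then show "path_max E (length E - 1) = wK"
    unfolding path_max_def * using coset_max_eq[OF fin_J fin_sub[OF Diff_subset]] by simp
qed

text \<open>Each \<open>path_max E i\<close> is an additive left factor of the next one, and right descents of an element
  of \<open>W\<^sub>K\<close> belong to \<open>K\<close>.\<close>

lemma reduced_expression_in_K:
  assumes E: "reduced W S E" and n: "n < length E" and y: "path_max E n \<in> par K" and i: "i \<le> n"
  shows "path_max E i \<in> par K \<and> E ! i \<subseteq> K"
proof -
  have ex: "expression W S E" using E reduced_iff by blast
  have P: "path_max E i \<in> par K"
    using i y n
  proof (induction rule: inc_induct)
    case base
    then show ?case by blast
  next
    case (step i)
    have i: "Suc i < length E" "i < length E" using step n by simp_all
    have IH: "path_max E (Suc i) \<in> par K" using step by blast
    show ?case
    proof (cases "E ! i \<subseteq> E ! Suc i")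
      case False
      then show ?thesis using IH path_max_down[OF ex i(1) False] by simp
    next
      case True
      then have r: "reduced_up E i" using E i unfolding reduced_iff by blast
      have f: "fin (E ! i)" "fin (E ! Suc i)" using expression_fin[OF ex] i by auto
      have yc: "path_max E i \<in> carrier W" using path_max_closed[OF ex i(2)] .
      have "path_max E (Suc i) = path_max E i \<otimes> (wl (E ! i) \<otimes> wl (E ! Suc i))"
        using path_max_up[OF ex i(1) True r] f yc by (simp add: m_assoc)
      then show ?thesis
        using par_prefix[OF K_subset yc, of "wl (E ! i) \<otimes> wl (E ! Suc i)"] f IH
          path_max_up_len[OF ex i(1) True r] by simp
    qed
  qed
  have "E ! i \<subseteq> K"
  proof
    fix r assume r: "r \<in> E ! i"
    have il: "i < length E" using i n by simp
    then have "len (path_max E i \<otimes> r) < len (path_max E i)"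
      using path_max_maximal[OF ex il] r unfolding coset_maximal_def by blast
    then show "r \<in> K"
      using par_right_descent[OF K_subset P] r fin_subset[OF expression_fin[OF ex il]] by blast
  qed
  then show ?thesis using P by blast
qed

lemma finite_K: "finite K"
proof (rule finite_subset)
  show "K \<subseteq> par K" by (rule subsetI) (rule par_gen)
  show "finite (par K)" using fin_sJ by (simp add: finitary_def)
qed

lemma short_expression:
  shows "steps J [Add s, Remove t] \<in> reduced_expressions W S J (K - {t}) target"
proof -
  let ?E = "[J, K, K - {t}]"
  have e: "expression W S ?E" unfolding expression_def
  proof (intro conjI allI impI)
    show "\<forall>I\<in>set ?E. fin I" using fin_J fin_sJ fin_sub[of "K - {t}"] by auto
    fix i assume "Suc i < length ?E"
    then have "i = 0 \<or> i = 1" by auto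
    then show "\<exists>r\<in>S. r \<notin> ?E ! i \<and> ?E ! Suc i = insert r (?E ! i) \<or>
      r \<in> ?E ! i \<and> ?E ! Suc i = ?E ! i - {r}"
      using s_in_S s_notin t_mem K_subset by fastforce
  qed simp
  have y0: "path_max ?E 0 = wl J" using path_max_0[OF e] by simp
  have u0: "reduced_up ?E 0" unfolding reduced_up_def y0
    using fin_J K_subset by (auto simp: coset_minimal_def)
  have y1: "path_max ?E (Suc 0) = wK"
    using path_max_up[OF e _ _ u0] fin_J fin_sJ by (auto simp: y0)
  have y2: "path_max ?E (Suc (Suc 0)) = wK"
    using path_max_down[OF e, of "Suc 0"] t_mem y1 by auto
  have r: "reduced W S ?E" unfolding reduced_iff
  proof (intro conjI allI impI e)
    fix i assume i: "Suc i < length ?E \<and> ?E ! i \<subseteq> ?E ! Suc i"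
    then have "i = 0 \<or> i = 1" by auto
    then show "reduced_up ?E i" using u0 i t_mem by auto
  qed
  have "forward_path W S ?E (Suc (Suc 0)) = target" using path_coset[OF e, of "Suc (Suc 0)"] y2 by simp
  then show ?thesis using e r by (simp add: reduced_expressions_def expresses_def)
qed

text \<open>After the first step the maximal element is already \<open>w\<^sub>K\<close>, the longest one possible.  As a
  proper step up increases the length, only steps down can follow, and counting elements leaves room for
  exactly one.\<close>

lemma up_first_unique:
  assumes E: "E \<in> reduced_expressions W S J (K - {t}) target"
    and len: "1 < length E" and E1: "E ! 1 = K"
  shows "E = steps J [Add s, Remove t]"
proof -
  note e = target_facts[OF E]
  let ?n = "length E - 1"
  have inK: "path_max E i \<in> par K" if "i < length E" for i
    using reduced_expression_in_K[OF e(1), of ?n i] e(6) longest_par[OF fin_sJ] that by simp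
  have EK: "E ! i \<subseteq> K" if "i < length E" for i
    using reduced_expression_in_K[OF e(1), of ?n i] e(6) longest_par[OF fin_sJ] that by simp
  have "path_max E (Suc i) = wK \<and> card (E ! Suc i) + i = card K" if "Suc i < length E" for i
    using that
  proof (induction i)
    case 0
    have sub: "E ! 0 \<subseteq> E ! Suc 0" using e E1 by auto
    then have "reduced_up E 0" using e(1) 0 unfolding reduced_iff by blast
    then have "path_max E (Suc 0) = wl J \<otimes> wl J \<otimes> wK"
      using path_max_up[OF e(2) 0 sub] path_max_0[OF e(2)] e E1 by simp
    then show ?case using fin_J fin_sJ E1 by simp
  next
    case (Suc i)
    have IH: "path_max E (Suc i) = wK" "card (E ! Suc i) + i = card K" using Suc by auto
    from e(2) Suc.prems show ?case
    proof (cases rule: expression_step)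
      case (up r)
      have f: "fin (E ! Suc i)" "fin (E ! Suc (Suc i))" using expression_fin[OF e(2)] Suc.prems by auto
      have "reduced_up E (Suc i)" using e(1) Suc.prems up unfolding reduced_iff by blast
      then have "len (path_max E (Suc (Suc i))) = len wK + len (wl (E ! Suc i) \<otimes> wl (E ! Suc (Suc i)))"
        using path_max_up_len[OF e(2) Suc.prems up(4)] IH by simp
      then have "len (wl (E ! Suc i) \<otimes> wl (E ! Suc (Suc i))) = 0"
        using longest_bound[OF fin_sJ inK[OF Suc.prems]] by simp
      then have "wl (E ! Suc i) \<otimes> wl (E ! Suc (Suc i)) = \<one>" using len_eq_0 f by simp
      then have "wl (E ! Suc i) = wl (E ! Suc (Suc i))"
        using inv_equality[of "wl (E ! Suc i)" "wl (E ! Suc (Suc i))"] f by simp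
      then have "E ! Suc (Suc i) \<subseteq> E ! Suc i" using longest_subset f by blast
      then show ?thesis using up by blast
    next
      case (down r)
      have "finite (E ! Suc i)" using EK[of "Suc i"] Suc.prems finite_K finite_subset by auto
      then have "card (E ! Suc (Suc i)) + 1 = card (E ! Suc i)"
        using down by (metis Suc_eq_plus1 card_Suc_Diff1)
      then show ?thesis using IH path_max_down[OF e(2) Suc.prems down(4)] by simp
    qed
  qed
  from this[of "length E - 2"] have c: "card (K - {t}) + (length E - 2) = card K"
    using e(5) len by (simp add: numeral_2_eq_2 Suc_diff_Suc)
  have "card (K - {t}) + 1 = card K" using t_mem finite_K by (metis Suc_eq_plus1 card_Suc_Diff1)
  then have l: "length E = 3" using c by linarith
  then have "E = [E ! 0, E ! 1, E ! 2]"
    by (intro nth_equalityI) (auto simp: less_Suc_eq numeral_3_eq_3 numeral_2_eq_2)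
  also have "\<dots> = [J, K, K - {t}]" using e(4,5) E1 l by simp
  finally show ?thesis by simp
qed

lemma target_length:
  assumes E: "E \<in> reduced_expressions W S J (K - {t}) target"
  shows "1 < length E"
proof (rule ccontr)
  note e = target_facts[OF E]
  assume "\<not> ?thesis"
  then have "length E = 1" using e(3) by (cases E) auto
  then have "wl J = wK" using e(4,6) path_max_0[OF e(2)] by simp
  then have "K \<subseteq> J" using longest_subset[OF fin_J fin_sJ] by simp
  then show False using s_notin by blast
qed

text \<open>At the end of the expression, \<open>w\<^sub>K\<close> conjugates \<open>L\<close> into \<open>K - {t}\<close>.  The rest is
  \<open>stabilizer_decreasing\<close>.\<close>

lemma target_stabilizer:
  assumes E: "E \<in> reduced_expressions W S J (K - {t}) target"
    and i: "i < length E" and g: "g \<in> L"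
  shows "inv (path_max E i) \<otimes> g \<otimes> path_max E i \<in> par (E ! i)"
proof -
  note e = target_facts[OF E]
  have gJ: "g \<in> J" using g by auto
  have "(\<lambda>g. wK \<otimes> g \<otimes> wK) ` (K - {topp}) = K - {t}"
    using longest_conj_image_Diff[OF fin_sJ, of "{topp}"] topp_mem topp_opp by simp
  then have "wK \<otimes> g \<otimes> wK \<in> K - {t}" using g by blast
  then have "inv wK \<otimes> g \<otimes> wK \<in> par (K - {t})" using par_gen fin_sJ by simp
  then show ?thesis
    using stabilizer_decreasing[OF e(1), of "length E - 1" i g] e(4,5,6) par_gen[OF gJ] i by simp
qed

lemma down_first:
  assumes E: "E \<in> reduced_expressions W S J (K - {t}) target" and E1: "E ! 1 \<noteq> K"
  obtains r where "r \<in> J" "E ! 1 = J - {r}" "path_max E 1 = wl J"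
proof -
  note e = target_facts[OF E]
  have l: "Suc 0 < length E" using target_length[OF E] by simp
  from e(2) l show ?thesis
  proof (cases rule: expression_step)
    case (up r)
    have "E ! 1 \<subseteq> K"
      using reduced_expression_in_K[OF e(1), of "length E - 1" 1] e(6) longest_par[OF fin_sJ] l by simp
    then have "E ! 1 = K" using up e(4) by auto
    then show ?thesis using E1 by simp
  next
    case (down r)
    then show ?thesis
      using that[of r] e(4) path_max_down[OF e(2) l] path_max_0[OF e(2)] by simp
  qed
qed

text \<open>If \<open>s = topp\<close>, then \<open>L = J\<close>, and all of \<open>W\<^sub>J\<close> would have to fix a face whose stabilizer in \<open>W\<^sub>J\<close> is
  a proper parabolic subgroup.\<close>

lemma down_first_proper:
  assumes E: "E \<in> reduced_expressions W S J (K - {t}) target" and E1: "E ! 1 \<noteq> K"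
  shows "s \<noteq> topp"
proof
  assume st: "s = topp"
  obtain r where r: "r \<in> J" "E ! 1 = J - {r}" "path_max E 1 = wl J"
    using down_first[OF E E1] .
  have rc: "r \<in> S" "r \<in> carrier W" using r J_subset by auto
  have "wl J \<otimes> r \<otimes> wl J \<in> L" using longest_conj[OF fin_J r(1)] st s_notin by auto
  then have "inv (wl J) \<otimes> (wl J \<otimes> r \<otimes> wl J) \<otimes> wl J \<in> par (J - {r})"
    using target_stabilizer[OF E, of 1] target_length[OF E] r by simp
  then have "r \<in> par (J - {r})" using longest_conj_conj[OF fin_J rc(2)] fin_J by simp
  then show False using par_gen_mem[of "J - {r}" r] rc J_subset by blast
qed

text \<open>In terms of faces: once the walk has left the fundamental chamber by a step down, it
  does not come back, because \<open>path_max E i = wl (E ! i)\<close> means that the minimal element of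
  \<open>path_max E i W\<^bsub>E ! i\<^esub>\<close> is \<open>1\<close>.  A step up would keep that element, and a step down cannot produce it.\<close>

lemma path_max_neq_longest:
  assumes E: "E \<in> reduced_expressions W S J (K - {t}) target" and E1: "E ! 1 \<noteq> K"
    and i: "1 \<le> i" "i < length E"
  shows "path_max E i \<noteq> wl (E ! i)"
  using i
proof (induction i rule: nat_induct_at_least)
  case base
  note e = target_facts[OF E]
  obtain r where r: "r \<in> J" "E ! 1 = J - {r}" "path_max E 1 = wl J"
    using down_first[OF E E1] .
  have "fin (E ! 1)" using expression_fin[OF e(2)] base by simp
  then show ?case using longest_subset[OF _ fin_J] r by fastforce
next
  case (Suc i)
  note e = target_facts[OF E]
  have f: "fin (E ! i)" "fin (E ! Suc i)" using expression_fin[OF e(2)] Suc.prems by auto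
  have i: "i < length E" using Suc.prems by simp
  have yc: "path_max E i \<in> carrier W" using path_max_closed[OF e(2) i] .
  have IH: "path_max E i \<noteq> wl (E ! i)" using Suc by simp
  from e(2) Suc.prems show ?case
  proof (cases rule: expression_step)
    case (up r)
    then have ru: "reduced_up E i" using e(1) Suc.prems unfolding reduced_iff by blast
    show ?thesis
    proof
      assume "path_max E (Suc i) = wl (E ! Suc i)"
      then have "path_max E i \<otimes> wl (E ! i) \<otimes> wl (E ! Suc i) = wl (E ! Suc i)"
        using path_max_up[OF e(2) Suc.prems up(4) ru] by simp
      then have "path_max E i \<otimes> wl (E ! i) = \<one>" using yc f by simp
      then show False using inv_equality[of "path_max E i" "wl (E ! i)"] yc f IH by simp
    qed
  next
    case (down r)
    show ?thesis
    proof
      assume a: "path_max E (Suc i) = wl (E ! Suc i)"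
      then have y: "path_max E i = wl (E ! Suc i)"
        using path_max_down[OF e(2) Suc.prems down(4)] by simp
      have "len (path_max E i \<otimes> r) < len (path_max E i)"
        using path_max_maximal[OF e(2) i] down unfolding coset_maximal_def by blast
      then have "r \<in> E ! Suc i"
        using par_right_descent[OF fin_subset[OF f(2)] longest_par[OF f(2)] down(1)] y by simp
      then show False using down by blast
    qed
  qed
qed

end

context proper_switchback
begin

text \<open>By \<open>target_stabilizer\<close> and \<open>vert_max_conj\<close>, a step down from the \<open>k\<close>-th vertex or edge must keep
  \<open>edge (Suc k)\<close>, which leaves one choice at a vertex and none at an edge.  After the first step, a step
  up from a vertex would lead to \<open>K\<close> and force the maximal element to be \<open>wl (E ! n)\<close>, against
  \<open>path_max_neq_longest\<close>.  A step up from an edge back to the vertex that the walk has just left is not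
  reduced.\<close>

lemma down_first_forced:
  assumes E: "E \<in> reduced_expressions W S J (K - {t}) target" and E1: "E ! 1 \<noteq> K"
    and n: "n < length E"
  shows "\<forall>i\<le>n. E ! i = path_set i"
  using n
proof (induction n)
  case 0
  then show ?case using target_facts(4)[OF E] vert_0 path_set_simps(1)[of 0] by simp
next
  case (Suc n)
  note e = target_facts[OF E]
  have IH: "E ! i = path_set i" if "i \<le> n" for i using Suc that by simp
  have n: "n < length E" using Suc.prems by simp
  have f: "fin (E ! n)" "fin (E ! Suc n)" using expression_fin[OF e(2)] Suc.prems by auto
  have red: "reduced_up E i" if "i \<le> n" "E ! i \<subseteq> E ! Suc i" for i
    using e(1) that Suc.prems unfolding reduced_iff by simp
  have y: "path_max E i = vert_max (i div 2)" if "i \<le> n" for i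
    using path_max_rotation[OF e(2), of i] that n red IH by simp
  have EK: "E ! Suc n \<subseteq> K"
    using reduced_expression_in_K[OF e(1), of "length E - 1" "Suc n"] e(6) longest_par[OF fin_sJ]
      Suc.prems by simp
  have stab: "edge (Suc (n div 2)) \<subseteq> E ! Suc n" if d: "\<not> E ! n \<subseteq> E ! Suc n"
  proof
    fix q assume q: "q \<in> edge (Suc (n div 2))"
    then obtain g where g: "g \<in> L" "q = inv (vert_max (n div 2)) \<otimes> g \<otimes> vert_max (n div 2)"
      using vert_max_conj[of "n div 2"] by blast
    have "path_max E (Suc n) = vert_max (n div 2)" using path_max_down[OF e(2) Suc.prems d] y by simp
    then have "q \<in> par (E ! Suc n)" using target_stabilizer[OF E Suc.prems g(1)] g(2) by simp
    moreover have "q \<in> S" using q edge_sub K_subset by blast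
    ultimately show "q \<in> E ! Suc n" using par_gen_mem[OF fin_subset[OF f(2)]] by blast
  qed
  have "E ! Suc n = path_set (Suc n)"
  proof (cases "even n")
    case True
    then obtain k where k: "n = 2 * k" by blast
    have En: "E ! n = vert k" using IH[of n] k by simp
    from e(2) Suc.prems show ?thesis
    proof (cases rule: expression_step)
      case (up r)
      have "r \<in> K" using EK up by blast
      then have "r = rcur k" using up(2) En unfolding vert_def by blast
      then have SK: "E ! Suc n = K" using up(3) En insert_vert[of k] by simp
      then have n1: "1 \<le> n" using E1 by (cases n) auto
      let ?m = "path_max E n \<otimes> wl (E ! n)"
      have "coset_minimal {} K ?m" using red[of n] up(4) SK unfolding reduced_up_def by simp
      moreover have "?m \<in> par K"
        using par_mult[OF K_subset] vert_max_par y[of n] En par_mono[OF vert_sub longest_par[OF fin_vert]] by simp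
      ultimately have "?m = \<one>" using right_minimal_in_par_trivial[OF K_subset] by blast
      then have "path_max E n = wl (E ! n)"
        using inv_equality[of "path_max E n" "wl (E ! n)"] path_max_closed[OF e(2) n] f by simp
      then show ?thesis using path_max_neq_longest[OF E E1 n1 n] by blast
    next
      case (down r)
      have "edge (Suc k) \<subseteq> vert k - {r}" using stab[OF down(4)] down(3) En k by simp
      then have "r = rcur (Suc k)" using edge_of_vert[of k] down(2) En by auto
      then show ?thesis using down(3) En edge_of_vert(1)[of k] k by simp
    qed
  next
    case False
    then obtain k where k: "n = Suc (2 * k)" using oddE by fastforce
    have En: "E ! n = edge (Suc k)" using IH[of n] k by simp
    have pS: "path_set (Suc n) = vert (Suc k)" using path_set_simps(1)[of "Suc k"] k by simp
    from e(2) Suc.prems show ?thesis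
    proof (cases rule: expression_step)
      case (up r)
      have "r \<in> K" using EK up by blast
      then have "r = rcur k \<or> r = rcur (Suc k)"
        using up(2) En unfolding edge_def rot_Suc(1) by blast
      moreover have "r \<noteq> rcur (Suc k)"
      proof
        assume r: "r = rcur (Suc k)"
        have "coset_maximal J (vert k) (vert_max k)"
          using path_max_maximal[OF e(2), of "2 * k"] y[of "2 * k"] IH[of "2 * k"] e(4) n k by simp
        then have "\<not> len (vert_max k \<otimes> wl (edge (Suc k))) < len (vert_max k \<otimes> wl (edge (Suc k)) \<otimes> r)"
          using maximal_longest_no_ascent[OF J_subset fin_subset[OF fin_vert] _ fin_edge]
            edge_of_vert[of k] r by blast
        moreover have "reduced_up E n" using red up(4) by simp
        ultimately show False
          using up(3) En y[of n] k unfolding reduced_up_def coset_minimal_def by simp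
      qed
      ultimately have "r = rcur k" by blast
      then show ?thesis using up(3) En vert_of_edge(1)[of k] pS by simp
    next
      case (down r)
      have "edge (Suc k) \<subseteq> edge (Suc k) - {r}" using stab[OF down(4)] down(3) En k by simp
      then show ?thesis using down(2) En by blast
    qed
  qed
  then show ?case using IH by (auto simp: le_Suc_eq)
qed

lemma down_first_unique:
  assumes E: "E \<in> reduced_expressions W S J (K - {t}) target" and E1: "E ! 1 \<noteq> K"
    and adv: "\<forall>j<d. advances j" and stop: "\<not> advances d"
  shows "E = rexp d"
proof -
  note e = target_facts[OF E]
  let ?n = "length E - 1"
  have n: "?n < length E" using e(3) by simp
  have eq: "\<forall>i\<le>?n. E ! i = path_set i" using down_first_forced[OF E E1 n] .
  have "\<And>i. i < ?n \<Longrightarrow> E ! i \<subseteq> E ! Suc i \<Longrightarrow> reduced_up E i"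
    using e(1) unfolding reduced_iff by simp
  then have y: "path_max E ?n = vert_max (?n div 2)" and a: "\<forall>j. Suc (2 * j) < ?n \<longrightarrow> advances j"
    using path_max_rotation[OF e(2) n] eq by auto
  have "even ?n"
  proof (rule ccontr)
    assume "odd ?n"
    then obtain k where "?n = 2 * k + 1" by (rule oddE)
    then have k: "?n = Suc (2 * k)" by simp
    have "edge (Suc k) = K - {t}" using eq e(5) k by simp
    moreover have "rprev (Suc k) \<notin> edge (Suc k)" "rcur (Suc k) \<notin> edge (Suc k)"
      by (simp_all add: edge_def)
    ultimately have "rprev (Suc k) \<notin> K - {t}" "rcur (Suc k) \<notin> K - {t}" by simp_all
    then have "rprev (Suc k) = t" "rcur (Suc k) = t" using rot_mem[of "Suc k"] by blast+
    then show False using rot_mem[of "Suc k"] by simp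
  qed
  then obtain k where k: "?n = 2 * k" by (rule evenE)
  have "vert_max k = wK" using y e(6) k by simp
  then have "\<not> advances k" by (rule advances_not_longest)
  moreover have "\<forall>j<k. advances j" using a k by simp
  ultimately have "k = d" using adv stop by (meson linorder_neqE_nat)
  then show ?thesis using eq k n by (intro nth_equalityI) auto
qed

lemma long_expression:
  assumes adv: "\<forall>j<d. advances j" and stop: "\<not> advances d"
  shows "rexp d \<in> reduced_expressions W S J (K - {t}) target"
proof -
  have r: "reduced W S (rexp d)" using adv reduced_rexp_iff by blast
  have ne: "rexp d \<noteq> []" by (simp add: rexp_def)
  have h: "rexp d ! 0 = J" using path_set_simps(1)[of 0] vert_0 by simp
  have l: "rexp d ! (2 * d) = K - {t}" using stop_types[OF assms] by (simp add: vert_def)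
  have "path_max (rexp d) (2 * d) = wK"
    using path_max_rotation[OF rexp_expression, of "2 * d" d] r stop_longest[OF assms]
    unfolding reduced_iff by simp
  then have "forward_path W S (rexp d) (2 * d) = target"
    using path_coset[OF rexp_expression, of "2 * d" d] h l by simp
  moreover have "hd (rexp d) = J" "last (rexp d) = K - {t}"
    using h l ne by (simp_all add: hd_conv_nth last_conv_nth)
  ultimately show ?thesis
    using r rexp_expression by (simp add: reduced_expressions_def expresses_def)
qed

lemma steps_rexp:
  "steps J (concat (map (\<lambda>i. [Remove (rotation W S J s t (int i)), Add (rotation W S J s t (int i - 1))])
     [1..<Suc n])) = rexp n"
proof (induction n)
  case 0
  have "path_set 0 = J" using path_set_simps(1)[of 0] vert_0 by simp
  then show ?case by (simp add: rexp_def)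
next
  case (Suc n)
  let ?u = "rotation W S J s t"
  let ?f = "\<lambda>i. [Remove (?u (int i)), Add (?u (int i - 1))]"
  have u: "?u (int (Suc n)) = rcur (Suc n)" "?u (int (Suc n) - 1) = rcur n"
    using rotation_nat[of "Suc n"] rotation_nat[of n] by simp_all
  have l: "last (rexp n) = vert n" using rexp_nth[of "2 * n" n]
    by (metis diff_Suc_1 last_conv_nth length_0_conv lessI nat.distinct(1) path_set_simps(1) rexp_length)
  have "concat (map ?f [1..<Suc (Suc n)]) = concat (map ?f [1..<Suc n]) @ [Remove (rcur (Suc n)), Add (rcur n)]"
    using u by simp
  then have "steps J (concat (map ?f [1..<Suc (Suc n)])) =
      rexp n @ tl (steps (vert n) [Remove (rcur (Suc n)), Add (rcur n)])"
    using Suc.IH l by (simp only: steps_append)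
  also have "\<dots> = rexp n @ [path_set (Suc (2 * n)), path_set (2 * Suc n)]"
    using vert_of_edge(1)[of n] edge_of_vert(1)[of n] by (simp only: path_set_simps) simp
  also have "\<dots> = rexp (Suc n)" by (simp add: rexp_def)
  finally show ?case .
qed

end

theorem proposition5p14:
  fixes W :: "('a, 'b) monoid_scheme" and S J I p :: "'a set" and s t w :: 'a and u :: "int \<Rightarrow> 'a"
  assumes "coxeter_system W S"
    and "s \<in> S" and "J \<subseteq> S" and "s \<notin> J"
    and "finitary W S (insert s J)"
    and "t \<in> insert s J"
    and "I = insert s J - {t}"
    and "w = longest W S (insert s J)"
    and "p = double_coset W J I w"
    and "u = rotation W S J s t"
  shows "(s = w \<otimes>\<^bsub>W\<^esub> t \<otimes>\<^bsub>W\<^esub> w \<longrightarrow>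
      reduced_expressions W S J I p = {steps J [Add s, Remove t]}) \<and>
    (s \<noteq> w \<otimes>\<^bsub>W\<^esub> t \<otimes>\<^bsub>W\<^esub> w \<longrightarrow>
      card (reduced_expressions W S J I p) = 2 \<and>
      (\<exists>\<delta>::nat.
        (\<forall>k. 1 \<le> k \<and> k \<le> \<delta> \<longrightarrow> reduced W S (rotation_expr (insert s J) u k)) \<and>
        (\<forall>d. (\<forall>k. 1 \<le> k \<and> k \<le> d \<longrightarrow> reduced W S (rotation_expr (insert s J) u k)) \<longrightarrow> d \<le> \<delta>) \<and>
        u (int \<delta>) = t \<and>
        steps J (concat (map (\<lambda>i. [Remove (u (int i)), Add (u (int i - 1))]) [1..<\<delta>])
                 @ [Remove t, Add (u (int \<delta> - 1))])
          = rotation_expr (insert s J) u \<delta> \<and>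
        same_coset W S (steps J [Add s, Remove t]) (rotation_expr (insert s J) u \<delta>) \<and>
        reduced_expressions W S J I p =
          {steps J [Add s, Remove t], rotation_expr (insert s J) u \<delta>} \<and>
        u (int \<delta> + 1) = w \<otimes>\<^bsub>W\<^esub> s \<otimes>\<^bsub>W\<^esub> w))"
proof -
  interpret coxeter_system W S by fact
  interpret switchback W S s J t by unfold_locales fact+
  have short: "steps J [Add s, Remove t] \<in> reduced_expressions W S J I p"
    using short_expression unfolding assms(7-9) .
  have up: "E = steps J [Add s, Remove t]" if "E \<in> reduced_expressions W S J I p" "E ! 1 = K" for E
    using up_first_unique[of E] target_length[of E] that unfolding assms(7-9) by blast
  show ?thesis
  proof (intro conjI impI)
    assume st: "s = w \<otimes>\<^bsub>W\<^esub> t \<otimes>\<^bsub>W\<^esub> w"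
    then have topp: "s = topp" by (simp only: assms(8))
    have "E ! 1 = K" if "E \<in> reduced_expressions W S J I p" for E
      using that down_first_proper[of E] topp unfolding assms(7-9) by blast
    then show "reduced_expressions W S J I p = {steps J [Add s, Remove t]}"
      using short up by blast
  next
    assume st: "s \<noteq> w \<otimes>\<^bsub>W\<^esub> t \<otimes>\<^bsub>W\<^esub> w"
    have "s \<noteq> topp" using st unfolding assms(8) .
    then interpret proper_switchback W S s J t by unfold_locales
    define d where "d = (LEAST n. \<not> advances n)"
    have stop: "\<not> advances d" unfolding d_def using ex_stop by (rule LeastI_ex)
    have adv: "\<forall>j<d. advances j" unfolding d_def using not_less_Least by blast
    have pos: "1 \<le> d" "rcur d = t" "rcur (Suc d) = sopp" using stop_types[OF adv stop] by auto
    have long: "rexp d \<in> reduced_expressions W S J I p" 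
      using long_expression[OF adv stop] unfolding assms(7-9) .
    have all: "reduced_expressions W S J I p = {steps J [Add s, Remove t], rexp d}"
    proof -
      have "E = rexp d" if "E \<in> reduced_expressions W S J I p" "E ! 1 \<noteq> K" for E
        using down_first_unique[OF _ that(2) adv stop] that(1) unfolding assms(7-9) by blast
      then show ?thesis using short long up by blast
    qed
    have "rcur 1 \<in> K" "rcur 1 \<notin> rexp d ! 1"
      using pos(1) path_set_simps(2)[of 0] edge_of_vert(3)[of 0] rot_mem[of 1] by simp_all
    then have "rexp d ! 1 \<noteq> steps J [Add s, Remove t] ! 1" by auto
    then have "steps J [Add s, Remove t] \<noteq> rexp d" by metis
    then show "card (reduced_expressions W S J I p) = 2" unfolding all by simp
    have rx: "rotation_expr (insert s J) u k = rexp k" for k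
      unfolding assms(10) by (rule rotation_expr_rexp)
    have ud: "u (int d) = t" using rotation_nat[of d] pos assms(10) by simp
    show "\<exists>\<delta>::nat.
        (\<forall>k. 1 \<le> k \<and> k \<le> \<delta> \<longrightarrow> reduced W S (rotation_expr (insert s J) u k)) \<and>
        (\<forall>d. (\<forall>k. 1 \<le> k \<and> k \<le> d \<longrightarrow> reduced W S (rotation_expr (insert s J) u k)) \<longrightarrow> d \<le> \<delta>) \<and>
        u (int \<delta>) = t \<and>
        steps J (concat (map (\<lambda>i. [Remove (u (int i)), Add (u (int i - 1))]) [1..<\<delta>])
                 @ [Remove t, Add (u (int \<delta> - 1))])
          = rotation_expr (insert s J) u \<delta> \<and>
        same_coset W S (steps J [Add s, Remove t]) (rotation_expr (insert s J) u \<delta>) \<and>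
        reduced_expressions W S J I p =
          {steps J [Add s, Remove t], rotation_expr (insert s J) u \<delta>} \<and>
        u (int \<delta> + 1) = w \<otimes>\<^bsub>W\<^esub> s \<otimes>\<^bsub>W\<^esub> w"
      unfolding rx
    proof (intro exI[of _ d] conjI allI impI)
      fix k assume "1 \<le> k \<and> k \<le> d"
      then show "reduced W S (rexp k)" using adv reduced_rexp_iff by simp
    next
      fix e assume *: "\<forall>k. 1 \<le> k \<and> k \<le> e \<longrightarrow> reduced W S (rexp k)"
      show "e \<le> d"
      proof (rule ccontr)
        assume "\<not> e \<le> d"
        then have "reduced W S (rexp e)" "d < e" using * by auto
        then show False using stop reduced_rexp_iff by blast
      qed
    next
      show "u (int d) = t" by (rule ud)
      have "[1..<Suc d] = [1..<d] @ [d]" using pos(1) by simp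
      then show "steps J (concat (map (\<lambda>i. [Remove (u (int i)), Add (u (int i - 1))]) [1..<d])
                 @ [Remove t, Add (u (int d - 1))]) = rexp d"
        using steps_rexp[of d] ud unfolding assms(10) by simp
      show "same_coset W S (steps J [Add s, Remove t]) (rexp d)"
        using short long unfolding same_coset_def reduced_expressions_def by blast
      show "reduced_expressions W S J I p = {steps J [Add s, Remove t], rexp d}" by (rule all)
      have "int d + 1 = int (Suc d)" by simp
      then show "u (int d + 1) = w \<otimes>\<^bsub>W\<^esub> s \<otimes>\<^bsub>W\<^esub> w"
        using rotation_nat[of "Suc d"] pos(3) unfolding assms(8,10) by (simp add: add.commute)
    qed
  qed
qed

end
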